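(* There is an algorithm which, given a positive integer $h$, an $h$-semicomplete digraph $G$ on $n$ vertices and a positive integer $k$, in $(h+2k+1)^{2k} n^{O(1)}$ time either constructs a path-decomposition of $G$ of width at most $k$ or concludes correctly that the pathwidth of $G$ is larger than $k$.
   Context: Digraphs are simple: no self-loops, and between each pair of distinct vertices at most one edge in each direction. A non-neighbor of a vertex $v$ is a vertex $u\neq v$ such that there is no edge between $u$ and $v$ in either direction. A digraph is $h$-semicomplete if each vertex has at most $h$ non-neighbors. A path-decomposition of a digraph $G$ is a sequence $(X_1,\dots,X_m)$ of subsets of $V(G)$ (bags) such that (1) $\bigcup_i X_i=V(G)$; (2) for each edge $(u,v)$ of $G$, there are $i\ge j$ with $u\in X_i$ and $v\in X_j$; (3) for every vertex $v$, the set $\{i : v\in X_i\}$ is an integer interval. Its width is $\max_i |X_i|-1$, and the pathwidth ${\rm pw}(G)$ is the minimum width of a path-decomposition of $G$. *)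

theory Defs
  imports "Graph_Theory.Pair_Digraph"
begin

section \<open>Semicomplete digraphs and pathwidth\<close>

text \<open>
  The library locale \<open>pair_digraph\<close> describes finite loopless digraphs whose arcs form a set of
  ordered pairs, hence with at most one arc in each direction between two vertices.
\<close>

definition non_neighbors :: "'a pair_pre_digraph \<Rightarrow> 'a \<Rightarrow> 'a set" where
  "non_neighbors G v = {u \<in> pverts G. u \<noteq> v \<and> (u, v) \<notin> parcs G \<and> (v, u) \<notin> parcs G}"

definition semicomplete :: "nat \<Rightarrow> 'a pair_pre_digraph \<Rightarrow> bool" where
  "semicomplete h G \<longleftrightarrow> (\<forall>v \<in> pverts G. card (non_neighbors G v) \<le> h)"

text \<open>
  Bags are indexed from 0. The sequence is required to be nonempty so that the maximum in the
  width exists; this matters only for the empty digraph, whose pathwidth is \<open>-1\<close>.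
\<close>

definition path_decomposition :: "'a pair_pre_digraph \<Rightarrow> 'a set list \<Rightarrow> bool" where
  "path_decomposition G Xs \<longleftrightarrow>
     Xs \<noteq> [] \<and>
     \<Union> (set Xs) = pverts G \<and>
     (\<forall>(u, v) \<in> parcs G. \<exists>i j. j \<le> i \<and> i < length Xs \<and> u \<in> Xs ! i \<and> v \<in> Xs ! j) \<and>
     (\<forall>v \<in> pverts G. \<exists>a b. {i. i < length Xs \<and> v \<in> Xs ! i} = {a..b})"

definition width :: "'a set list \<Rightarrow> int" where
  "width Xs = int (Max (card ` set Xs)) - 1"

definition pathwidth :: "'a pair_pre_digraph \<Rightarrow> int" where
  "pathwidth G = (LEAST w. \<exists>Xs. path_decomposition G Xs \<and> width Xs = w)"

text \<open>The minimum exists, so the \<open>LEAST\<close> above denotes what it should.\<close>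

lemma pathwidth_is_minimum:
  assumes "pair_digraph G"
  shows "\<exists>Xs. path_decomposition G Xs \<and> width Xs = pathwidth G"
    and "path_decomposition G Xs \<Longrightarrow> pathwidth G \<le> width Xs"
proof -
  interpret pair_digraph G by fact
  let ?P = "\<lambda>Xs. path_decomposition G Xs"
  let ?m = "\<lambda>Xs :: 'a set list. Max (card ` set Xs)"
  have "{i. i < length [pverts G] \<and> v \<in> [pverts G] ! i} = {0..0}" if "v \<in> pverts G" for v
    using that by auto
  then have interval: "\<forall>v \<in> pverts G. \<exists>a b. {i. i < length [pverts G] \<and> v \<in> [pverts G] ! i} = {a..b}"
    by blast
  have "\<exists>i j. j \<le> i \<and> i < length [pverts G] \<and> u \<in> [pverts G] ! i \<and> v \<in> [pverts G] ! j"
    if "(u, v) \<in> parcs G" for u v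
    using in_arcsD1[OF that] in_arcsD2[OF that] by (intro exI[of _ 0]) simp
  with interval have "?P [pverts G]"
    unfolding path_decomposition_def by auto
  then obtain Xs where Xs: "?P Xs" "\<And>Ys. ?P Ys \<Longrightarrow> ?m Xs \<le> ?m Ys"
    using ex_has_least_nat[of ?P _ ?m] by blast
  have min: "width Xs \<le> width Ys" if "?P Ys" for Ys
    using Xs(2)[OF that] by (simp add: width_def)
  have eq: "pathwidth G = width Xs"
    unfolding pathwidth_def by (rule Least_equality) (use Xs(1) min in blast)+
  show "\<exists>Xs. ?P Xs \<and> width Xs = pathwidth G" using Xs eq by auto
  show "?P Ys \<Longrightarrow> pathwidth G \<le> width Ys" for Ys using min by (simp add: eq)
qed


section \<open>Model of computation\<close>

text \<open>
  Algorithms are programs of a first-order, call-by-value functional language whose only data are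
  binary trees, in the style of N. D. Jones, Computability and Complexity. A program is a finite
  list of function bodies together with a main expression; a call \<open>Call f es\<close> refers to the
  \<open>f\<close>-th body, and variables are positions in the list of current bindings. Every construct costs
  one unit. There is no arithmetic and no equality test on trees: one step only allocates a cell,
  follows a pointer, tests for \<open>Atom\<close>, or binds finitely many variables (a number bounded by the
  size of the program). Hence, with trees represented by shared pointers, a run of cost \<open>t\<close> is
  executed by a random access machine in \<open>O(t)\<close> steps, for every fixed program.
\<close>

datatype val = Atom | Cell val val

fun left :: "val \<Rightarrow> val" where
  "left Atom = Atom"
| "left (Cell a b) = a"

fun right :: "val \<Rightarrow> val" where
  "right Atom = Atom"
| "right (Cell a b) = b"

datatype expr =
    Var nat
  | Mk_Atom
  | Mk_Cell expr expr
  | Left expr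
  | Right expr
  | If_Atom expr expr expr
  | Bind expr expr
  | Call nat "expr list"

text \<open>
  \<open>evaluates P env e v t\<close>: with function bodies \<open>P\<close> and bindings \<open>env\<close>, the expression \<open>e\<close>
  terminates with value \<open>v\<close> at cost \<open>t\<close>.
\<close>

inductive evaluates :: "expr list \<Rightarrow> val list \<Rightarrow> expr \<Rightarrow> val \<Rightarrow> nat \<Rightarrow> bool"
  and evaluates_list :: "expr list \<Rightarrow> val list \<Rightarrow> expr list \<Rightarrow> val list \<Rightarrow> nat \<Rightarrow> bool"
  for P :: "expr list"
  where
  ev_Var: "i < length env \<Longrightarrow> evaluates P env (Var i) (env ! i) 1"
| ev_Atom: "evaluates P env Mk_Atom Atom 1"
| ev_Cell: "\<lbrakk>evaluates P env e1 v1 t1; evaluates P env e2 v2 t2\<rbrakk>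
    \<Longrightarrow> evaluates P env (Mk_Cell e1 e2) (Cell v1 v2) (t1 + t2 + 1)"
| ev_Left: "evaluates P env e v t \<Longrightarrow> evaluates P env (Left e) (left v) (t + 1)"
| ev_Right: "evaluates P env e v t \<Longrightarrow> evaluates P env (Right e) (right v) (t + 1)"
| ev_If_Atom: "\<lbrakk>evaluates P env e Atom t; evaluates P env e1 v t1\<rbrakk>
    \<Longrightarrow> evaluates P env (If_Atom e e1 e2) v (t + t1 + 1)"
| ev_If_Cell: "\<lbrakk>evaluates P env e (Cell a b) t; evaluates P env e2 v t2\<rbrakk>
    \<Longrightarrow> evaluates P env (If_Atom e e1 e2) v (t + t2 + 1)"
| ev_Bind: "\<lbrakk>evaluates P env e1 v1 t1; evaluates P (v1 # env) e2 v2 t2\<rbrakk>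
    \<Longrightarrow> evaluates P env (Bind e1 e2) v2 (t1 + t2 + 1)"
| ev_Call: "\<lbrakk>f < length P; evaluates_list P env es vs t1; evaluates P vs (P ! f) v t2\<rbrakk>
    \<Longrightarrow> evaluates P env (Call f es) v (t1 + t2 + 1)"
| ev_Nil: "evaluates_list P env [] [] 0"
| ev_Cons: "\<lbrakk>evaluates P env e v t1; evaluates_list P env es vs t2\<rbrakk>
    \<Longrightarrow> evaluates_list P env (e # es) (v # vs) (t1 + t2)"

inductive_cases evaluates_VarE: "evaluates P env (Var i) v t"
inductive_cases evaluates_AtomE: "evaluates P env Mk_Atom v t"
inductive_cases evaluates_CellE: "evaluates P env (Mk_Cell e1 e2) v t"
inductive_cases evaluates_LeftE: "evaluates P env (Left e) v t"
inductive_cases evaluates_RightE: "evaluates P env (Right e) v t"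
inductive_cases evaluates_IfE: "evaluates P env (If_Atom e e1 e2) v t"
inductive_cases evaluates_BindE: "evaluates P env (Bind e1 e2) v t"
inductive_cases evaluates_CallE: "evaluates P env (Call f es) v t"
inductive_cases evaluates_NilE: "evaluates_list P env [] vs t"
inductive_cases evaluates_ConsE: "evaluates_list P env (e # es) vs t"

lemma evaluates_deterministic:
  "evaluates P env e v t \<Longrightarrow> evaluates P env e v' t' \<Longrightarrow> v' = v \<and> t' = t"
  "evaluates_list P env es vs t \<Longrightarrow> evaluates_list P env es vs' t' \<Longrightarrow> vs' = vs \<and> t' = t"
proof (induction arbitrary: v' t' and vs' t' rule: evaluates_evaluates_list.inducts)
  case ev_Var then show ?case by (elim evaluates_VarE) simp
next
  case ev_Atom then show ?case by (elim evaluates_AtomE) simp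
next
  case ev_Cell from ev_Cell.prems show ?case
    by (rule evaluates_CellE) (metis ev_Cell.IH val.distinct(1) Suc_eq_plus1)+
next
  case ev_Left from ev_Left.prems show ?case
    by (rule evaluates_LeftE) (metis ev_Left.IH val.distinct(1) Suc_eq_plus1)+
next
  case ev_Right from ev_Right.prems show ?case
    by (rule evaluates_RightE) (metis ev_Right.IH val.distinct(1) Suc_eq_plus1)+
next
  case ev_If_Atom from ev_If_Atom.prems show ?case
    by (rule evaluates_IfE) (metis ev_If_Atom.IH val.distinct(1) Suc_eq_plus1)+
next
  case ev_If_Cell from ev_If_Cell.prems show ?case
    by (rule evaluates_IfE) (metis ev_If_Cell.IH val.distinct(1) Suc_eq_plus1)+
next
  case ev_Bind from ev_Bind.prems show ?case
    by (rule evaluates_BindE) (metis ev_Bind.IH val.distinct(1) Suc_eq_plus1)+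
next
  case ev_Call from ev_Call.prems show ?case
    by (rule evaluates_CallE) (metis ev_Call.IH val.distinct(1) Suc_eq_plus1)+
next
  case ev_Nil then show ?case by (elim evaluates_NilE) simp
next
  case ev_Cons from ev_Cons.prems show ?case
    by (rule evaluates_ConsE) (metis ev_Cons.IH val.distinct(1) Suc_eq_plus1)+
qed


section \<open>Input and output\<close>

text \<open>
  Numbers are written in unary. Time is measured in \<open>h\<close>, \<open>k\<close> and \<open>n\<close> rather than in the length of
  the input, so this does not relax the time bound.
\<close>

primrec enc_nat :: "nat \<Rightarrow> val" where
  "enc_nat 0 = Atom"
| "enc_nat (Suc n) = Cell Atom (enc_nat n)"

primrec enc_list :: "val list \<Rightarrow> val" where
  "enc_list [] = Atom"
| "enc_list (x # xs) = Cell x (enc_list xs)"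

definition enc_bool :: "bool \<Rightarrow> val" where
  "enc_bool b = (if b then Cell Atom Atom else Atom)"

text \<open>The adjacency matrix of a digraph with vertices \<open>0, \<dots>, n - 1\<close>, row by row.\<close>

definition enc_digraph :: "nat \<Rightarrow> nat pair_pre_digraph \<Rightarrow> val" where
  "enc_digraph n G =
     enc_list (map (\<lambda>u. enc_list (map (\<lambda>v. enc_bool ((u, v) \<in> parcs G)) [0..<n])) [0..<n])"

text \<open>
  An answer is either \<open>None\<close>, meaning that the pathwidth is too large, or a sequence of bags,
  each bag being listed without repetitions.
\<close>

fun enc_answer :: "nat list list option \<Rightarrow> val" where
  "enc_answer None = Atom"
| "enc_answer (Some bags) = Cell Atom (enc_list (map (\<lambda>b. enc_list (map enc_nat b)) bags))"

fun correct_answer :: "nat pair_pre_digraph \<Rightarrow> nat \<Rightarrow> nat list list option \<Rightarrow> bool" where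
  "correct_answer G k None \<longleftrightarrow> pathwidth G > int k"
| "correct_answer G k (Some bags) \<longleftrightarrow>
     (\<forall>b \<in> set bags. distinct b) \<and>
     path_decomposition G (map set bags) \<and> width (map set bags) \<le> int k"

end

theory Submission
  imports Defs
begin

text \<open>
  Let \<open>f S\<close> be the number of vertices outside \<open>S\<close> with an arc into \<open>S\<close>. The pathwidth is at most \<open>k\<close>
  iff the vertices can be added one by one to the empty set so that always \<open>f \<le> k\<close>: the vertex added
  last at some stage together with the vertices counted by \<open>f\<close> is a bag, and the bags are listed
  backwards. The function \<open>f\<close> is submodular, hence if \<open>f W \<le> f S\<close> for all \<open>X \<subseteq> S \<subseteq> W\<close> (\<open>W\<close> is
  \<open>good\<close> for \<open>X\<close>), then replacing \<open>X\<close> by \<open>W\<close> loses no solution.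

  The algorithm keeps a tree of partial solutions along whose branches \<open>f\<close> strictly increases, so that
  its height is at most \<open>k\<close>. In each round every leaf grows by a vertex or branches over all vertices
  that can be added; in an \<open>h\<close>-semicomplete digraph these are at most \<open>h + 2k + 1\<close>, because each has
  at most \<open>k\<close> in-neighbours among them. When below a node \<open>X\<close> a set \<open>L\<close> with \<open>f L \<le> f X\<close> shows up,
  \<open>X\<close> can be replaced. Replacing it by \<open>L\<close> would be wrong in general. Instead let \<open>W\<close> minimize \<open>f\<close>
  between \<open>X\<close> and \<open>L\<close>; then \<open>W\<close> is good and reachable from \<open>X\<close> in the order of \<open>L\<close>, and following
  that order down the tree leads to a subtree whose root contains \<open>W\<close>, or to a leaf, to which the rest
  of \<open>W\<close> is added. No leaf gets smaller, so \<open>n\<close> rounds suffice.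

  The minimizer is found by bipartite matching: \<open>f S + card S\<close> is the size of the closed
  in-neighbourhood of \<open>S\<close>, so \<open>L\<close> itself is a minimizer iff Hall's condition holds between the closed
  in-neighbours that \<open>L\<close> has in addition to those of \<open>X\<close>, and \<open>L - X\<close>; in general \<open>W\<close> arises from \<open>L\<close>
  by deleting the neighbours of a maximal violator.
\<close>

section \<open>Partial solutions of a submodular function\<close>

locale submodular =
  fixes V :: "nat set" and f :: "nat set \<Rightarrow> nat" and k :: nat
  assumes submod: "f (A \<union> B) + f (A \<inter> B) \<le> f A + f B"
    and finite_V: "finite V"
begin

definition good :: "nat set \<Rightarrow> nat set \<Rightarrow> bool" where
  "good X W \<longleftrightarrow> X \<subseteq> W \<and> (\<forall>S. X \<subseteq> S \<longrightarrow> S \<subseteq> W \<longrightarrow> f W \<le> f S)"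

lemma good_subset: "good X W \<Longrightarrow> X \<subseteq> W"
  by (simp add: good_def)

lemma good_refl [simp]: "good X X"
  by (auto simp: good_def dest: subset_antisym)

text \<open>\<open>Z \<inter> W\<close> lies between \<open>X\<close> and \<open>W\<close>, so its
  value is at least \<open>f W\<close>; cancelling these two terms in the submodular inequality for
  \<open>Z\<close> and \<open>W\<close> leaves the claim.\<close>

lemma good_union:
  assumes "good X W" "X \<subseteq> Z"
  shows "f (Z \<union> W) \<le> f Z"
proof -
  have "f W \<le> f (Z \<inter> W)" using assms by (auto simp: good_def)
  with submod[of Z W] show ?thesis by linarith
qed

text \<open>A set \<open>T\<close> of the new interval satisfies
  \<open>T \<union> W = S \<union> W\<close>, so \<open>good_union\<close> for \<open>T\<close> is
  already the claim.\<close>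

lemma good_extend:
  assumes "good X W" "X \<subseteq> S"
  shows "good S (S \<union> W)"
  unfolding good_def
proof (intro conjI allI impI)
  fix T assume T: "S \<subseteq> T" "T \<subseteq> S \<union> W"
  then have "T \<union> W = S \<union> W" by auto
  with good_union[OF assms(1), of T] assms T show "f (S \<union> W) \<le> f T" by auto
qed simp

text \<open>Enlarging \<open>S\<close> to \<open>S \<union> Y\<close> does not raise
  \<open>f\<close>, by goodness of \<open>Y\<close>, and leads into the interval from
  \<open>Y\<close> to \<open>Z\<close>, where \<open>Z\<close> is minimal.\<close>

lemma good_trans:
  assumes "good X Y" "good Y Z"
  shows "good X Z"
  unfolding good_def
proof (intro conjI allI impI)
  show "X \<subseteq> Z" using assms by (auto simp: good_def)
  fix S assume S: "X \<subseteq> S" "S \<subseteq> Z"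
  have "f Z \<le> f (S \<union> Y)" using assms S by (auto simp: good_def)
  also have "\<dots> \<le> f S" using good_union[OF assms(1) S(1)] .
  finally show "f Z \<le> f S" .
qed

lemma good_step: "f (insert v X) \<le> f X \<Longrightarrow> good X (insert v X)"
  unfolding good_def by (metis insert_subset subset_antisym subset_insert subset_insertI order_refl)

text \<open>Only the sets after an insertion are tested, not the starting set; hence the separate
  conditions on it in \<open>feasible_last\<close> and \<open>seq\<close>.\<close>

primrec feasible :: "nat set \<Rightarrow> nat list \<Rightarrow> bool" where
  "feasible X [] \<longleftrightarrow> True"
| "feasible X (v # vs) \<longleftrightarrow> f (insert v X) \<le> k \<and> feasible (insert v X) vs"

lemma feasible_append: "feasible X (vs @ ws) \<longleftrightarrow> feasible X vs \<and> feasible (X \<union> set vs) ws"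
  by (induction vs arbitrary: X) auto

text \<open>Every stage of the order contains \<open>X\<close>, so by \<open>good_union\<close>
  adding \<open>W\<close> to all stages raises no value.\<close>

lemma feasible_union_good:
  "feasible Z vs \<Longrightarrow> good X W \<Longrightarrow> X \<subseteq> Z \<Longrightarrow> feasible (Z \<union> W) vs"
proof (induction vs arbitrary: Z)
  case (Cons v vs)
  have "f (insert v Z \<union> W) \<le> f (insert v Z)"
    using Cons.prems by (intro good_union) auto
  moreover have "feasible (insert v Z \<union> W) vs"
    using Cons.prems by (intro Cons.IH) auto
  ultimately show ?case using Cons.prems(1) by simp
qed simp

lemma feasible_filter: "feasible Z vs \<Longrightarrow> S \<subseteq> Z \<Longrightarrow> feasible Z (filter (\<lambda>x. x \<notin> S) vs)"
proof (induction vs arbitrary: Z)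
  case (Cons v vs)
  have "feasible (insert v Z) (filter (\<lambda>x. x \<notin> S) vs)"
    using Cons.prems by (intro Cons.IH) auto
  with Cons.prems show ?case by (cases "v \<in> S") (auto simp: insert_absorb subset_iff)
qed simp

lemma feasible_last: "feasible X vs \<Longrightarrow> f X \<le> k \<Longrightarrow> f (X \<union> set vs) \<le> k"
proof (induction vs arbitrary: X)
  case (Cons v vs)
  then have "f (insert v X \<union> set vs) \<le> k" by (intro Cons.IH) auto
  then show ?case by simp
qed simp

text \<open>The dual of \<open>feasible_union_good\<close>: stages are intersected with
  \<open>W\<close>. A stage united with \<open>W\<close> stays between \<open>X\<close> and
  \<open>L\<close>, so its value is at least \<open>f W\<close>, and submodularity bounds the
  intersection by the stage. This is why a minimizer below \<open>L\<close> can be reached in the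
  order of \<open>L\<close>.\<close>

lemma feasible_restrict_minimizer:
  assumes "feasible P zs" "X \<subseteq> P" "P \<union> set zs \<subseteq> L" "W \<subseteq> L"
    and min: "\<And>S. X \<subseteq> S \<Longrightarrow> S \<subseteq> L \<Longrightarrow> f W \<le> f S"
  shows "feasible (P \<inter> W) (filter (\<lambda>x. x \<in> W) zs)"
  using assms(1-4)
proof (induction zs arbitrary: P)
  case (Cons z zs)
  have IH: "feasible (insert z P \<inter> W) (filter (\<lambda>x. x \<in> W) zs)"
    using Cons by auto
  have "f W \<le> f (insert z P \<union> W)" using Cons.prems by (intro min) auto
  with submod[of "insert z P" W] Cons.prems(1)
  have "f (insert z P \<inter> W) \<le> k" by simp
  with IH show ?case by auto
qed simp

definition alive :: "nat set \<Rightarrow> bool" where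
  "alive X \<longleftrightarrow> (\<exists>vs. feasible X vs \<and> X \<union> set vs = V)"

lemma alive_good:
  assumes "alive X" "good X W" "W \<subseteq> V"
  shows "alive W"
proof -
  from assms(1) obtain vs where vs: "feasible X vs" "X \<union> set vs = V" by (auto simp: alive_def)
  have "feasible (X \<union> W) vs" using feasible_union_good[OF vs(1) assms(2)] by simp
  moreover have "X \<union> W = W" using good_subset[OF assms(2)] by auto
  ultimately show ?thesis using vs(2) assms(2,3) good_subset[OF assms(2)]
    by (auto simp: alive_def intro!: exI[of _ vs])
qed

lemma alive_feasible: "feasible X vs \<Longrightarrow> alive (X \<union> set vs) \<Longrightarrow> alive X"
  unfolding alive_def by (metis feasible_append set_append Un_assoc)

text \<open>A completing order may start with vertices of \<open>X\<close>; these are skipped, and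
  the first new vertex is the wanted one.\<close>

lemma alive_step:
  assumes "alive X" "X \<noteq> V"
  obtains v where "v \<in> V - X" "f (insert v X) \<le> k" "alive (insert v X)"
proof -
  from assms(1) obtain vs where "feasible X vs" "X \<union> set vs = V" by (auto simp: alive_def)
  then have "\<exists>v \<in> V - X. f (insert v X) \<le> k \<and> alive (insert v X)"
  proof (induction vs)
    case Nil with assms(2) show ?case by simp
  next
    case (Cons v vs)
    show ?case
    proof (cases "v \<in> X")
      case True with Cons show ?thesis by (auto simp: insert_absorb)
    next
      case False with Cons.prems show ?thesis
        by (intro bexI[of _ v]) (auto simp: alive_def)
    qed
  qed
  with that show thesis by blast
qed

end

section \<open>Trees of partial solutions and walks in them\<close>

datatype tree = Node (seed: nat) (taken: "nat list") (kids: "tree list")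

lemma size_less_size_list: "t \<in> set ts \<Longrightarrow> size t < Suc (size_list size ts)"
  by (induction ts) auto

text \<open>A kid is addressed by its \<open>seed\<close>, the vertex on which its parent branched,
  which stays fixed when the kid's own set grows. The result has at most one element and stands for
  an option: the empty list reports that the required kid is missing. Since \<open>taken\<close>
  lists the newest vertex first, the rest of the order is reversed at a leaf.\<close>

function follow :: "tree \<Rightarrow> nat list \<Rightarrow> tree list" where
  "follow (Node v Z ts) ws =
    (case filter (\<lambda>x. x \<notin> set Z) ws of
       [] \<Rightarrow> [Node v Z ts]
     | u # us \<Rightarrow>
         (if ts = [] then [Node v (rev (u # us) @ Z) []]
          else (case filter (\<lambda>t. seed t = u) ts of [] \<Rightarrow> [] | t # _ \<Rightarrow> follow t us)))"
  by pat_completeness auto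
termination
proof (relation "measure (size \<circ> fst)", goal_cases)
  case (2 v Z ts ws u us t r)
  then have "t \<in> set (filter (\<lambda>t. seed t = u) ts)" by simp
  then have "t \<in> set ts" by simp
  from size_less_size_list[OF this] show ?case by simp
qed simp

declare follow.simps [simp del]

context submodular
begin

text \<open>The last conjunct matters for the empty list, where \<open>feasible\<close> tests
  nothing.\<close>

definition seq :: "nat list \<Rightarrow> bool" where
  "seq X \<longleftrightarrow> distinct X \<and> set X \<subseteq> V \<and> feasible {} (rev X) \<and> f (set X) \<le> k"

text \<open>The invariant after \<open>i\<close> rounds. A kid may have moved from its branch set to
  a set that is good for it, and a branch may be absent once it is known not to be alive.\<close>

inductive tinv :: "nat \<Rightarrow> tree \<Rightarrow> bool" for i where
  tinv_leaf: "seq X \<Longrightarrow> i \<le> length X \<Longrightarrow> tinv i (Node v X [])"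
| tinv_node: "\<lbrakk>seq X; ts \<noteq> []; distinct (map seed ts);
    \<And>t. t \<in> set ts \<Longrightarrow> tinv i t \<and> (\<exists>ys. taken t = ys @ X) \<and> seed t \<in> V - set X \<and>
       f (insert (seed t) (set X)) \<le> k \<and> good (insert (seed t) (set X)) (set (taken t));
    \<And>t. t \<in> set ts \<Longrightarrow> f (set X) < f (set (taken t));
    \<And>v. v \<in> V - set X \<Longrightarrow> f (insert v (set X)) \<le> k \<Longrightarrow> alive (insert v (set X)) \<Longrightarrow> v \<in> seed ` set ts\<rbrakk>
   \<Longrightarrow> tinv i (Node v X ts)"

text \<open>The part of \<open>tinv\<close> that survives when all kids are advanced; the strict
  increase of \<open>f\<close> from the parent to its kids can be lost there and is restored by
  \<open>settle\<close>.\<close>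

definition kinv :: "nat \<Rightarrow> nat list \<Rightarrow> tree list \<Rightarrow> bool" where
  "kinv i X ts \<longleftrightarrow> distinct (map seed ts) \<and>
    (\<forall>t \<in> set ts. tinv i t \<and> (\<exists>ys. taken t = ys @ X) \<and> seed t \<in> V - set X \<and>
       f (insert (seed t) (set X)) \<le> k \<and> good (insert (seed t) (set X)) (set (taken t))) \<and>
    (\<forall>v \<in> V - set X. f (insert v (set X)) \<le> k \<longrightarrow> alive (insert v (set X)) \<longrightarrow> v \<in> seed ` set ts)"

lemma tinv_iff:
  "tinv i (Node v X ts) \<longleftrightarrow>
    seq X \<and> (if ts = [] then i \<le> length X
             else kinv i X ts \<and> (\<forall>t \<in> set ts. f (set X) < f (set (taken t))))"
  unfolding kinv_def by (subst tinv.simps) auto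

lemma tinv_seq: "tinv i t \<Longrightarrow> seq (taken t)"
  by (cases t) (simp add: tinv_iff)

text \<open>The contract shared by \<open>follow\<close>, \<open>grow\<close>, \<open>settle\<close>
  and \<open>adv\<close>: an empty result certifies that nothing completes \<open>S\<close>, a tree
  loses no completion of \<open>S\<close>. The list \<open>X\<close> and the set \<open>S\<close>
  are separate because \<open>follow\<close> is asked for a set that can be larger than its starting
  node.\<close>

definition result_ok :: "nat \<Rightarrow> nat list \<Rightarrow> nat set \<Rightarrow> tree list \<Rightarrow> bool" where
  "result_ok i X S rs \<longleftrightarrow> (rs = [] \<longrightarrow> \<not> alive S) \<and>
     (rs \<noteq> [] \<longrightarrow> (\<exists>t. rs = [t] \<and> tinv i t \<and> (\<exists>ys. taken t = ys @ X) \<and> good S (set (taken t))))"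

lemma seq_extend:
  assumes "seq Z" "feasible (set Z) us" "distinct us" "set us \<inter> set Z = {}" "set us \<subseteq> V"
  shows "seq (rev us @ Z)"
proof -
  have "f (set Z \<union> set us) \<le> k"
    using feasible_last[OF assms(2)] assms(1) by (simp add: seq_def)
  with assms show ?thesis
    by (auto simp: seq_def feasible_append Un_commute)
qed

text \<open>One level of the walk, stated for \<open>kinv\<close> because it is used both inside the
  induction of \<open>follow_ok\<close> and at the root from which \<open>settle\<close> walks,
  where \<open>f\<close> need not increase strictly.\<close>

lemma follow_descend:
  assumes X: "seq X" and ts: "kinv i X ts" "u \<in> V" "u \<notin> set X"
    and feas: "feasible (set X) (u # us)" and ws: "distinct us" "set us \<subseteq> V"
    and IH: "\<And>t. \<lbrakk>t \<in> set ts; tinv i t; feasible (set (taken t)) us\<rbrakk>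
       \<Longrightarrow> result_ok i (taken t) (set (taken t) \<union> set us) (follow t us)"
  shows "result_ok i X (set X \<union> set (u # us))
    (case filter (\<lambda>t. seed t = u) ts of [] \<Rightarrow> [] | t # _ \<Rightarrow> follow t us)"
proof (cases "filter (\<lambda>t. seed t = u) ts")
  case Nil
  then have "u \<notin> seed ` set ts" by (auto simp: filter_empty_conv)
  \<comment> \<open>The kids cover every live branch, so a missing seed refutes the branch and with
    it every set reached through it.\<close>
  with ts feas have "\<not> alive (insert u (set X))" by (auto simp: kinv_def)
  moreover have "feasible (insert u (set X)) us" using feas by simp
  ultimately have "\<not> alive (insert u (set X) \<union> set us)" using alive_feasible by blast
  with Nil show ?thesis by (simp add: result_ok_def)
next
  case (Cons t rest)
  then have "t \<in> set (filter (\<lambda>t. seed t = u) ts)" by simp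
  then have t: "t \<in> set ts" "seed t = u" by auto
  then have T: "tinv i t" "\<exists>ys. taken t = ys @ X" "good (insert u (set X)) (set (taken t))"
    using ts by (auto simp: kinv_def)
  let ?S = "set X \<union> set (u # us)"
  \<comment> \<open>The kid may have outgrown its branch set; by goodness the rest of the order is
    feasible from the larger set too.\<close>
  have "feasible (insert u (set X) \<union> set (taken t)) us"
    using feas T(3) by (intro feasible_union_good[where X = "insert u (set X)"]) auto
  moreover have sub: "insert u (set X) \<subseteq> set (taken t)" using T(3) by (rule good_subset)
  ultimately have "feasible (set (taken t)) us" by (simp only: Un_absorb1)
  from IH[OF t(1) T(1) this]
  have R: "result_ok i (taken t) (set (taken t) \<union> set us) (follow t us)" .
  \<comment> \<open>The walk now aims at a set larger than \<open>?S\<close>; this set is good for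
    \<open>?S\<close>, so the change of target loses nothing.\<close>
  have "good ?S (?S \<union> set (taken t))" using T(3) by (rule good_extend) auto
  also have "?S \<union> set (taken t) = set (taken t) \<union> set us" using sub by auto
  finally have G: "good ?S (set (taken t) \<union> set us)" .
  have "set (taken t) \<union> set us \<subseteq> V" using tinv_seq[OF T(1)] ws by (auto simp: seq_def)
  then have "alive (set (taken t) \<union> set us)" if "alive ?S" using alive_good[OF that G] by simp
  moreover have "good ?S W" if "good (set (taken t) \<union> set us) W" for W
    using good_trans[OF G that] .
  moreover have "\<exists>ys. Y = ys @ X" if "\<exists>ys. Y = ys @ taken t" for Y using T(2) that by force
  ultimately have "result_ok i X ?S (follow t us)" using R unfolding result_ok_def by blast
  with Cons show ?thesis by simp
qed

lemma follow_ok: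
  assumes "tinv i t" "feasible (set (taken t)) ws" "distinct ws" "set ws \<subseteq> V"
  shows "result_ok i (taken t) (set (taken t) \<union> set ws) (follow t ws)"
  using assms
proof (induction t arbitrary: ws rule: tree.induct)
  case (Node v Z ts)
  let ?us = "filter (\<lambda>x. x \<notin> set Z) ws"
  have U: "set Z \<union> set ws = set Z \<union> set ?us" by auto
  have feas: "feasible (set Z) ?us" using Node.prems by (intro feasible_filter) auto
  have seqZ: "seq Z" using Node.prems by (simp add: tinv_iff)
  show ?case
  proof (cases ?us)
    case Nil
    with U have "set Z \<union> set ws = set Z" by simp
    with Nil Node.prems show ?thesis by (simp add: follow.simps result_ok_def)
  next
    case (Cons u us)
    have d: "distinct (u # us)" "set (u # us) \<subseteq> V" "set (u # us) \<inter> set Z = {}"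
      using Node.prems Cons[symmetric] by auto
    show ?thesis
    proof (cases "ts = []")
      case True
      have "seq (rev (u # us) @ Z)" by (rule seq_extend) (use seqZ feas Cons d in auto)
      moreover have "i \<le> length (rev (u # us) @ Z)" using Node.prems True by (simp add: tinv_iff)
      ultimately have "tinv i (Node v (rev (u # us) @ Z) [])" by (simp add: tinv_iff)
      moreover have "set Z \<union> set ws = set (rev (u # us) @ Z)" using U Cons by auto
      ultimately show ?thesis using Cons True by (auto simp: follow.simps result_ok_def)
    next
      case False
      have "result_ok i Z (set Z \<union> set (u # us))
         (case filter (\<lambda>t. seed t = u) ts of [] \<Rightarrow> [] | t # _ \<Rightarrow> follow t us)"
        by (rule follow_descend) (use Node False feas Cons d seqZ in \<open>auto simp: tinv_iff\<close>)
      with U Cons False show ?thesis by (simp add: follow.simps)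
    qed
  qed
qed

end

section \<open>Minimizers by bipartite matching\<close>

text \<open>
  Matchings are association lists keyed by vertices of \<open>A\<close>, newer pairs overriding older ones. An entry
  \<open>(q, M)\<close> of the stack stands for an alternating path: \<open>M\<close> covers the new vertex and all vertices
  covered by \<open>M0\<close> except \<open>q\<close>. If no free vertex is reached, the visited vertices, all covered by \<open>M0\<close>,
  become part of the dead region \<open>D0\<close>, which later searches need not enter.
\<close>

fun search :: "(nat \<Rightarrow> nat \<Rightarrow> bool) \<Rightarrow> nat list \<Rightarrow> (nat \<times> nat) list \<Rightarrow> nat list \<Rightarrow> nat \<Rightarrow>
    (nat \<times> (nat \<times> nat) list) list \<Rightarrow> nat list \<Rightarrow> (nat \<times> nat) list \<times> nat list" where
  "search adj A M0 D0 0 st vis = (M0, vis)"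
| "search adj A M0 D0 (Suc m) [] vis = (M0, vis)"
| "search adj A M0 D0 (Suc m) ((q, M) # st) vis =
    (let N = filter (\<lambda>l. l \<notin> set vis \<and> adj q l) A in
     case filter (\<lambda>l. map_of M l = None) N of
       l # _ \<Rightarrow> ((l, q) # M, D0)
     | [] \<Rightarrow> search adj A M0 D0 m (map (\<lambda>l. (the (map_of M l), (l, q) # M)) N @ st) (N @ vis))"

primrec matching :: "(nat \<Rightarrow> nat \<Rightarrow> bool) \<Rightarrow> nat list \<Rightarrow> nat \<Rightarrow> nat list \<Rightarrow>
    (nat \<times> nat) list \<times> nat list \<Rightarrow> (nat \<times> nat) list \<times> nat list" where
  "matching adj A m [] s = s"
| "matching adj A m (q # Q) s =
    matching adj A m Q (search adj A (fst s) (snd s) m [(q, fst s)] (snd s))"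

definition matched :: "(nat \<Rightarrow> nat \<Rightarrow> bool) \<Rightarrow> nat set \<Rightarrow> (nat \<rightharpoonup> nat) \<Rightarrow> bool" where
  "matched adj A m \<longleftrightarrow> (\<forall>l q. m l = Some q \<longrightarrow> l \<in> A \<and> adj q l) \<and> inj_on m (dom m)"

definition stuck :: "(nat \<Rightarrow> nat \<Rightarrow> bool) \<Rightarrow> nat set \<Rightarrow> nat set \<Rightarrow> nat \<Rightarrow> bool" where
  "stuck adj A D q \<longleftrightarrow> (\<forall>l \<in> A. adj q l \<longrightarrow> l \<in> D)"

text \<open>The unmatched vertices of \<open>Q\<close> and the mates of \<open>D\<close> have all
  their neighbours in \<open>D\<close>, so together they exceed their neighbourhood by at least the
  number of unmatched vertices. The last conjunct says that a dead region arises only from a failed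
  search.\<close>

definition matching_inv :: "(nat \<Rightarrow> nat \<Rightarrow> bool) \<Rightarrow> nat set \<Rightarrow> nat set \<Rightarrow>
    (nat \<rightharpoonup> nat) \<Rightarrow> nat set \<Rightarrow> bool" where
  "matching_inv adj A Q m D \<longleftrightarrow> matched adj A m \<and> ran m \<subseteq> Q \<and> D \<subseteq> dom m \<and>
     (\<forall>l \<in> D. \<forall>q. m l = Some q \<longrightarrow> stuck adj A D q) \<and> (\<forall>q \<in> Q - ran m. stuck adj A D q) \<and>
     (D \<noteq> {} \<longrightarrow> Q - ran m \<noteq> {})"

text \<open>Each alternative matching agrees with the original one outside the newly visited
  vertices, so the vertex exposed at a freshly reached \<open>l\<close> is the original mate of
  \<open>l\<close>. The last conjunct says that a reached vertex is exhausted or still waiting on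
  the stack.\<close>

definition search_inv :: "(nat \<Rightarrow> nat \<Rightarrow> bool) \<Rightarrow> nat set \<Rightarrow> (nat \<rightharpoonup> nat) \<Rightarrow> nat set \<Rightarrow> nat \<Rightarrow>
    (nat \<times> (nat \<times> nat) list) set \<Rightarrow> nat set \<Rightarrow> bool" where
  "search_inv adj A m D q0 st vis \<longleftrightarrow> D \<subseteq> vis \<and> vis \<subseteq> dom m \<and>
     (\<forall>(q, M) \<in> st. matched adj A (map_of M) \<and> dom (map_of M) = dom m \<and>
        q \<in> insert q0 (ran m) \<and> ran (map_of M) = insert q0 (ran m) - {q} \<and>
        (\<forall>l. l \<notin> vis \<or> l \<in> D \<longrightarrow> map_of M l = m l)) \<and>
     (\<forall>q. q = q0 \<or> (\<exists>l \<in> vis - D. m l = Some q) \<longrightarrow> stuck adj A vis q \<or> q \<in> fst ` st)"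

lemma inj_on_upd:
  assumes "inj_on m (dom m)" "q \<notin> ran m"
  shows "inj_on (m(l \<mapsto> q)) (dom (m(l \<mapsto> q)))"
proof (rule inj_onI)
  fix x y assume "x \<in> dom (m(l \<mapsto> q))" "y \<in> dom (m(l \<mapsto> q))" "(m(l \<mapsto> q)) x = (m(l \<mapsto> q)) y"
  then show "x = y" using assms
    by (fastforce simp: inj_on_def ran_def dom_def split: if_splits)
qed

text \<open>By injectivity \<open>l\<close> is the only preimage of \<open>q'\<close>, so rerouting
  \<open>l\<close> exposes exactly that vertex.\<close>

lemma ran_upd_inj:
  assumes "inj_on m (dom m)" "m l = Some q'"
  shows "ran (m(l \<mapsto> q)) = insert q (ran m - {q'})"
proof (intro subset_antisym subsetI)
  fix x assume "x \<in> ran (m(l \<mapsto> q))"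
  then obtain y where "(m(l \<mapsto> q)) y = Some x" by (auto simp: ran_def)
  then show "x \<in> insert q (ran m - {q'})"
    using assms inj_onD[OF assms(1), of y l]
    by (auto simp: ran_def dom_def split: if_splits)
next
  fix x assume x: "x \<in> insert q (ran m - {q'})"
  show "x \<in> ran (m(l \<mapsto> q))"
  proof (cases "x = q")
    case True then show ?thesis by (auto simp: ran_def)
  next
    case False
    with x obtain y where "m y = Some x" "x \<noteq> q'" by (auto simp: ran_def)
    with assms(2) have "(m(l \<mapsto> q)) y = Some x" by auto
    then show ?thesis by (rule ranI)
  qed
qed

text \<open>Giving \<open>l\<close> to \<open>q\<close> exposes the former mate of \<open>l\<close>,
  which is its original mate because \<open>l\<close> was unvisited. Afterwards \<open>q\<close> is
  exhausted, and the vertices that become reached are those of the pushed entries.\<close>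

lemma search_step:
  assumes A: "distinct A" and m: "matching_inv adj (set A) Q m D" "q0 \<notin> Q"
    and inv: "search_inv adj (set A) m D q0 (insert (q, M) st) vis"
    and N: "N = {l \<in> set A. l \<notin> vis \<and> adj q l}" "\<forall>l \<in> N. map_of M l \<noteq> None"
  shows "search_inv adj (set A) m D q0 ((\<lambda>l. (the (map_of M l), (l, q) # M)) ` N \<union> st) (N \<union> vis)"
proof -
  have M: "matched adj (set A) (map_of M)" "dom (map_of M) = dom m" "q \<in> insert q0 (ran m)"
    "ran (map_of M) = insert q0 (ran m) - {q}" "\<forall>l. l \<notin> vis \<or> l \<in> D \<longrightarrow> map_of M l = m l"
    "D \<subseteq> vis" "vis \<subseteq> dom m"
    using inv by (auto simp: search_inv_def)
  have inj: "inj_on (map_of M) (dom (map_of M))" using M(1) by (simp add: matched_def)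
  have new: "matched adj (set A) (map_of ((l, q) # M)) \<and> dom (map_of ((l, q) # M)) = dom m \<and>
        r \<in> insert q0 (ran m) \<and> ran (map_of ((l, q) # M)) = insert q0 (ran m) - {r} \<and>
        (\<forall>x. x \<notin> N \<union> vis \<or> x \<in> D \<longrightarrow> map_of ((l, q) # M) x = m x) \<and> m l = Some r"
    if l: "l \<in> N" and r: "r = the (map_of M l)" for l r
  proof (intro conjI)
    have Ml: "map_of M l = Some r" "l \<notin> vis" "l \<in> set A" "adj q l" using l r N by auto
    then show "m l = Some r" using M(5) by auto
    have "q \<notin> ran (map_of M)" using M(4) by auto
    with inj have "inj_on ((map_of M)(l \<mapsto> q)) (dom ((map_of M)(l \<mapsto> q)))" by (rule inj_on_upd)
    then show "matched adj (set A) (map_of ((l, q) # M))"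
      using M(1) Ml by (auto simp: matched_def split: if_splits)
    show "dom (map_of ((l, q) # M)) = dom m" using M(2) Ml(1) by auto
    have rM: "r \<in> ran (map_of M)" using Ml(1) by (rule ranI)
    then show "r \<in> insert q0 (ran m)" using M(4) by auto
    have "ran (map_of ((l, q) # M)) = insert q (ran (map_of M) - {r})"
      using ran_upd_inj[OF inj Ml(1)] by simp
    then show "ran (map_of ((l, q) # M)) = insert q0 (ran m) - {r}" using M(3,4) rM by auto
    show "\<forall>x. x \<notin> N \<union> vis \<or> x \<in> D \<longrightarrow> map_of ((l, q) # M) x = m x"
      using M(5,6) l Ml by auto
  qed
  have Nm: "N \<subseteq> dom m" using new by auto
  have stk: "stuck adj (set A) (N \<union> vis) q" using N by (auto simp: stuck_def)
  have mono: "stuck adj (set A) vis r \<Longrightarrow> stuck adj (set A) (N \<union> vis) r" for r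
    by (auto simp: stuck_def)
  let ?new = "(\<lambda>l. (the (map_of M l), (l, q) # M)) ` N"
  have 1: "\<forall>r. r = q0 \<or> (\<exists>l \<in> N \<union> vis - D. m l = Some r) \<longrightarrow>
      stuck adj (set A) (N \<union> vis) r \<or> r \<in> fst ` (?new \<union> st)"
  proof (intro allI impI)
    fix r assume r: "r = q0 \<or> (\<exists>l \<in> N \<union> vis - D. m l = Some r)"
    show "stuck adj (set A) (N \<union> vis) r \<or> r \<in> fst ` (?new \<union> st)"
    proof (cases "\<exists>l \<in> N. m l = Some r")
      case True
      then obtain l where l: "l \<in> N" "m l = Some r" by blast
      then have "map_of M l = Some r" using M(5) N by auto
      with l have "(r, (l, q) # M) \<in> ?new" by (intro image_eqI[of _ _ l]) auto
      then show ?thesis by force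
    next
      case False
      with r have "r = q0 \<or> (\<exists>l \<in> vis - D. m l = Some r)" by auto
      then have "stuck adj (set A) vis r \<or> r \<in> fst ` insert (q, M) st"
        using inv unfolding search_inv_def by blast
      with stk mono show ?thesis by auto
    qed
  qed
  have 2: "case e of (q, M) \<Rightarrow> matched adj (set A) (map_of M) \<and> dom (map_of M) = dom m \<and>
        q \<in> insert q0 (ran m) \<and> ran (map_of M) = insert q0 (ran m) - {q} \<and>
        (\<forall>l. l \<notin> N \<union> vis \<or> l \<in> D \<longrightarrow> map_of M l = m l)" if e: "e \<in> ?new \<union> st" for e
    using e
  proof
    assume "e \<in> ?new"
    then obtain l where "l \<in> N" "e = (the (map_of M l), (l, q) # M)" by blast
    with new[OF this(1) refl] show ?thesis by (simp only: prod.case) blast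
  next
    assume "e \<in> st"
    then have e': "e \<in> insert (q, M) st" by simp
    obtain r R where "e = (r, R)" by fastforce
    have "\<forall>e \<in> insert (q, M) st. case e of (q, M) \<Rightarrow> matched adj (set A) (map_of M) \<and>
        dom (map_of M) = dom m \<and> q \<in> insert q0 (ran m) \<and>
        ran (map_of M) = insert q0 (ran m) - {q} \<and>
        (\<forall>l. l \<notin> vis \<or> l \<in> D \<longrightarrow> map_of M l = m l)"
      using inv unfolding search_inv_def by (elim conjE)
    from bspec[OF this e'] show ?thesis by (simp add: \<open>e = (r, R)\<close>)
  qed
  have 3: "D \<subseteq> N \<union> vis" "N \<union> vis \<subseteq> dom m" using M(6,7) Nm by auto
  show ?thesis unfolding search_inv_def by (rule conjI 3 ballI 1 2 | assumption)+
qed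

text \<open>The fuel is measured by the stack entries plus the covered vertices not yet visited.
  Each pushed entry is paid for by a newly visited vertex, so a step lowers the sum by one.\<close>

lemma search_ok:
  assumes A: "distinct A" and m: "matching_inv adj (set A) Q (map_of M0) (set D)" "q0 \<notin> Q"
  shows "search_inv adj (set A) (map_of M0) (set D) q0 (set st) (set vis) \<Longrightarrow>
    length st + card (dom (map_of M0) - set vis) < fuel \<Longrightarrow>
    search adj A M0 D fuel st vis = (M', D') \<Longrightarrow>
    matching_inv adj (set A) (insert q0 Q) (map_of M') (set D')"
proof (induction fuel arbitrary: st vis)
  case (Suc fuel)
  let ?m = "map_of M0"
  have ran: "ran ?m \<subseteq> Q" "q0 \<notin> ran ?m" using m by (auto simp: matching_inv_def)
  show ?case
  proof (cases st)
    case Nil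
    \<comment> \<open>The search has failed: all reached vertices are exhausted, so the visited set
      becomes the dead region, and \<open>q0\<close> is the unmatched vertex that justifies
      it.\<close>
    with Suc.prems have eq: "M' = M0" "D' = vis" by auto
    have vis: "set D \<subseteq> set vis" "set vis \<subseteq> dom ?m"
      and stk: "\<And>q. q = q0 \<or> (\<exists>l \<in> set vis - set D. ?m l = Some q) \<Longrightarrow> stuck adj (set A) (set vis) q"
      using Suc.prems(1) Nil by (auto simp: search_inv_def)
    have mono: "stuck adj (set A) (set D) r \<Longrightarrow> stuck adj (set A) (set vis) r" for r
      using vis(1) by (auto simp: stuck_def)
    have "stuck adj (set A) (set vis) q" if "l \<in> set vis" "?m l = Some q" for l q
      using that stk mono m(1) unfolding matching_inv_def by blast
    moreover have "stuck adj (set A) (set vis) q" if "q \<in> insert q0 Q - ran ?m" for q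
      using that stk mono m(1) unfolding matching_inv_def by blast
    ultimately show ?thesis
      using m(1) vis(2) ran unfolding matching_inv_def eq by blast
  next
    case (Cons e st')
    obtain q M where e: "e = (q, M)" by fastforce
    let ?N = "filter (\<lambda>l. l \<notin> set vis \<and> adj q l) A"
    let ?F = "filter (\<lambda>l. map_of M l = None) ?N"
    have inv: "search_inv adj (set A) ?m (set D) q0 (insert (q, M) (set st')) (set vis)"
      using Suc.prems(1) Cons e by simp
    then have M: "matched adj (set A) (map_of M)" "dom (map_of M) = dom ?m" "q \<in> insert q0 (ran ?m)"
      "ran (map_of M) = insert q0 (ran ?m) - {q}"
      "\<forall>l. l \<notin> set vis \<or> l \<in> set D \<longrightarrow> map_of M l = ?m l" "set D \<subseteq> set vis" "set vis \<subseteq> dom ?m"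
      by (auto simp: search_inv_def)
    show ?thesis
    proof (cases ?F)
      case (Cons l rest)
      then have "l \<in> set ?F" by simp
      then have l: "l \<in> set A" "adj q l" "map_of M l = None" by auto
      have eq: "M' = (l, q) # M" "D' = D"
        using Suc.prems(3) \<open>st = e # st'\<close> e Cons by auto
      have q: "q \<notin> ran (map_of M)" using M(4) by auto
      have ran': "ran (map_of M') = insert q0 (ran ?m)" using l(3) M(3,4) by (auto simp: eq)
      have inj: "inj_on (map_of M') (dom (map_of M'))"
        using inj_on_upd[OF _ q, of l] M(1) unfolding matched_def eq by simp
      then have "matched adj (set A) (map_of M')"
        using M(1) l unfolding matched_def eq by auto
      moreover have "ran (map_of M') \<subseteq> insert q0 Q" using ran ran' by auto
      moreover have D: "set D \<subseteq> dom ?m" using M(6,7) by blast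
      \<comment> \<open>The augmenting path does not change mates inside \<open>D\<close>, so the
        dead region survives.\<close>
      moreover have "map_of M' x = ?m x" if "x \<in> set D" for x
      proof -
        have "x \<noteq> l" using that D M(2) l(3) by auto
        with that M(5) show ?thesis by (simp add: eq)
      qed
      ultimately show ?thesis
        using m ran ran' unfolding matching_inv_def eq(2) by (intro conjI) (auto simp: dom_def subset_iff)
    next
      case Nil
      then have N: "\<forall>l \<in> set ?N. map_of M l \<noteq> None" unfolding filter_empty_conv by blast
      let ?new = "map (\<lambda>l. (the (map_of M l), (l, q) # M)) ?N"
      have inv': "search_inv adj (set A) ?m (set D) q0 (set (?new @ st')) (set (?N @ vis))"
        using search_step[OF A m inv, of "set ?N"] N by auto
      have Nm: "set ?N \<subseteq> dom ?m - set vis" using N M(2) by auto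
      have "card (dom ?m - set (?N @ vis)) = card ((dom ?m - set vis) - set ?N)"
        by (intro arg_cong[where f = card]) auto
      also have "\<dots> = card (dom ?m - set vis) - card (set ?N)"
        using Nm by (intro card_Diff_subset) auto
      also have "card (set ?N) = length ?N" using A by (intro distinct_card) simp
      finally have c: "card (dom ?m - set (?N @ vis)) = card (dom ?m - set vis) - length ?N" .
      have "length ?N \<le> card (dom ?m - set vis)"
        using card_mono[OF _ Nm] distinct_card[of ?N] A by (simp add: finite_dom_map_of)
      with c have "length (?new @ st') + card (dom ?m - set (?N @ vis)) < fuel"
        using Suc.prems(2) Cons by simp
      moreover have "search adj A M0 D fuel (?new @ st') (?N @ vis) = (M', D')"
        using Suc.prems(3) Cons e Nil by (simp add: Let_def)
      ultimately show ?thesis using Suc.IH inv' by blast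
    qed
  qed
qed simp

lemma search_inv_init:
  assumes "matching_inv adj A Q (map_of M) D" "q \<notin> Q"
  shows "search_inv adj A (map_of M) D q {(q, M)} D"
  using assms by (auto simp: search_inv_def matching_inv_def)

lemma matching_ok:
  assumes "distinct A" "matching_inv adj (set A) Q0 (map_of (fst s)) (set (snd s))"
    "distinct Q" "Q0 \<inter> set Q = {}" "Q0 \<union> set Q \<subseteq> {..<n}"
    "matching adj A (Suc n) Q s = s'"
  shows "matching_inv adj (set A) (Q0 \<union> set Q) (map_of (fst s')) (set (snd s'))"
  using assms(2-)
proof (induction Q arbitrary: Q0 s)
  case (Cons q Q)
  obtain M D where s: "s = (M, D)" by fastforce
  let ?m = "map_of M"
  have inv: "matching_inv adj (set A) Q0 ?m (set D)" "q \<notin> Q0" using Cons.prems s by auto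
  have Q0: "Q0 \<subseteq> {..<n}" "q < n" using Cons.prems by auto
  have "inj_on ?m (dom ?m)" "ran ?m \<subseteq> Q0" using inv by (auto simp: matching_inv_def matched_def)
  moreover have "?m ` dom ?m = Some ` ran ?m" by (auto simp: ran_def dom_def image_iff) metis
  \<comment> \<open>The range lies in \<open>Q0\<close>, which misses \<open>q\<close> and hence has
    fewer than \<open>n\<close> elements; together with the one initial stack entry this stays below
    the fuel \<open>Suc n\<close>.\<close>
  ultimately have "card (dom ?m) = card (ran ?m)"
    by (metis card_image inj_Some subset_UNIV inj_on_subset)
  also have "\<dots> \<le> card Q0"
    using \<open>ran ?m \<subseteq> Q0\<close> Q0 finite_subset by (intro card_mono) auto
  also have "\<dots> < card (insert q Q0)"
    using inv(2) finite_subset[OF Q0(1)] by simp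
  also have "\<dots> \<le> card {..<n}" using Q0 by (intro card_mono) auto
  finally have "card (dom ?m) < n" by simp
  moreover have "card (dom ?m - set D) \<le> card (dom ?m)"
    by (intro card_mono) (auto simp: finite_dom_map_of)
  ultimately have fuel: "length [(q, M)] + card (dom ?m - set D) < Suc n" by simp
  obtain M' D' where S: "search adj A M D (Suc n) [(q, M)] D = (M', D')" by fastforce
  have "matching_inv adj (set A) (insert q Q0) (map_of M') (set D')"
    using search_ok[OF assms(1) inv _ fuel S] search_inv_init[OF inv] by simp
  then have "matching_inv adj (set A) (insert q Q0 \<union> set Q) (map_of (fst s')) (set (snd s'))"
    using Cons.prems S s by (intro Cons.IH[of "insert q Q0" "(M', D')"]) auto
  then show ?case by simp
qed simp

section \<open>In-neighbourhoods of a digraph and their minimizers\<close>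

locale ordering =
  fixes n k :: nat and E :: "(nat \<times> nat) set"
  assumes arcs: "E \<subseteq> {..<n} \<times> {..<n}" and loopless: "(v, v) \<notin> E"
begin

definition inb :: "nat set \<Rightarrow> nat set" where
  "inb S = {u \<in> {..<n} - S. \<exists>x \<in> S. (u, x) \<in> E}"

lemma finite_inb [simp]: "finite (inb S)"
  by (simp add: inb_def)

text \<open>A vertex counted for the union or the intersection is an in-neighbour of
  \<open>A\<close> or of \<open>B\<close>, and one counted for both is an in-neighbour of both;
  inclusion and exclusion on each side gives submodularity.\<close>

sublocale submodular "{..<n}" "\<lambda>S. card (inb S)" k
proof
  fix A B
  have "card (inb (A \<union> B)) + card (inb (A \<inter> B))
      = card (inb (A \<union> B) \<union> inb (A \<inter> B)) + card (inb (A \<union> B) \<inter> inb (A \<inter> B))"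
    by (intro card_Un_Int) auto
  also have "\<dots> \<le> card (inb A \<union> inb B) + card (inb A \<inter> inb B)"
    by (intro add_mono card_mono) (auto simp: inb_def)
  also have "\<dots> = card (inb A) + card (inb B)" by (intro card_Un_Int[symmetric]) auto
  finally show "card (inb (A \<union> B)) + card (inb (A \<inter> B)) \<le> card (inb A) + card (inb B)" .
qed simp

definition adj :: "nat \<Rightarrow> nat \<Rightarrow> bool" where
  "adj q l \<longleftrightarrow> q = l \<or> (q, l) \<in> E"

definition hits :: "nat \<Rightarrow> nat list \<Rightarrow> bool" where
  "hits q X \<longleftrightarrow> q \<in> set X \<or> (\<exists>x \<in> set X. (q, x) \<in> E)"

definition minimizer :: "nat list \<Rightarrow> nat list \<Rightarrow> nat list" where
  "minimizer X L =
    (let D = snd (matching adj (filter (\<lambda>l. l \<notin> set X) L) (Suc n)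
       (filter (\<lambda>q. hits q L \<and> \<not> hits q X) [0..<n]) ([], []))
     in filter (\<lambda>l. l \<notin> set D) L)"

definition clos :: "nat set \<Rightarrow> nat set" where
  "clos S = {q \<in> {..<n}. \<exists>s \<in> S. adj q s}"

lemma card_clos:
  assumes "S \<subseteq> {..<n}"
  shows "card (clos S) = card S + card (inb S)"
proof -
  have "clos S = S \<union> inb S" using assms by (auto simp: clos_def inb_def adj_def)
  moreover have "S \<inter> inb S = {}" by (auto simp: inb_def)
  ultimately show ?thesis using finite_subset[OF assms] by (simp add: card_Un_disjoint)
qed

text \<open>Let \<open>d\<close> be the number of unmatched vertices. By \<open>gap\<close>,
  \<open>f L - f S\<close> is the excess of the closed in-neighbours lost from \<open>L\<close> to
  \<open>S\<close> over the vertices lost. This excess is at most \<open>d\<close> for all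
  \<open>S\<close> in the interval and at least \<open>d\<close> for the computed set.\<close>

lemma minimizer_ok:
  assumes L: "distinct L" "set L \<subseteq> {..<n}" and X: "set X \<subset> set L"
    and le: "card (inb (set L)) \<le> card (inb (set X))"
  shows "set X \<subset> set (minimizer X L)"
    and "\<And>S. set X \<subseteq> S \<Longrightarrow> S \<subseteq> set L \<Longrightarrow> card (inb (set (minimizer X L))) \<le> card (inb S)"
proof -
  let ?A = "filter (\<lambda>l. l \<notin> set X) L"
  let ?Ql = "filter (\<lambda>q. hits q L \<and> \<not> hits q X) [0..<n]"
  obtain M D where MD: "matching adj ?A (Suc n) ?Ql ([], []) = (M, D)" by fastforce
  let ?Q = "set ?Ql" and ?m = "map_of M" and ?D = "set D"
  let ?W = "set (minimizer X L)"
  have W: "?W = set L - ?D" by (auto simp: minimizer_def MD)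
  have init: "matching_inv adj (set ?A) {} (map_of (fst ([], []))) (set (snd ([], [])))"
    by (simp add: matching_inv_def matched_def)
  have inv: "matching_inv adj (set ?A) ?Q ?m ?D"
    using matching_ok[OF _ init _ _ _ MD] L(1) by auto
  then have m: "matched adj (set ?A) ?m" "ran ?m \<subseteq> ?Q" "?D \<subseteq> dom ?m"
    "\<And>l q. l \<in> ?D \<Longrightarrow> ?m l = Some q \<Longrightarrow> stuck adj (set ?A) ?D q"
    "\<And>q. q \<in> ?Q - ran ?m \<Longrightarrow> stuck adj (set ?A) ?D q" "?D \<noteq> {} \<Longrightarrow> ?Q - ran ?m \<noteq> {}"
    by (auto simp: matching_inv_def)
  have dom: "dom ?m \<subseteq> set L - set X" using m(1) by (auto simp: matched_def)
  with m(3) have DA: "?D \<subseteq> set L - set X" by blast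
  with W X have XW: "set X \<subseteq> ?W" "?W \<subseteq> set L" by auto
  have Q: "?Q = clos (set L) - clos (set X)"
    by (auto simp: clos_def adj_def hits_def)
  have fin: "finite (clos S)" for S by (simp add: clos_def)
  have mono: "S \<subseteq> T \<Longrightarrow> clos S \<subseteq> clos T" for S T by (auto simp: clos_def)
  \<comment> \<open>This is \<open>card_clos\<close> for \<open>L\<close> and for \<open>S\<close>,
    subtracted; integers are used because the difference can be negative.\<close>
  have gap: "int (card (inb (set L))) - int (card (inb S)) =
      int (card (clos (set L) - clos S)) - int (card (set L - S))" if "S \<subseteq> set L" for S
  proof -
    have "card (clos (set L) - clos S) = card (clos (set L)) - card (clos S)"
      "card (clos S) \<le> card (clos (set L))"
      using mono[OF that] fin by (auto intro: card_Diff_subset card_mono)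
    moreover have "card (set L - S) = card (set L) - card S" "card S \<le> card (set L)"
      using that by (auto intro: card_Diff_subset card_mono finite_subset)
    moreover have "S \<subseteq> {..<n}" using that L by auto
    ultimately show ?thesis using card_clos[of S] card_clos[OF L(2)] by linarith
  qed
  let ?U = "?Q - ran ?m"
  let ?d = "card ?U"
  \<comment> \<open>A matched vertex outside the closed in-neighbourhood of \<open>S\<close> has its
    mate outside \<open>S\<close>, so \<open>L - S\<close> bounds the matched ones.\<close>
  have upper: "card (clos (set L) - clos S) \<le> card (set L - S) + ?d"
    if S: "set X \<subseteq> S" "S \<subseteq> set L" for S
  proof -
    let ?P = "clos (set L) - clos S"
    have sub: "?P \<subseteq> ?Q" using mono[OF S(1)] Q by auto
    let ?B = "{l \<in> dom ?m. the (?m l) \<in> ?P}"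
    have "?B \<subseteq> set L - S"
    proof
      fix l assume l: "l \<in> ?B"
      then obtain q where q: "?m l = Some q" "q \<in> ?P" by auto
      with m(1) have "adj q l" "l \<in> set L" by (auto simp: matched_def)
      with q(2) show "l \<in> set L - S" by (auto simp: clos_def)
    qed
    then have "card ?B \<le> card (set L - S)" by (intro card_mono) auto
    moreover have "?P \<inter> ran ?m \<subseteq> (\<lambda>l. the (?m l)) ` ?B" by (force simp: ran_def)
    then have "card (?P \<inter> ran ?m) \<le> card ?B"
      by (intro surj_card_le) (auto intro: finite_subset[OF _ finite_dom_map_of])
    moreover have "card ?P \<le> card ((?P \<inter> ran ?m) \<union> ?U)"
      using sub fin by (intro card_mono) auto
    moreover have "card ((?P \<inter> ran ?m) \<union> ?U) \<le> card (?P \<inter> ran ?m) + ?d" by (rule card_Un_le)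
    ultimately show ?thesis by linarith
  qed
  \<comment> \<open>Deleting \<open>D\<close> loses all unmatched vertices and all mates of
    \<open>D\<close>: they have no neighbour in \<open>X\<close> by the choice of \<open>?Q\<close>,
    and none in the rest of \<open>L\<close> outside \<open>D\<close> because they are
    stuck.\<close>
  have lower: "card ?D + ?d \<le> card (clos (set L) - clos ?W)"
  proof -
    let ?R = "(\<lambda>l. the (?m l)) ` ?D"
    have "inj_on (\<lambda>l. the (?m l)) ?D"
      using m(1,3) by (auto simp: matched_def inj_on_def dom_def subset_iff) (metis option.sel)
    then have "card ?R = card ?D" by (rule card_image)
    moreover have R: "?R \<subseteq> ran ?m" using m(3) by (auto simp: ran_def dom_def subset_iff)
    then have "card (?R \<union> ?U) = card ?R + ?d" by (intro card_Un_disjoint) auto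
    moreover have "?R \<union> ?U \<subseteq> clos (set L) - clos ?W"
    proof
      fix q assume q: "q \<in> ?R \<union> ?U"
      then have qQ: "q \<in> ?Q" using R m(2) by blast
      have "stuck adj (set ?A) ?D q"
        using q
      proof
        assume "q \<in> ?R"
        then obtain l where l: "l \<in> ?D" "q = the (?m l)" by blast
        with m(3) have "?m l = Some q" by auto
        with l(1) show ?thesis by (rule m(4))
      qed (rule m(5))
      then have "\<not> adj q w" if "w \<in> ?W" for w
        using that qQ Q W by (cases "w \<in> set X") (auto simp: stuck_def clos_def)
      with qQ Q show "q \<in> clos (set L) - clos ?W" by (auto simp: clos_def)
    qed
    then have "card (?R \<union> ?U) \<le> card (clos (set L) - clos ?W)" using fin by (intro card_mono) auto
    ultimately show ?thesis by linarith
  qed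
  have cW: "card (set L - ?W) = card ?D"
    using DA W by (intro arg_cong[where f = card]) auto
  show min: "card (inb ?W) \<le> card (inb S)" if "set X \<subseteq> S" "S \<subseteq> set L" for S
    using gap[OF that(2)] upper[OF that] gap[OF XW(2)] lower cW by linarith
  show "set X \<subset> ?W"
  proof (cases "?D = {}")
    case True with W X show ?thesis by auto
  next
    case False
    \<comment> \<open>If something was deleted, a search has failed, so \<open>f\<close> drops
      strictly below \<open>f L\<close> and thus below \<open>f X\<close>; the result cannot have
      shrunk back to \<open>X\<close>.\<close>
    with m(6) have "?d > 0" by (auto simp: card_gt_0_iff)
    with gap[OF XW(2)] lower cW have "card (inb ?W) < card (inb (set L))" by linarith
    with le have "?W \<noteq> set X" by auto
    with XW show ?thesis by auto
  qed
qed

end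

section \<open>The search tree\<close>

context ordering
begin

definition cands :: "nat list \<Rightarrow> nat list" where
  "cands X = filter (\<lambda>v. v \<notin> set X \<and> card (inb (set (v # X))) \<le> k) [0..<n]"

text \<open>A step that does not raise \<open>f\<close> is taken without branching, which is safe by
  \<open>good_step\<close>; hence all kids created by branching have strictly larger value.\<close>

definition grow :: "nat \<Rightarrow> nat list \<Rightarrow> tree list" where
  "grow v X =
    (if filter (\<lambda>u. u \<notin> set X) [0..<n] = [] then [Node v X []]
     else (case filter (\<lambda>u. card (inb (set (u # X))) \<le> card (inb (set X))) (cands X) of
       u # _ \<Rightarrow> [Node v (u # X) []]
     | [] \<Rightarrow> (if cands X = [] then [] else [Node v X (map (\<lambda>u. Node u (u # X) []) (cands X))])))"

text \<open>Applied after the kids were advanced, when some of them may have come down to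
  \<open>f X\<close>. The new root keeps the label \<open>v\<close>, by which its own parent finds
  it.\<close>

definition settle :: "nat \<Rightarrow> nat list \<Rightarrow> tree list \<Rightarrow> tree list" where
  "settle v X ts =
    (if ts = [] then []
     else (case filter (\<lambda>t. card (inb (set (taken t))) \<le> card (inb (set X))) ts of
       [] \<Rightarrow> [Node v X ts]
     | t # _ \<Rightarrow> map (\<lambda>r. Node v (taken r) (kids r)) (follow (Node v X ts) (rev (minimizer X (taken t))))))"

fun adv :: "tree \<Rightarrow> tree list" where
  "adv (Node v X ts) = (if ts = [] then grow v X else settle v X (concat (map adv ts)))"

lemma seq_Cons:
  assumes "seq X" "v \<in> {..<n} - set X" "card (inb (insert v (set X))) \<le> k"
  shows "seq (v # X)"
  using seq_extend[OF assms(1), of "[v]"] assms by simp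

lemma tinv_Node_seed: "tinv i (Node v X ts) \<longleftrightarrow> tinv i (Node w X ts)"
  by (simp add: tinv_iff)

lemma set_cands: "set (cands X) = {v \<in> {..<n} - set X. card (inb (insert v (set X))) \<le> k}"
  by (auto simp: cands_def)

lemma grow_ok:
  assumes X: "seq X" "i \<le> length X" "i < n"
  shows "result_ok (Suc i) X (set X) (grow v X)"
proof -
  have dX: "distinct X" "set X \<subseteq> {..<n}" using X by (auto simp: seq_def)
  show ?thesis
  proof (cases "filter (\<lambda>u. u \<notin> set X) [0..<n] = []")
    case True
    then have "set X = {..<n}" using dX by (auto simp: filter_empty_conv)
    \<comment> \<open>A full order cannot grow, but its length \<open>n\<close> already meets the
      demand \<open>Suc i\<close>.\<close>
    then have "length X = n" using distinct_card[OF dX(1)] by simp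
    then have "tinv (Suc i) (Node v X [])" using X by (simp add: tinv_iff)
    moreover have "grow v X = [Node v X []]" unfolding grow_def if_P[OF True] ..
    ultimately show ?thesis by (simp add: result_ok_def)
  next
    case False
    have ne: "set X \<noteq> {..<n}"
    proof
      assume "set X = {..<n}"
      then have "filter (\<lambda>u. u \<notin> set X) [0..<n] = []" unfolding filter_empty_conv by simp
      with False show False ..
    qed
    note grow = grow_def[of v X, unfolded if_not_P[OF False]]
    let ?N = "filter (\<lambda>u. card (inb (set (u # X))) \<le> card (inb (set X))) (cands X)"
    show ?thesis
    proof (cases ?N)
      case (Cons u us)
      then have "u \<in> set ?N" by simp
      then have u: "u \<in> {..<n} - set X" "card (inb (insert u (set X))) \<le> k"
        "card (inb (insert u (set X))) \<le> card (inb (set X))" by (auto simp: set_cands)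
      have "tinv (Suc i) (Node v (u # X) [])" using seq_Cons[OF X(1) u(1,2)] X by (simp add: tinv_iff)
      moreover have "grow v X = [Node v (u # X) []]" unfolding grow Cons by simp
      ultimately show ?thesis using good_step[OF u(3)] by (simp add: result_ok_def)
    next
      case Nil
      let ?ts = "map (\<lambda>u. Node u (u # X) []) (cands X)"
      have leaf: "tinv (Suc i) (Node u (u # X) [])" if "u \<in> set (cands X)" for u
        using that X seq_Cons[OF X(1)] by (auto simp: tinv_iff set_cands)
      have lt: "card (inb (set X)) < card (inb (insert u (set X)))" if "u \<in> set (cands X)" for u
        using that Nil by (auto simp: filter_empty_conv not_le)
      have alive: "v \<in> set (cands X)"
        if "v \<in> {..<n} - set X" "card (inb (insert v (set X))) \<le> k" for v
        using that by (simp add: set_cands)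
      show ?thesis
      proof (cases "cands X = []")
        case True
        have "\<not> alive (set X)"
        proof
          assume "alive (set X)"
          from alive_step[OF this ne] show False using alive True by (metis empty_iff list.set(1))
        qed
        moreover have "grow v X = []" unfolding grow Nil by (simp add: True)
        ultimately show ?thesis by (simp add: result_ok_def)
      next
        case cs: False
        have "kinv (Suc i) X ?ts" unfolding kinv_def
          using leaf by (auto simp: set_cands comp_def image_image) (auto simp: cands_def)
        then have "tinv (Suc i) (Node v X ?ts)" using X(1) cs lt by (auto simp: tinv_iff)
        moreover have "grow v X = [Node v X ?ts]" unfolding grow Nil by (simp add: cs)
        ultimately show ?thesis by (simp add: result_ok_def)
      qed
    qed
  qed
qed

lemma result_ok_cases:
  assumes "result_ok i X S rs"
  obtains "rs = []" "\<not> alive S"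
  | t where "rs = [t]" "tinv i t" "\<exists>ys. taken t = ys @ X" "good S (set (taken t))"
  using assms by (cases "rs = []") (auto simp: result_ok_def)

text \<open>Both sides list the vertices of \<open>W\<close> outside \<open>X\<close> in their order
  of insertion; the right one is the shape that \<open>feasible_restrict_minimizer\<close>
  delivers.\<close>

lemma filter_rev_suffix:
  assumes "W = filter P (ys @ X)" "distinct (ys @ X)"
  shows "filter (\<lambda>x. x \<notin> set X) (rev W) = filter (\<lambda>x. x \<in> set W) (rev ys)"
proof -
  have "filter (\<lambda>x. x \<notin> set X) (rev W) = filter (\<lambda>x. x \<notin> set X \<and> P x) (rev ys)"
    unfolding assms(1) by (simp add: rev_filter filter_empty_conv conj_commute)
  also have "\<dots> = filter (\<lambda>x. x \<in> set W) (rev ys)"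
    using assms(2) unfolding assms(1) by (intro filter_cong) auto
  finally show ?thesis .
qed

text \<open>The minimizer is a good set strictly above \<open>X\<close>. Strictness forces the walk
  to leave the root, where the increase of \<open>f\<close> fails, and to end at a descendant, below
  which the full invariant holds.\<close>

lemma settle_ok:
  assumes X: "seq X" "set X \<noteq> {..<n}" and ts: "kinv i X ts"
  shows "result_ok i X (set X) (settle v X ts)"
proof (cases "ts = []")
  case True
  have "\<not> alive (set X)"
  proof
    assume "alive (set X)"
    from alive_step[OF this X(2)] show False using ts True by (fastforce simp: kinv_def)
  qed
  with True show ?thesis by (simp add: result_ok_def settle_def)
next
  case ne: False
  let ?F = "filter (\<lambda>t. card (inb (set (taken t))) \<le> card (inb (set X))) ts"
  show ?thesis
  proof (cases ?F)
    case Nil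
    then have "card (inb (set X)) < card (inb (set (taken t)))" if "t \<in> set ts" for t
      using that unfolding filter_empty_conv by (auto simp: not_le)
    with X ts ne have "tinv i (Node v X ts)" by (simp add: tinv_iff)
    with Nil ne show ?thesis by (simp add: settle_def result_ok_def)
  next
    case (Cons t rest)
    then have "t \<in> set ?F" by simp
    then have t: "t \<in> set ts" "card (inb (set (taken t))) \<le> card (inb (set X))" by auto
    then obtain ys where T: "tinv i t" "taken t = ys @ X" "seed t \<in> {..<n} - set X"
      "good (insert (seed t) (set X)) (set (taken t))"
      using ts unfolding kinv_def by blast
    let ?L = "taken t" and ?W = "minimizer X (taken t)"
    have L: "distinct ?L" "set ?L \<subseteq> {..<n}" "feasible {} (rev ?L)"
      using tinv_seq[OF T(1)] by (auto simp: seq_def)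
    have XL: "set X \<subset> set ?L" using T(3) good_subset[OF T(4)] by auto
    note min = minimizer_ok[OF L(1,2) XL t(2)]
    have WL: "set ?W \<subseteq> set ?L" "distinct ?W" using L(1) by (auto simp: minimizer_def Let_def)
    have W: "good (set X) (set ?W)"
      using min WL unfolding good_def by (meson order_trans psubset_imp_subset)
    have "feasible (set X) (rev ys)" using L(3) by (simp add: T(2) feasible_append)
    then have "feasible (set X \<inter> set ?W) (filter (\<lambda>x. x \<in> set ?W) (rev ys))"
      by (rule feasible_restrict_minimizer[where X = "set X" and L = "set ?L"])
        (use WL min T(2) in auto)
    moreover have "set X \<inter> set ?W = set X" using min(1) by auto
    moreover have "filter (\<lambda>x. x \<notin> set X) (rev ?W) = filter (\<lambda>x. x \<in> set ?W) (rev ys)"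
    proof -
      obtain D where D: "?W = filter (\<lambda>x. x \<notin> D) ?L" by (auto simp: minimizer_def Let_def)
      show ?thesis by (rule filter_rev_suffix) (use D L(1) T(2) in simp_all)
    qed
    ultimately have feas: "feasible (set X) (filter (\<lambda>x. x \<notin> set X) (rev ?W))" by simp
    obtain u us where us: "filter (\<lambda>x. x \<notin> set X) (rev ?W) = u # us"
    proof (cases "filter (\<lambda>x. x \<notin> set X) (rev ?W)")
      case Nil
      then have "set ?W \<subseteq> set X" unfolding filter_empty_conv by auto
      with min(1) show thesis by auto
    qed
    have d: "distinct (u # us)" "set (u # us) = set ?W - set X"
      unfolding us[symmetric] using WL by auto
    have f: "follow (Node v X ts) (rev ?W) =
        (case filter (\<lambda>t. seed t = u) ts of [] \<Rightarrow> [] | t # _ \<Rightarrow> follow t us)"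
      using us ne by (simp add: follow.simps)
    have "result_ok i X (set X \<union> set (u # us))
        (case filter (\<lambda>t. seed t = u) ts of [] \<Rightarrow> [] | t # _ \<Rightarrow> follow t us)"
      by (rule follow_descend) (use X ts feas us d WL L in \<open>auto intro!: follow_ok\<close>)
    moreover have "set X \<union> set (u # us) = set ?W" using d min(1) by auto
    ultimately have "result_ok i X (set ?W) (follow (Node v X ts) (rev ?W))" by (simp add: f)
    then have "result_ok i X (set X) (map (\<lambda>r. Node v (taken r) (kids r)) (follow (Node v X ts) (rev ?W)))"
    proof (cases rule: result_ok_cases)
      case 1
      with alive_good[OF _ W] WL L show ?thesis by (auto simp: result_ok_def)
    next
      case (2 r)
      then have "tinv i (Node v (taken r) (kids r))"
        using tinv_Node_seed[of i v "taken r" "kids r" "seed r"] by simp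
      with 2 show ?thesis using good_trans[OF W 2(4)] by (auto simp: result_ok_def)
    qed
    with ne Cons show ?thesis by (simp add: settle_def)
  qed
qed

text \<open>A kid that vanishes when advanced was not alive, and then its branch set was not alive
  either, because the kid's set is good for it. So the kids still cover all live branches.\<close>

lemma kinv_adv:
  assumes K: "kinv i X ts"
    and IH: "\<And>t. t \<in> set ts \<Longrightarrow> result_ok (Suc i) (taken t) (set (taken t)) (adv t)"
      "\<And>t. t \<in> set ts \<Longrightarrow> \<forall>r \<in> set (adv t). seed r = seed t"
  shows "kinv (Suc i) X (concat (map adv ts))"
proof -
  let ?ts = "concat (map adv ts)"
  have "distinct (map seed ts)" using K by (simp add: kinv_def)
  then have "distinct (map seed ?ts) \<and> seed ` set ?ts \<subseteq> seed ` set ts"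
    using IH
  proof (induction ts)
    case (Cons t ts)
    have "result_ok (Suc i) (taken t) (set (taken t)) (adv t)" "\<forall>r \<in> set (adv t). seed r = seed t"
      using Cons.prems by auto
    moreover have "distinct (map seed (concat (map adv ts))) \<and>
        seed ` set (concat (map adv ts)) \<subseteq> seed ` set ts"
      using Cons by auto
    ultimately show ?case using Cons.prems(1)
      by (elim result_ok_cases) (auto; blast)+
  qed simp
  moreover have "tinv (Suc i) r \<and> (\<exists>ys. taken r = ys @ X) \<and> seed r \<in> {..<n} - set X \<and>
     card (inb (insert (seed r) (set X))) \<le> k \<and> good (insert (seed r) (set X)) (set (taken r))"
    if r: "r \<in> set ?ts" for r
  proof -
    obtain t where t: "t \<in> set ts" "r \<in> set (adv t)" using r by auto
    have T: "\<exists>ys. taken t = ys @ X" "seed t \<in> {..<n} - set X"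
      "card (inb (insert (seed t) (set X))) \<le> k" "good (insert (seed t) (set X)) (set (taken t))"
      using K t(1) unfolding kinv_def by blast+
    show ?thesis using IH(1)[OF t(1)]
    proof (cases rule: result_ok_cases)
      case (2 r')
      with t have "r' = r" by simp
      then have "\<exists>ys. taken r = ys @ X" using 2(3) T(1) by force
      moreover have "good (insert (seed t) (set X)) (set (taken r))"
        using good_trans[OF T(4) 2(4)] \<open>r' = r\<close> by simp
      moreover have "seed r = seed t" using IH(2)[OF t(1)] t(2) by blast
      ultimately show ?thesis using 2(2) T(2,3) \<open>r' = r\<close> by simp
    qed (use t in simp)
  qed
  moreover have "w \<in> seed ` set ?ts"
    if w: "w \<in> {..<n} - set X" "card (inb (insert w (set X))) \<le> k" "alive (insert w (set X))" for w
  proof -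
    obtain t where t: "t \<in> set ts" "w = seed t" using K w unfolding kinv_def by blast
    then have T: "tinv i t" "good (insert w (set X)) (set (taken t))" using K unfolding kinv_def by blast+
    have "alive (set (taken t))"
      using alive_good[OF w(3) T(2)] tinv_seq[OF T(1)] by (auto simp: seq_def)
    with IH(1)[OF t(1)] obtain r where "adv t = [r]"
      by (auto elim!: result_ok_cases)
    then have "r \<in> set (adv t)" by simp
    with t(1) IH(2)[OF t(1)] t(2) have "r \<in> set ?ts" "w = seed r" unfolding set_concat by auto
    then show ?thesis by blast
  qed
  ultimately show ?thesis unfolding kinv_def by blast
qed

lemma adv_ok:
  assumes "tinv i t" "i < n"
  shows "result_ok (Suc i) (taken t) (set (taken t)) (adv t) \<and> (\<forall>r \<in> set (adv t). seed r = seed t)"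
  using assms(1)
proof (induction t rule: tree.induct)
  case (Node v X ts)
  show ?case
  proof (cases "ts = []")
    case True
    have "\<forall>r \<in> set (grow v X). seed r = v" by (auto simp: grow_def split: list.splits)
    with True Node.prems grow_ok[of X i v] assms(2) show ?thesis by (simp add: tinv_iff)
  next
    case False
    let ?ts = "concat (map adv ts)"
    have X: "seq X" and K: "kinv i X ts" and lt: "\<And>t. t \<in> set ts \<Longrightarrow> card (inb (set X)) < card (inb (set (taken t)))"
      using Node.prems False by (auto simp: tinv_iff)
    have IH: "result_ok (Suc i) (taken t) (set (taken t)) (adv t)" "\<forall>r \<in> set (adv t). seed r = seed t"
      if "t \<in> set ts" for t
      using Node.IH[OF that] K that by (auto simp: kinv_def)
    have K': "kinv (Suc i) X ?ts" using kinv_adv[OF K] IH by blast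
    obtain t where "t \<in> set ts" using False by (cases ts) auto
    then have "set X \<noteq> {..<n}" using K unfolding kinv_def by blast
    then have "result_ok (Suc i) X (set X) (settle v X ?ts)" using settle_ok[OF X _ K'] by blast
    moreover have "\<forall>r \<in> set (settle v X ?ts). seed r = v"
      by (auto simp: settle_def split: list.splits)
    ultimately show ?thesis using False by simp
  qed
qed

end

section \<open>Path-decompositions and the size of the search tree\<close>

primrec tsize :: "tree \<Rightarrow> nat" where
  "tsize (Node v X ts) = Suc (sum_list (map tsize ts))"

context ordering
begin

primrec rounds :: "nat \<Rightarrow> tree list \<Rightarrow> tree list" where
  "rounds 0 r = r"
| "rounds (Suc m) r = rounds m (case r of [] \<Rightarrow> [] | t # _ \<Rightarrow> adv t)"

lemma result_ok_round:
  assumes "result_ok i [] {} r" "i < n"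
  shows "result_ok (Suc i) [] {} (case r of [] \<Rightarrow> [] | t # _ \<Rightarrow> adv t)"
  using assms(1)
proof (cases rule: result_ok_cases)
  case 1 then show ?thesis by (simp add: result_ok_def)
next
  case (2 t)
  have V: "set (taken t) \<subseteq> {..<n}" using tinv_seq[OF 2(2)] by (simp add: seq_def)
  have "result_ok (Suc i) (taken t) (set (taken t)) (adv t)" using adv_ok[OF 2(2)] assms(2) by simp
  then have "result_ok (Suc i) [] {} (adv t)"
  proof (cases rule: result_ok_cases)
    case 1
    with alive_good[OF _ 2(4) V] show ?thesis by (auto simp: result_ok_def)
  next
    case (2 r)
    with good_trans[OF \<open>good {} (set (taken t))\<close>] show ?thesis by (auto simp: result_ok_def)
  qed
  with 2 show ?thesis by simp
qed

lemma rounds_ok: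
  "result_ok i [] {} r \<Longrightarrow> i + m \<le> n \<Longrightarrow> result_ok (i + m) [] {} (rounds m r)"
proof (induction m arbitrary: i r)
  case (Suc m)
  then show ?case using Suc.IH[OF result_ok_round[OF Suc.prems(1)]] by simp
qed simp

lemma inb_all [simp]: "inb {..<n} = {}"
  by (auto simp: inb_def)

lemma inb_empty [simp]: "inb {} = {}"
  by (auto simp: inb_def)

lemma seq_full:
  assumes "seq X" "n \<le> length X"
  shows "set X = {..<n}"
proof -
  have X: "distinct X" "set X \<subseteq> {..<n}" using assms by (auto simp: seq_def)
  have "length X \<le> n" using card_mono[OF _ X(2)] distinct_card[OF X(1)] by simp
  with X assms(2) show ?thesis by (intro card_subset_eq) (auto simp: distinct_card)
qed

text \<open>By induction a kid would already contain all vertices, where \<open>f\<close> is 0, and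
  so could not exceed the value of its parent. Hence only a leaf is left.\<close>

lemma tinv_final: "tinv n t \<Longrightarrow> kids t = [] \<and> set (taken t) = {..<n}"
proof (induction t rule: tree.induct)
  case (Node v X ts)
  show ?case
  proof (cases ts)
    case Nil
    with Node.prems seq_full[of X] show ?thesis by (simp add: tinv_iff)
  next
    case (Cons t ts')
    with Node.prems have "tinv n t" "card (inb (set X)) < card (inb (set (taken t)))"
      by (auto simp: tinv_iff kinv_def)
    with Node.IH[of t] Cons show ?thesis by simp
  qed
qed

section \<open>Vertex orders and path-decompositions\<close>

definition boundary :: "nat list \<Rightarrow> nat list" where
  "boundary X = filter (\<lambda>u. u \<notin> set X \<and> (\<exists>x \<in> set X. (u, x) \<in> E)) [0..<n]"

lemma set_boundary [simp]: "set (boundary X) = inb (set X)"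
  by (auto simp: boundary_def inb_def)

lemma distinct_boundary [simp]: "distinct (boundary X)"
  by (simp add: boundary_def)

lemma length_boundary: "length (boundary X) = card (inb (set X))"
  using distinct_card[of "boundary X"] by simp

text \<open>With the newest vertex first, bag \<open>i\<close> belongs to the set of
  \<open>drop i X\<close>, so the sets shrink along the sequence; this fits the direction that a
  path-decomposition prescribes for arcs.\<close>

primrec bags :: "nat list \<Rightarrow> nat list list" where
  "bags [] = []"
| "bags (v # X) = (v # boundary (v # X)) # bags X"

lemma length_bags [simp]: "length (bags X) = length X"
  by (induction X) auto

lemma nth_bags: "i < length X \<Longrightarrow> bags X ! i = X ! i # boundary (drop i X)"
proof (induction X arbitrary: i)
  case (Cons v X)
  then show ?case by (cases i) auto
qed simp

lemma interval_eq:
  fixes S :: "nat set"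
  assumes "finite S" "p \<in> S" "\<And>i. i \<in> S \<Longrightarrow> p \<le> i" "\<And>i j. i \<in> S \<Longrightarrow> p \<le> j \<Longrightarrow> j \<le> i \<Longrightarrow> j \<in> S"
  shows "S = {p..Max S}"
proof (intro subset_antisym subsetI)
  show "x \<in> {p..Max S}" if "x \<in> S" for x
    using that assms(3)[OF that] Max_ge[OF assms(1) that] by simp
  have "Max S \<in> S" using assms(1,2) by (intro Max_in) auto
  then show "x \<in> S" if "x \<in> {p..Max S}" for x using that assms(4)[of "Max S" x] by simp
qed

text \<open>Vertices are inserted by decreasing level with ties broken arbitrarily; in
  \<open>cut\<close>, the vertex \<open>v\<close> is the one inserted last.\<close>

lemma alive_by_level:
  fixes l :: "nat \<Rightarrow> nat"
  assumes S: "S \<subseteq> {..<n}" "\<And>u v. v \<in> S \<Longrightarrow> u \<in> {..<n} - S \<Longrightarrow> l u \<le> l v"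
    and cut: "\<And>S v. S \<subseteq> {..<n} \<Longrightarrow> v \<in> S \<Longrightarrow> (\<And>x. x \<in> S \<Longrightarrow> l v \<le> l x) \<Longrightarrow>
      (\<And>u. u \<in> {..<n} - S \<Longrightarrow> l u \<le> l v) \<Longrightarrow> card (inb S) \<le> k"
  shows "alive S"
  using S
proof (induction "card ({..<n} - S)" arbitrary: S)
  case 0
  then have "S = {..<n}" by auto
  then show ?case by (auto simp: alive_def intro!: exI[of _ "[]"])
next
  case (Suc c)
  let ?R = "{..<n} - S"
  have R: "finite ?R" "?R \<noteq> {}" using Suc.hyps(2) by (simp, metis card.empty nat.distinct(1))
  have "Max (l ` ?R) \<in> l ` ?R" using R by (intro Max_in) auto
  then obtain v where "v \<in> ?R" "l v = Max (l ` ?R)" by auto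
  with R have v: "v \<in> ?R" "\<And>u. u \<in> ?R \<Longrightarrow> l u \<le> l v" by simp_all
  have "?R - {v} = {..<n} - insert v S" by auto
  then have "c = card ({..<n} - insert v S)" using Suc.hyps(2) v R by (metis card_Diff_singleton diff_Suc_1)
  then have "alive (insert v S)"
    by (rule Suc.hyps(1)) (use Suc.prems v in auto)
  moreover have "card (inb (insert v S)) \<le> k"
    by (rule cut[of _ v]) (use Suc.prems v in auto)
  ultimately show ?case using alive_feasible[of S "[v]"] by simp
qed

end

locale ordered_digraph = ordering +
  fixes G :: "nat pair_pre_digraph"
  assumes pverts: "pverts G = {..<n}" and parcs: "parcs G = E"
begin

lemma bags_decomposition:
  assumes "seq X" "set X = {..<n}" "0 < n"
  shows "path_decomposition G (map set (bags X))"
    and "width (map set (bags X)) \<le> int k"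
    and "\<forall>b \<in> set (bags X). distinct b"
proof -
  have X: "distinct X" "length X = n" using assms distinct_card[of X] by (auto simp: seq_def)
  have suffix: "seq (drop i X)" for i
  proof -
    have "feasible {} (rev (drop i X) @ rev (take i X))"
      using assms(1) unfolding rev_append[symmetric] by (simp add: seq_def)
    then have f: "feasible {} (rev (drop i X))" by (simp add: feasible_append)
    have "card (inb (set (drop i X))) \<le> k" using feasible_last[OF f] by simp
    moreover have "set (drop i X) \<subseteq> {..<n}" using set_drop_subset[of i X] assms(2) by simp
    ultimately show ?thesis using f X(1) by (simp add: seq_def)
  qed
  have nth: "map set (bags X) ! i = insert (X ! i) (inb (set (drop i X)))" if "i < n" for i
    using that X by (simp add: nth_bags)
  have drop: "X ! q \<in> set (drop i X) \<longleftrightarrow> i \<le> q" if "q < n" for q i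
    using that X by (auto simp: in_set_conv_nth nth_eq_iff_index_eq intro!: exI[of _ "q - i"])
  show "\<forall>b \<in> set (bags X). distinct b"
  proof
    fix b assume "b \<in> set (bags X)"
    then obtain i where i: "i < n" "b = bags X ! i" using X by (auto simp: in_set_conv_nth)
    then have "X ! i \<in> set (drop i X)" using drop by simp
    with i X show "distinct b" by (auto simp: nth_bags inb_def)
  qed
  show "width (map set (bags X)) \<le> int k"
  proof -
    have "card b \<le> Suc k" if b: "b \<in> set (map set (bags X))" for b
    proof -
      obtain i where i: "i < n" "b = map set (bags X) ! i"
        using b X by (metis in_set_conv_nth length_bags length_map)
      have "card b \<le> Suc (card (inb (set (drop i X))))"
        unfolding i nth[OF i(1)] by (simp add: card_insert_if)
      also have "\<dots> \<le> Suc k" using suffix[of i] by (simp add: seq_def)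
      finally show ?thesis .
    qed
    moreover have "bags X \<noteq> []" using X assms(3) by (metis length_bags length_0_conv less_irrefl)
    ultimately have "Max (card ` set (map set (bags X))) \<le> Suc k"
      by (intro Max.boundedI) auto
    then show ?thesis by (simp add: width_def)
  qed
  show "path_decomposition G (map set (bags X))"
    unfolding path_decomposition_def
  proof (intro conjI)
    show "map set (bags X) \<noteq> []" using X assms(3) by (metis length_bags length_0_conv less_irrefl map_is_Nil_conv)
    show "\<Union> (set (map set (bags X))) = pverts G"
    proof (intro subset_antisym subsetI)
      fix v assume "v \<in> \<Union> (set (map set (bags X)))"
      then obtain i where i: "i < n" "v \<in> map set (bags X) ! i"
        using X by (metis UnionE in_set_conv_nth length_bags length_map)
      then show "v \<in> pverts G" using nth[OF i(1)] X assms(2) nth_mem[of i X] by (auto simp: pverts inb_def)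
    next
      fix v assume "v \<in> pverts G"
      then have "v \<in> set X" using assms(2) pverts by simp
      then obtain i where i: "i < n" "v = X ! i" using X by (auto simp: in_set_conv_nth)
      then have "v \<in> map set (bags X) ! i" using nth by simp
      then show "v \<in> \<Union> (set (map set (bags X)))" using i X by (metis UnionI nth_mem length_bags length_map)
    qed
    show "\<forall>(u, v)\<in>parcs G. \<exists>i j. j \<le> i \<and> i < length (map set (bags X)) \<and>
        u \<in> map set (bags X) ! i \<and> v \<in> map set (bags X) ! j"
    proof (clarify)
      fix u v assume "(u, v) \<in> parcs G"
      then have uv: "(u, v) \<in> E" "u \<in> set X" "v \<in> set X" using parcs arcs assms(2) by auto
      then obtain p q where pq: "p < n" "q < n" "u = X ! p" "v = X ! q"
        using X by (metis in_set_conv_nth)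
      show "\<exists>i j. j \<le> i \<and> i < length (map set (bags X)) \<and>
        u \<in> map set (bags X) ! i \<and> v \<in> map set (bags X) ! j"
      \<comment> \<open>For \<open>q \<le> p\<close> the own bags of \<open>u\<close> and
        \<open>v\<close> stand in the required order. Otherwise \<open>u\<close> is inserted after
        \<open>v\<close>, so it is on the boundary when \<open>v\<close> is inserted, and bag
        \<open>q\<close> contains both.\<close>
      proof (cases "q \<le> p")
        case True
        with pq X nth show ?thesis by (intro exI[of _ p] exI[of _ q]) auto
      next
        case False
        then have "u \<in> inb (set (drop q X))"
          using uv drop[OF pq(1)] drop[OF pq(2)] pq arcs unfolding inb_def by auto
        with pq X nth[of q] show ?thesis by (intro exI[of _ q]) auto
      qed
    qed
    show "\<forall>v\<in>pverts G. \<exists>a b. {i. i < length (map set (bags X)) \<and> v \<in> map set (bags X) ! i} = {a..b}"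
    proof
      fix v assume "v \<in> pverts G"
      then have "v \<in> set X" using assms(2) pverts by simp
      then obtain p where p: "p < n" "v = X ! p" using X by (auto simp: in_set_conv_nth)
      let ?S = "{i. i < length (map set (bags X)) \<and> v \<in> map set (bags X) ! i}"
      have mem: "i \<in> ?S \<longleftrightarrow> i < n \<and> (i = p \<or> v \<in> inb (set (drop i X)))" for i
      proof (cases "i < n")
        case True
        then have "X ! i = v \<longleftrightarrow> i = p" using X p by (simp add: nth_eq_iff_index_eq)
        moreover have "v \<in> map set (bags X) ! i \<longleftrightarrow> v = X ! i \<or> v \<in> inb (set (drop i X))"
          unfolding nth[OF True] by simp
        ultimately show ?thesis using True X(2) by auto
      qed (use X(2) in simp)
      \<comment> \<open>Beyond its own index \<open>p\<close>, the vertex \<open>v\<close> stays in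
        the bags as long as the shrinking set contains an out-neighbour of it; its bags therefore
        form an interval starting at \<open>p\<close>.\<close>
      have in_inb: "v \<in> inb (set (drop i X)) \<longleftrightarrow> p < i \<and> (\<exists>x \<in> set (drop i X). (v, x) \<in> E)" for i
        using drop[OF p(1)] p assms(2) nth_mem[of p X] X unfolding inb_def by auto
      have anti: "set (drop i X) \<subseteq> set (drop j X)" if "j \<le> i" for i j
        using that by (rule set_drop_subset_set_drop)
      have "?S = {p..Max ?S}"
      proof (rule interval_eq)
        show "finite ?S" by simp
        show "p \<in> ?S" using mem p by blast
        show "p \<le> i" if "i \<in> ?S" for i using that mem[of i] in_inb[of i] by auto
        show "j \<in> ?S" if "i \<in> ?S" "p \<le> j" "j \<le> i" for i j
          using that mem[of i] mem[of j] in_inb[of i] in_inb[of j] anti[of j i] by (cases "j = p") auto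
      qed
      then show "\<exists>a b. ?S = {a..b}" by blast
    qed
  qed
qed

text \<open>Vertices are inserted by decreasing index of their first bag. When \<open>v\<close> is
  the last one, a remaining in-neighbour \<open>u\<close> starts no later than \<open>v\<close>, and
  its arc puts it into some bag no earlier than the first bag of \<open>v\<close>. As its bags form
  an interval, \<open>u\<close> lies in the first bag of \<open>v\<close>, which has at most
  \<open>k\<close> further elements.\<close>

lemma decomposition_alive:
  assumes dec: "path_decomposition G Xs" and w: "width Xs \<le> int k"
  shows "alive {}"
proof -
  define l where "l v = (LEAST i. i < length Xs \<and> v \<in> Xs ! i)" for v
  have un: "\<Union> (set Xs) = {..<n}" using dec pverts by (simp add: path_decomposition_def)
  have l: "l v < length Xs" "v \<in> Xs ! l v" if "v < n" for v
  proof -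
    have "\<exists>i. i < length Xs \<and> v \<in> Xs ! i"
      using that un by (metis UnionE in_set_conv_nth lessThan_iff)
    then have "l v < length Xs \<and> v \<in> Xs ! l v" unfolding l_def by (rule LeastI_ex)
    then show "l v < length Xs" "v \<in> Xs ! l v" by auto
  qed
  have l_le: "l v \<le> i" if "i < length Xs" "v \<in> Xs ! i" for v i
    unfolding l_def using that by (intro Least_le) simp
  have card: "card b \<le> Suc k" "finite b" if "b \<in> set Xs" for b
  proof -
    have "card b \<le> Max (card ` set Xs)" using that by (intro Max_ge) auto
    then show "card b \<le> Suc k" using w by (simp add: width_def)
    show "finite b" using un that by (metis Union_upper finite_lessThan finite_subset)
  qed
  show ?thesis
  proof (rule alive_by_level[where l = l])
    fix S v assume S: "S \<subseteq> {..<n}" "v \<in> S" "\<And>x. x \<in> S \<Longrightarrow> l v \<le> l x"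
      "\<And>u. u \<in> {..<n} - S \<Longrightarrow> l u \<le> l v"
    then have v: "v < n" by auto
    have "inb S \<subseteq> Xs ! l v - {v}"
    proof
      fix u assume u: "u \<in> inb S"
      then obtain x where x: "x \<in> S" "(u, x) \<in> E" "u < n" "u \<notin> S" by (auto simp: inb_def)
      then obtain i j where ij: "j \<le> i" "i < length Xs" "u \<in> Xs ! i" "x \<in> Xs ! j"
        using dec parcs unfolding path_decomposition_def by blast
      have "l v \<le> i" using S(3)[OF x(1)] l_le[of j x] ij by linarith
      have "l u \<le> l v" using S(4) x by simp
      obtain a b where ab: "{i. i < length Xs \<and> u \<in> Xs ! i} = {a..b}"
        using dec x(3) pverts unfolding path_decomposition_def by blast
      have "l u \<in> {a..b}" "i \<in> {a..b}" unfolding ab[symmetric] using l[OF x(3)] ij by auto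
      then have "l v \<in> {a..b}" using \<open>l v \<le> i\<close> \<open>l u \<le> l v\<close> by auto
      then have "u \<in> Xs ! l v" unfolding ab[symmetric] by simp
      then show "u \<in> Xs ! l v - {v}" using x S by auto
    qed
    then have "card (inb S) \<le> card (Xs ! l v - {v})"
      using card(2)[OF nth_mem[OF l(1)[OF v]]] by (intro card_mono) auto
    also have "\<dots> \<le> k"
      using card[OF nth_mem[OF l(1)[OF v]]] l(2)[OF v] by (simp add: card_Diff_singleton)
    finally show "card (inb S) \<le> k" .
  qed auto
qed

end

section \<open>Branching number and size of the search tree\<close>

lemma few_low_indegree:
  fixes C :: "'a set"
  assumes "finite C" "\<And>v. (v, v) \<notin> E"
    and ind: "\<And>v. v \<in> C \<Longrightarrow> card {u \<in> C. (u, v) \<in> E} \<le> k"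
    and non: "\<And>v. v \<in> C \<Longrightarrow> card {u \<in> C. u \<noteq> v \<and> (u, v) \<notin> E \<and> (v, u) \<notin> E} \<le> h"
  shows "card C \<le> h + 2 * k + 1"
proof (cases "C = {}")
  case False
  let ?I = "\<lambda>v. {u \<in> C. (u, v) \<in> E}" and ?O = "\<lambda>v. {u \<in> C. (v, u) \<in> E}"
    and ?N = "\<lambda>v. {u \<in> C. u \<noteq> v \<and> (u, v) \<notin> E \<and> (v, u) \<notin> E}"
  have deg: "card C \<le> Suc (card (?I v) + card (?O v) + h)" if v: "v \<in> C" for v
  proof -
    have "card C \<le> card (insert v ((?I v \<union> ?O v) \<union> ?N v))"
      using assms(1) by (intro card_mono) auto
    also have "\<dots> \<le> Suc (card ((?I v \<union> ?O v) \<union> ?N v))" by (rule card_insert_le_m1) auto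
    also have "card ((?I v \<union> ?O v) \<union> ?N v) \<le> card (?I v) + card (?O v) + card (?N v)"
      by (meson add_le_mono card_Un_le le_refl le_trans)
    finally show ?thesis using non[OF v] by linarith
  qed
  \<comment> \<open>Single out-degrees may be large, but summed over \<open>C\<close> they count the
    same arcs as the in-degrees.\<close>
  have swap: "(\<Sum>v\<in>C. card (?O v)) = (\<Sum>v\<in>C. card (?I v))"
    using sum.swap_restrict[OF assms(1,1), of "\<lambda>_ _. 1 :: nat" "\<lambda>v u. (v, u) \<in> E"]
    by simp
  have "card C * card C = (\<Sum>v\<in>C. card C)" by simp
  also have "\<dots> \<le> (\<Sum>v\<in>C. Suc (card (?I v) + card (?O v) + h))" by (intro sum_mono deg)
  also have "\<dots> = card C * Suc h + 2 * (\<Sum>v\<in>C. card (?I v))"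
    by (simp add: sum.distrib sum_Suc swap algebra_simps)
  also have "(\<Sum>v\<in>C. card (?I v)) \<le> card C * k"
    using sum_mono[of C "\<lambda>v. card (?I v)" "\<lambda>_. k"] ind by simp
  finally have "card C * card C \<le> card C * (h + 2 * k + 1)" by (simp add: algebra_simps)
  moreover have "card C > 0" using False assms(1) by (simp add: card_gt_0_iff)
  ultimately show ?thesis by (simp only: mult_le_cancel1)
qed simp

context ordering
begin

text \<open>A candidate with an arc to the candidate \<open>v\<close> is counted by
  \<open>inb\<close> once \<open>v\<close> is inserted, so \<open>v\<close> has at most
  \<open>k\<close> in-neighbours among the candidates.\<close>

lemma card_cands:
  assumes "\<And>v. v < n \<Longrightarrow> card {u \<in> {..<n}. u \<noteq> v \<and> (u, v) \<notin> E \<and> (v, u) \<notin> E} \<le> h"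
  shows "card {v \<in> {..<n} - X. card (inb (insert v X)) \<le> k} \<le> h + 2 * k + 1" (is "card ?C \<le> _")
proof (rule few_low_indegree)
  fix v assume v: "v \<in> ?C"
  have "{u \<in> ?C. (u, v) \<in> E} \<subseteq> inb (insert v X)" using loopless by (auto simp: inb_def)
  then have "card {u \<in> ?C. (u, v) \<in> E} \<le> card (inb (insert v X))" by (intro card_mono) auto
  then show "card {u \<in> ?C. (u, v) \<in> E} \<le> k" using v by simp
  have "card {u \<in> ?C. u \<noteq> v \<and> (u, v) \<notin> E \<and> (v, u) \<notin> E}
      \<le> card {u \<in> {..<n}. u \<noteq> v \<and> (u, v) \<notin> E \<and> (v, u) \<notin> E}"
    by (intro card_mono) auto
  also have "\<dots> \<le> h" using assms v by simp
  finally show "card {u \<in> ?C. u \<noteq> v \<and> (u, v) \<notin> E \<and> (v, u) \<notin> E} \<le> h" .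
qed (use loopless in auto)

text \<open>The added 1 closes the induction: a root with at most \<open>B\<close> kids of size at
  most \<open>2 * P - 1\<close> gives \<open>2 + B * (2 * P - 1)\<close>, which is at most
  \<open>2 * B * P\<close> because \<open>B \<ge> 2\<close>.\<close>

lemma tsize_bound:
  assumes B: "2 \<le> B" "\<And>X. card {v \<in> {..<n} - X. card (inb (insert v X)) \<le> k} \<le> B"
  shows "tinv i t \<Longrightarrow> tsize t + 1 \<le> 2 * B ^ (k - card (inb (set (taken t))))"
proof (induction t rule: tree.induct)
  case (Node v X ts)
  show ?case
  proof (cases "ts = []")
    case True
    have "1 \<le> B ^ (k - card (inb (set X)))" using B(1) by simp
    with True show ?thesis by simp
  next
    case False
    let ?f = "\<lambda>X. card (inb (set X))"
    have K: "kinv i X ts" "\<And>t. t \<in> set ts \<Longrightarrow> ?f X < ?f (taken t)"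
      using Node.prems False by (auto simp: tinv_iff)
    let ?P = "B ^ (k - Suc (?f X))"
    have "?P \<ge> 1" using B by simp
    have each: "tsize t \<le> 2 * ?P - 1" if t: "t \<in> set ts" for t
    proof -
      have "tinv i t" using K t by (simp add: kinv_def)
      then have "tsize t + 1 \<le> 2 * B ^ (k - ?f (taken t))" using Node.IH[OF t] by simp
      also have "\<dots> \<le> 2 * ?P" using K(2)[OF t] B by (intro mult_le_mono power_increasing) auto
      finally show ?thesis by simp
    qed
    have "length ts = card (seed ` set ts)"
      using K(1) distinct_card[of "map seed ts"] by (simp add: kinv_def)
    also have "\<dots> \<le> card {v \<in> {..<n} - set X. card (inb (insert v (set X))) \<le> k}"
      using K(1) by (intro card_mono) (auto simp: kinv_def)
    also have "\<dots> \<le> B" by (rule B)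
    finally have len: "length ts \<le> B" .
    have "sum_list (map tsize ts) \<le> sum_list (map (\<lambda>_. 2 * ?P - 1) ts)"
      using each by (rule sum_list_mono)
    also have "\<dots> \<le> B * (2 * ?P - 1)" using len by (simp add: sum_list_triv)
    finally have "tsize (Node v X ts) + 1 \<le> 2 + B * (2 * ?P - 1)" by simp
    also have "\<dots> \<le> 2 * (B * ?P)"
    proof -
      have "B \<le> B * (2 * ?P)" using \<open>?P \<ge> 1\<close> by simp
      then show ?thesis using B(1) unfolding diff_mult_distrib2 by linarith
    qed
    \<comment> \<open>No truncation occurs in the exponent: a kid has value at most \<open>k\<close>
      and more than the root.\<close>
    also have "B * ?P = B ^ (k - ?f X)"
    proof -
      obtain t where t: "t \<in> set ts" using False by (cases ts) auto
      then have "seq (taken t)" using K(1) tinv_seq by (auto simp: kinv_def)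
      then have "?f X < k" using K(2)[OF t] by (simp add: seq_def)
      then have "k - ?f X = Suc (k - Suc (?f X))" by simp
      then show ?thesis by simp
    qed
    finally show ?thesis by simp
  qed
qed

end

section \<open>The program\<close>

abbreviation (input) "x0 \<equiv> Var 0"
abbreviation (input) "x1 \<equiv> Var (Suc 0)"
abbreviation (input) "x2 \<equiv> Var (Suc (Suc 0))"
abbreviation (input) "x3 \<equiv> Var (Suc (Suc (Suc 0)))"
abbreviation (input) "x4 \<equiv> Var (Suc (Suc (Suc (Suc 0))))"
abbreviation (input) "x5 \<equiv> Var (Suc (Suc (Suc (Suc (Suc 0)))))"
abbreviation (input) "x6 \<equiv> Var (Suc (Suc (Suc (Suc (Suc (Suc 0))))))"
abbreviation (input) "x7 \<equiv> Var (Suc (Suc (Suc (Suc (Suc (Suc (Suc 0)))))))"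

abbreviation (input) "Tt \<equiv> Mk_Cell Mk_Atom Mk_Atom"

definition Not_e :: "expr \<Rightarrow> expr" where "Not_e e = If_Atom e Tt Mk_Atom"
definition And_e :: "expr \<Rightarrow> expr \<Rightarrow> expr" where "And_e e e' = If_Atom e Mk_Atom e'"
definition Or_e :: "expr \<Rightarrow> expr \<Rightarrow> expr" where "Or_e e e' = If_Atom e e' Tt"

text \<open>
  The loop bodies below are run on a list and a parameter. The predicate \<open>p\<close> finds the current
  element in \<open>x0\<close> and the parameter in \<open>x2\<close>.
\<close>

definition Filter_e :: "nat \<Rightarrow> expr \<Rightarrow> expr" where
  "Filter_e f p = If_Atom x0 Mk_Atom (Bind (Left x0) (Bind p
     (Bind (Call f [Right x2, x3]) (If_Atom x1 x0 (Mk_Cell x2 x0)))))"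

definition Ex_e :: "nat \<Rightarrow> expr \<Rightarrow> expr" where
  "Ex_e f p = If_Atom x0 Mk_Atom (Bind (Left x0) (If_Atom p (Call f [Right x1, x2]) Tt))"

definition Map_e :: "nat \<Rightarrow> expr \<Rightarrow> expr" where
  "Map_e f e = If_Atom x0 Mk_Atom (Bind (Left x0) (Mk_Cell e (Call f [Right x1, x2])))"

abbreviation (input) "eq_f \<equiv> (0::nat)"
abbreviation (input) "le_f \<equiv> (1::nat)"
abbreviation (input) "nth_f \<equiv> (2::nat)"
abbreviation (input) "mem_f \<equiv> (3::nat)"
abbreviation (input) "arc_f \<equiv> (4::nat)"
abbreviation (input) "boundary_f \<equiv> (5::nat)"
abbreviation (input) "cands_f \<equiv> (6::nat)"
abbreviation (input) "improve_f \<equiv> (7::nat)"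
abbreviation (input) "leaves_f \<equiv> (8::nat)"
abbreviation (input) "revapp_f \<equiv> (9::nat)"
abbreviation (input) "diff_f \<equiv> (10::nat)"
abbreviation (input) "demand_f \<equiv> (11::nat)"
abbreviation (input) "lookup_f \<equiv> (12::nat)"
abbreviation (input) "nbrs_f \<equiv> (13::nat)"
abbreviation (input) "free_f \<equiv> (14::nat)"
abbreviation (input) "push_f \<equiv> (15::nat)"
abbreviation (input) "append_f \<equiv> (16::nat)"
abbreviation (input) "search_f \<equiv> (17::nat)"
abbreviation (input) "matching_f \<equiv> (18::nat)"
abbreviation (input) "minimizer_f \<equiv> (19::nat)"
abbreviation (input) "child_f \<equiv> (20::nat)"
abbreviation (input) "follow_f \<equiv> (21::nat)"
abbreviation (input) "collapse_f \<equiv> (22::nat)"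
abbreviation (input) "advs_f \<equiv> (23::nat)"
abbreviation (input) "adv_f \<equiv> (24::nat)"
abbreviation (input) "grow_f \<equiv> (25::nat)"
abbreviation (input) "settle_f \<equiv> (26::nat)"
abbreviation (input) "rounds_f \<equiv> (27::nat)"
abbreviation (input) "bags_f \<equiv> (28::nat)"
abbreviation (input) "upt_f \<equiv> (29::nat)"

text \<open>
  A context packs the adjacency matrix, the list of all vertices and \<open>k\<close>.
\<close>

abbreviation (input) "Graph_e c \<equiv> Left c"
abbreviation (input) "Verts_e c \<equiv> Left (Right c)"
abbreviation (input) "Width_e c \<equiv> Right (Right c)"
abbreviation (input) "Boundary_e X c \<equiv> Call boundary_f [Verts_e c, Mk_Cell X (Graph_e c)]"
abbreviation (input) "Hits_e X q G \<equiv> Or_e (Call mem_f [X, q]) (Call arc_f [X, Mk_Cell q G])"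
abbreviation (input) "Seed_e t \<equiv> Left t"
abbreviation (input) "Taken_e t \<equiv> Left (Right t)"
abbreviation (input) "Kids_e t \<equiv> Right (Right t)"
abbreviation (input) "Node_e v X ts \<equiv> Mk_Cell v (Mk_Cell X ts)"
abbreviation (input) "Single_e e \<equiv> Mk_Cell e Mk_Atom"

definition eq_b where
  "eq_b = If_Atom x0 (If_Atom x1 Tt Mk_Atom) (If_Atom x1 Mk_Atom (Call eq_f [Right x0, Right x1]))"
definition le_b where
  "le_b = If_Atom x0 Tt (If_Atom x1 Mk_Atom (Call le_f [Right x0, Right x1]))"
definition nth_b where
  "nth_b = If_Atom x1 (Left x0) (Call nth_f [Right x0, Right x1])"
definition mem_b where
  "mem_b = Ex_e mem_f (Call eq_f [x2, x0])"
definition arc_b where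
  "arc_b = Ex_e arc_f (Call nth_f [Call nth_f [Right x2, Left x2], x0])"
definition boundary_b where
  "boundary_b = Filter_e boundary_f
     (And_e (Not_e (Call mem_f [Left x2, x0])) (Call arc_f [Left x2, Mk_Cell x0 (Right x2)]))"
definition cands_b where
  "cands_b = Filter_e cands_f (And_e (Not_e (Call mem_f [Left x2, x0]))
     (Call le_f [Boundary_e (Mk_Cell x0 (Left x2)) (Right x2), Width_e (Right x2)]))"
definition improve_b where
  "improve_b = Filter_e improve_f
     (Call le_f [Boundary_e (Mk_Cell x0 (Left x2)) (Right x2), Boundary_e (Left x2) (Right x2)])"
definition leaves_b where
  "leaves_b = Map_e leaves_f (Node_e x0 (Mk_Cell x0 x2) Mk_Atom)"
definition revapp_b where
  "revapp_b = If_Atom x0 x1 (Call revapp_f [Right x0, Mk_Cell (Left x0) x1])"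
definition diff_b where
  "diff_b = Filter_e diff_f (Not_e (Call mem_f [x2, x0]))"
definition demand_b where
  "demand_b = Filter_e demand_f (And_e (Hits_e (Right (Left x2)) x0 (Right x2))
     (Not_e (Hits_e (Left (Left x2)) x0 (Right x2))))"
text \<open>The value found is wrapped in a cell, since the code of the vertex 0 is itself
  \<open>Atom\<close>.\<close>

definition lookup_b where
  "lookup_b = If_Atom x0 Mk_Atom (If_Atom (Call eq_f [x1, Left (Left x0)])
     (Call lookup_f [Right x0, x1]) (Single_e (Right (Left x0))))"
definition nbrs_b where
  "nbrs_b = Filter_e nbrs_f (And_e (Not_e (Call mem_f [Left (Left x2), x0]))
     (Or_e (Call eq_f [Right (Left x2), x0])
       (Call nth_f [Call nth_f [Right x2, Right (Left x2)], x0])))"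
definition free_b where
  "free_b = Filter_e free_f (Not_e (Call lookup_f [x2, x0]))"
text \<open>The parameter packs \<open>q\<close>, the matching of the popped entry and the rest of
  the stack, in front of which the new entries are put.\<close>

definition push_b where
  "push_b = If_Atom x0 (Right (Right x1))
     (Mk_Cell
       (Mk_Cell (Left (Call lookup_f [Left (Right x1), Left x0]))
         (Mk_Cell (Mk_Cell (Left x0) (Left x1)) (Left (Right x1))))
       (Call push_f [Right x0, x1]))"
definition append_b where
  "append_b = If_Atom x0 x1 (Mk_Cell (Left x0) (Call append_f [Right x0, x1]))"

text \<open>Arguments of \<open>search_b\<close>: fuel, stack, visited, \<open>A\<close>, the state \<open>(M0, D0)\<close>, the graph.\<close>

definition search_b where
  "search_b = If_Atom x0 (Mk_Cell (Left x4) x2) (If_Atom x1 (Mk_Cell (Left x4) x2)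
     (Bind (Call nbrs_f [x3, Mk_Cell (Mk_Cell x2 (Left (Left x1))) x5])
       (Bind (Call free_f [x0, Right (Left x2)])
         (If_Atom x0
           (Call search_f [Right x2,
              Call push_f [x1, Mk_Cell (Left (Left x3)) (Mk_Cell (Right (Left x3)) (Right x3))],
              Call append_f [x1, x4], x5, x6, x7])
           (Mk_Cell (Mk_Cell (Mk_Cell (Left x0) (Left (Left x3))) (Right (Left x3))) (Right x6))))))"

text \<open>Arguments of \<open>matching_b\<close>: \<open>Q\<close>, the state, \<open>A\<close>, fuel, the graph.\<close>

definition matching_b where
  "matching_b = If_Atom x0 x1
     (Call matching_f [Right x0,
        Call search_f [x3, Single_e (Mk_Cell (Left x0) (Left x1)), Right x1, x2, x1, x4],
        x2, x3, x4])"
text \<open>\<open>Tt\<close> serves as the pair of two empty lists, and the vertex list with one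
  more cell as the fuel \<open>Suc n\<close>. The result is reversed into the order of insertion,
  which \<open>follow\<close> expects.\<close>

definition minimizer_b where
  "minimizer_b = Bind
     (Call matching_f [Call demand_f [Verts_e x2, Mk_Cell (Mk_Cell x0 x1) (Graph_e x2)], Tt,
        Call diff_f [x1, x0], Mk_Cell Mk_Atom (Verts_e x2), Graph_e x2])
     (Call revapp_f [Call diff_f [x2, Right x0], Mk_Atom])"
definition child_b where
  "child_b = Filter_e child_f (Call eq_f [x2, Seed_e x0])"
definition follow_b where
  "follow_b = Bind (Call diff_f [x1, Taken_e x0])
     (If_Atom x0 (Single_e x1)
       (If_Atom (Kids_e x1)
         (Single_e (Node_e (Seed_e x1) (Call revapp_f [x0, Taken_e x1]) Mk_Atom))
         (Bind (Call child_f [Kids_e x1, Left x0])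
           (If_Atom x0 Mk_Atom (Call follow_f [Left x0, Right x1])))))"
definition collapse_b where
  "collapse_b = Filter_e collapse_f
     (Call le_f [Boundary_e (Taken_e x0) (Right x2), Boundary_e (Left x2) (Right x2)])"
definition advs_b where
  "advs_b = If_Atom x0 Mk_Atom
     (Call append_f [Call adv_f [Left x0, x1], Call advs_f [Right x0, x1]])"
definition adv_b where
  "adv_b = If_Atom (Kids_e x0) (Call grow_f [Seed_e x0, Taken_e x0, x1])
     (Call settle_f [Seed_e x0, Taken_e x0, Call advs_f [Kids_e x0, x1], x1])"
definition grow_b where
  "grow_b = If_Atom (Call diff_f [Verts_e x2, x1]) (Single_e (Node_e x0 x1 Mk_Atom))
     (Bind (Call cands_f [Verts_e x2, Mk_Cell x1 x2])
       (Bind (Call improve_f [x0, Mk_Cell x2 x3])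
         (If_Atom x0
           (If_Atom x1 Mk_Atom (Single_e (Node_e x2 x3 (Call leaves_f [x1, x3]))))
           (Single_e (Node_e x2 (Mk_Cell (Left x0) x3) Mk_Atom)))))"
definition settle_b where
  "settle_b = If_Atom x2 Mk_Atom
     (Bind (Call collapse_f [x2, Mk_Cell x1 x3])
       (If_Atom x0 (Single_e (Node_e x1 x2 x3))
         (Bind (Call follow_f [Node_e x1 x2 x3, Call minimizer_f [x2, Taken_e (Left x0), x4]])
           (If_Atom x0 Mk_Atom (Single_e (Mk_Cell x2 (Right (Left x0))))))))"
definition rounds_b where
  "rounds_b = If_Atom x0 x1
     (If_Atom x1 Mk_Atom (Call rounds_f [Right x0, Call adv_f [Left x1, x2], x2]))"
definition bags_b where
  "bags_b = If_Atom x0 Mk_Atom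
     (Mk_Cell (Mk_Cell (Left x0) (Boundary_e x0 x1)) (Call bags_f [Right x0, x1]))"
definition upt_b where
  "upt_b = If_Atom x0 Mk_Atom (Mk_Cell x1 (Call upt_f [Right x0, Mk_Cell Mk_Atom x1]))"

text \<open>The input is \<open>h\<close>, the adjacency matrix, \<open>k\<close>; a list is also a unary number, its length.\<close>

definition main_e where
  "main_e = Bind (Call upt_f [x1, Mk_Atom])
     (If_Atom (Call le_f [x2, x3])
       (Bind (Mk_Cell x2 (Mk_Cell x0 x3))
         (Bind (Call rounds_f [x1, Single_e (Node_e Mk_Atom Mk_Atom Mk_Atom), x0])
           (If_Atom x0 Mk_Atom (Mk_Cell Mk_Atom (Call bags_f [Taken_e (Left x0), x1])))))
       (Mk_Cell Mk_Atom (Single_e x0)))"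

definition prog :: "expr list" where
  "prog = [eq_b, le_b, nth_b, mem_b, arc_b, boundary_b, cands_b, improve_b, leaves_b, revapp_b,
     diff_b, demand_b, lookup_b, nbrs_b, free_b, push_b, append_b, search_b, matching_b, minimizer_b,
     child_b, follow_b, collapse_b, advs_b, adv_b, grow_b, settle_b, rounds_b, bags_b, upt_b]"

section \<open>Program runs with upper bounds on their cost\<close>

definition runs :: "val list \<Rightarrow> expr \<Rightarrow> val \<Rightarrow> nat \<Rightarrow> bool" where
  "runs env e v b \<longleftrightarrow> (\<exists>t \<le> b. evaluates prog env e v t)"

definition runs_list :: "val list \<Rightarrow> expr list \<Rightarrow> val list \<Rightarrow> nat \<Rightarrow> bool" where
  "runs_list env es vs b \<longleftrightarrow> (\<exists>t \<le> b. evaluates_list prog env es vs t)"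

definition calls :: "nat \<Rightarrow> val list \<Rightarrow> val \<Rightarrow> nat \<Rightarrow> bool" where
  "calls f vs v b \<longleftrightarrow> f < length prog \<and> runs vs (prog ! f) v b"

lemma runs_le: "runs env e v b \<Longrightarrow> v = w \<Longrightarrow> b \<le> c \<Longrightarrow> runs env e w c"
  unfolding runs_def using order_trans by blast

lemma calls_le: "calls f vs v b \<Longrightarrow> v = w \<Longrightarrow> b \<le> c \<Longrightarrow> calls f vs w c"
  by (auto simp: calls_def intro: runs_le)

lemma runs_Var0: "runs (v # env) (Var 0) v 1"
  using ev_Var[of 0 "v # env"] by (auto simp: runs_def)

lemma runs_VarS: "runs env (Var i) v b \<Longrightarrow> runs (w # env) (Var (Suc i)) v b"
proof -
  assume "runs env (Var i) v b"
  then obtain t where t: "t \<le> b" "evaluates prog env (Var i) v t" by (auto simp: runs_def)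
  from t(2) have "i < length env" "v = env ! i" "t = 1" by (auto elim: evaluates_VarE)
  with ev_Var[of "Suc i" "w # env" prog] t show ?thesis by (auto simp: runs_def)
qed

lemma runs_Atom: "runs env Mk_Atom Atom 1"
  unfolding runs_def using ev_Atom by blast

lemma runs_Cell:
  "runs env e v b \<Longrightarrow> runs env e' v' b' \<Longrightarrow> runs env (Mk_Cell e e') (Cell v v') (b + b' + 1)"
  unfolding runs_def by (meson ev_Cell add_mono le_refl)

lemma runs_Left: "runs env e (Cell v w) b \<Longrightarrow> runs env (Left e) v (b + 1)"
  unfolding runs_def using ev_Left[of prog env e "Cell v w"] by (metis left.simps(2) add_le_mono1)

lemma runs_Right: "runs env e (Cell v w) b \<Longrightarrow> runs env (Right e) w (b + 1)"
  unfolding runs_def using ev_Right[of prog env e "Cell v w"] by (metis right.simps(2) add_le_mono1)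

text \<open>Both branches are charged, so the bound does not depend on the test, but a branch has to
  run only if it is taken. An impossible branch is priced at 0 by
  \<open>runs_absurd\<close>.\<close>

lemma runs_If:
  assumes "runs env e w b" "w = Atom \<Longrightarrow> runs env e1 v1 b1" "w \<noteq> Atom \<Longrightarrow> runs env e2 v2 b2"
  shows "runs env (If_Atom e e1 e2) (if w = Atom then v1 else v2) (b + (b1 + b2) + 1)"
proof (cases w)
  case Atom
  with assms obtain t t1 where "t \<le> b" "t1 \<le> b1" "evaluates prog env e Atom t" "evaluates prog env e1 v1 t1"
    by (auto simp: runs_def)
  with Atom ev_If_Atom[of prog env e t e1 v1 t1 e2] show ?thesis
    unfolding runs_def by (intro exI[of _ "t + t1 + 1"]) simp
next
  case (Cell x y)
  with assms obtain t t1 where "t \<le> b" "t1 \<le> b2" "evaluates prog env e (Cell x y) t" "evaluates prog env e2 v2 t1"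
    by (auto simp: runs_def)
  with Cell ev_If_Cell[of prog env e x y t e2 v2 t1 e1] show ?thesis
    unfolding runs_def by (intro exI[of _ "t + t1 + 1"]) simp
qed

lemma runs_absurd: "Cell a c = Atom \<Longrightarrow> runs env e Atom 0" "Atom \<noteq> Atom \<Longrightarrow> runs env e Atom 0"
  by simp_all

lemma runs_Bind:
  "runs env e v b \<Longrightarrow> runs (v # env) e' w b' \<Longrightarrow> runs env (Bind e e') w (b + b' + 1)"
  unfolding runs_def by (meson ev_Bind add_mono le_refl)

lemma runs_Call:
  "runs_list env es vs b \<Longrightarrow> calls f vs v b' \<Longrightarrow> runs env (Call f es) v (b + b' + 1)"
  unfolding runs_def runs_list_def calls_def by (meson ev_Call add_mono le_refl)

lemma runs_Nil: "runs_list env [] [] 0"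
  by (auto simp: runs_list_def intro: ev_Nil)

lemma runs_Cons:
  "runs env e v b \<Longrightarrow> runs_list env es vs b' \<Longrightarrow> runs_list env (e # es) (v # vs) (b + b')"
  unfolding runs_def runs_list_def by (meson ev_Cons add_mono)

lemma enc_bool_simps [simp]: "enc_bool p = Atom \<longleftrightarrow> \<not> p" "Atom = enc_bool p \<longleftrightarrow> \<not> p"
  "Cell Atom Atom = enc_bool p \<longleftrightarrow> p"
  by (auto simp: enc_bool_def)

lemma runs_Not: "runs env e (enc_bool p) b \<Longrightarrow> runs env (Not_e e) (enc_bool (\<not> p)) (b + 5)"
  unfolding Not_e_def
  by (rule runs_le, rule runs_If, assumption, (rule runs_Cell runs_Atom)+) (auto simp: enc_bool_def)

text \<open>The second operand has to run only if the first holds. \<open>calls_cands\<close> relies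
  on this: there the extended list is short enough because the vertex is new.\<close>

lemma runs_And:
  assumes "runs env e (enc_bool p) b" "p \<Longrightarrow> runs env e' (enc_bool q) b'"
  shows "runs env (And_e e e') (enc_bool (p \<and> q)) (b + b' + 2)"
  unfolding And_e_def
  by (rule runs_le, rule runs_If, rule assms(1), rule runs_Atom, rule assms(2)) (auto simp: enc_bool_def split: if_splits)

lemma runs_Or:
  assumes "runs env e (enc_bool p) b" "runs env e' (enc_bool q) b'"
  shows "runs env (Or_e e e') (enc_bool (p \<or> q)) (b + b' + 5)"
  unfolding Or_e_def
  by (rule runs_le, rule runs_If, rule assms(1), rule assms(2), (rule runs_Cell runs_Atom)+)
    (auto simp: enc_bool_def)

lemmas runs_rules = runs_Var0 runs_VarS runs_Atom runs_Cell runs_Left runs_Right runs_If runs_Bind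
  runs_Call runs_Nil runs_Cons runs_Not runs_And runs_Or

lemma callsI:
  "prog ! f = body \<Longrightarrow> runs vs body w c \<Longrightarrow> w = v \<Longrightarrow> c \<le> b \<Longrightarrow> f < length prog \<Longrightarrow> calls f vs v b"
  unfolding calls_def using runs_le by blast

lemma prog_nth:
  "prog ! eq_f = eq_b" "prog ! le_f = le_b" "prog ! nth_f = nth_b" "prog ! mem_f = mem_b"
  "prog ! arc_f = arc_b" "prog ! boundary_f = boundary_b" "prog ! cands_f = cands_b"
  "prog ! improve_f = improve_b" "prog ! leaves_f = leaves_b" "prog ! revapp_f = revapp_b"
  "prog ! diff_f = diff_b" "prog ! demand_f = demand_b" "prog ! lookup_f = lookup_b"
  "prog ! nbrs_f = nbrs_b" "prog ! free_f = free_b" "prog ! push_f = push_b"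
  "prog ! append_f = append_b" "prog ! search_f = search_b" "prog ! matching_f = matching_b"
  "prog ! minimizer_f = minimizer_b" "prog ! child_f = child_b" "prog ! follow_f = follow_b"
  "prog ! collapse_f = collapse_b" "prog ! advs_f = advs_b" "prog ! adv_f = adv_b"
  "prog ! grow_f = grow_b" "prog ! settle_f = settle_b" "prog ! rounds_f = rounds_b"
  "prog ! bags_f = bags_b" "prog ! upt_f = upt_b"
  by (simp_all add: prog_def)

lemma length_prog: "length prog = 30"
  by (simp add: prog_def)

text \<open>The induction yields a sharper bound in the length of the list; the final one has the
  shape of \<open>loop\<close>, in which all passes over lists are priced.\<close>

lemma calls_Filter:
  assumes f: "f < length prog" "prog ! f = Filter_e f p"
    and p: "\<And>x l. x \<in> set xs \<Longrightarrow> runs [e x, l, a] p (enc_bool (Q x)) T"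
    and N: "length xs \<le> N"
  shows "calls f [enc_list (map e xs), a] (enc_list (map e (filter Q xs))) ((N + 1) * (T + 50) + 50)"
proof -
  have "calls f [enc_list (map e xs), a] (enc_list (map e (filter Q xs))) (length xs * (T + 20) + 10)"
    using p
  proof (induction xs)
    case Nil
    show ?case
      by (rule callsI[OF f(2), unfolded Filter_e_def], simp only: list.map enc_list.simps,
          (erule runs_absurd | rule runs_rules)+) (use f in auto)
  next
    case (Cons x xs)
    have IH: "calls f [enc_list (map e xs), a] (enc_list (map e (filter Q xs))) (length xs * (T + 20) + 10)"
      using Cons by simp
    have p: "runs [e x, Cell (e x) (enc_list (map e xs)), a] p (enc_bool (Q x)) T"
      using Cons.prems by simp
    show ?case
      by (rule callsI[OF f(2), unfolded Filter_e_def], simp only: list.map enc_list.simps,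
          (erule runs_absurd | rule runs_rules IH p)+) (use f in auto)
  qed
  moreover have "length xs * (T + 20) \<le> (N + 1) * (T + 50)" using N by (intro mult_le_mono) auto
  ultimately show ?thesis by (elim calls_le) auto
qed

lemma calls_Ex:
  assumes f: "f < length prog" "prog ! f = Ex_e f p"
    and p: "\<And>x l. x \<in> set xs \<Longrightarrow> runs [e x, l, a] p (enc_bool (Q x)) T"
    and N: "length xs \<le> N"
  shows "calls f [enc_list (map e xs), a] (enc_bool (\<exists>x \<in> set xs. Q x)) ((N + 1) * (T + 50) + 50)"
proof -
  have "calls f [enc_list (map e xs), a] (enc_bool (\<exists>x \<in> set xs. Q x)) (length xs * (T + 20) + 10)"
    using p
  proof (induction xs)
    case Nil
    show ?case
      by (rule callsI[OF f(2), unfolded Ex_e_def], simp only: list.map enc_list.simps,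
          (erule runs_absurd | rule runs_rules)+) (use f in auto)
  next
    case (Cons x xs)
    have IH: "calls f [enc_list (map e xs), a] (enc_bool (\<exists>x \<in> set xs. Q x)) (length xs * (T + 20) + 10)"
      using Cons by simp
    have p: "runs [e x, Cell (e x) (enc_list (map e xs)), a] p (enc_bool (Q x)) T"
      using Cons.prems by simp
    show ?case
      by (rule callsI[OF f(2), unfolded Ex_e_def], simp only: list.map enc_list.simps,
          (erule runs_absurd | rule runs_rules IH p)+) (use f in \<open>auto simp: enc_bool_def\<close>)
  qed
  moreover have "length xs * (T + 20) \<le> (N + 1) * (T + 50)" using N by (intro mult_le_mono) auto
  ultimately show ?thesis by (elim calls_le) auto
qed

lemma calls_Map:
  assumes f: "f < length prog" "prog ! f = Map_e f p"
    and p: "\<And>x l. x \<in> set xs \<Longrightarrow> runs [e x, l, a] p (g x) T"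
    and N: "length xs \<le> N"
  shows "calls f [enc_list (map e xs), a] (enc_list (map g xs)) ((N + 1) * (T + 50) + 50)"
proof -
  have "calls f [enc_list (map e xs), a] (enc_list (map g xs)) (length xs * (T + 20) + 10)"
    using p
  proof (induction xs)
    case Nil
    show ?case
      by (rule callsI[OF f(2), unfolded Map_e_def], simp only: list.map enc_list.simps,
          (erule runs_absurd | rule runs_rules)+) (use f in auto)
  next
    case (Cons x xs)
    have IH: "calls f [enc_list (map e xs), a] (enc_list (map g xs)) (length xs * (T + 20) + 10)"
      using Cons by simp
    have p: "runs [e x, Cell (e x) (enc_list (map e xs)), a] p (g x) T"
      using Cons.prems by simp
    show ?case
      by (rule callsI[OF f(2), unfolded Map_e_def], simp only: list.map enc_list.simps,
          (erule runs_absurd | rule runs_rules IH p)+) (use f in auto)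
  qed
  moreover have "length xs * (T + 20) \<le> (N + 1) * (T + 50)" using N by (intro mult_le_mono) auto
  ultimately show ?thesis by (elim calls_le) auto
qed

section \<open>Numbers, lists and the adjacency matrix in the program\<close>

primrec spine :: "val \<Rightarrow> nat" where
  "spine Atom = 0"
| "spine (Cell a b) = Suc (spine b)"

lemma spine_enc [simp]: "spine (enc_list xs) = length xs" "spine (enc_nat m) = m"
  by (induction xs; simp) (induction m; simp)

lemma calls_eq: "calls eq_f [enc_nat a, enc_nat b] (enc_bool (a = b)) (10 * a + 10)"
proof (induction a arbitrary: b)
  case 0
  show ?case
    by (cases b; simp only: enc_nat.simps; rule callsI[OF prog_nth(1), unfolded eq_b_def];
        ((erule runs_absurd | rule runs_rules)+)?; simp add: enc_bool_def length_prog)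
next
  case (Suc a)
  show ?case
    by (cases b; simp only: enc_nat.simps; rule callsI[OF prog_nth(1), unfolded eq_b_def];
        ((erule runs_absurd | rule runs_rules Suc.IH)+)?; simp add: enc_bool_def length_prog)
qed

text \<open>Stated for \<open>spine\<close> because the program compares lengths: those of two
  boundaries, and those of a boundary or of the matrix with a number.\<close>

lemma calls_le_f: "calls le_f [a, b] (enc_bool (spine a \<le> spine b)) (10 * spine a + 10)"
proof (induction a arbitrary: b)
  case Atom
  show ?case
    by (rule callsI[OF prog_nth(2), unfolded le_b_def];
        ((erule runs_absurd | rule runs_rules)+)?; simp add: enc_bool_def length_prog)
next
  case (Cell a a')
  show ?case
    by (cases b; simp only: ; rule callsI[OF prog_nth(2), unfolded le_b_def];
        ((erule runs_absurd | rule runs_rules Cell.IH)+)?; simp add: enc_bool_def length_prog)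
qed

lemma calls_nth: "i < length vs \<Longrightarrow> calls nth_f [enc_list vs, enc_nat i] (vs ! i) (10 * i + 10)"
proof (induction i arbitrary: vs)
  case 0
  then obtain w ws where vs: "vs = w # ws" by (cases vs) auto
  show ?case unfolding vs(1)
    by (simp only: enc_nat.simps enc_list.simps; rule callsI[OF prog_nth(3), unfolded nth_b_def];
        ((erule runs_absurd | rule runs_rules)+)?; simp add: length_prog)
next
  case (Suc i)
  then obtain w ws where vs: "vs = w # ws" "i < length ws" by (cases vs) auto
  show ?case unfolding vs(1)
    by (simp only: enc_nat.simps enc_list.simps; rule callsI[OF prog_nth(3), unfolded nth_b_def];
        ((erule runs_absurd | rule runs_rules Suc.IH[OF vs(2)])+)?; simp add: length_prog)
qed

definition lin :: "nat \<Rightarrow> nat" where "lin n = 10 * n + 10"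
definition loop :: "(nat \<Rightarrow> nat) \<Rightarrow> nat \<Rightarrow> nat" where "loop T n = (n + 1) * (T n + 50) + 50"

abbreviation eseq :: "nat list \<Rightarrow> val" where "eseq X \<equiv> enc_list (map enc_nat X)"

lemma calls_revapp: "calls revapp_f [eseq us, eseq Z] (eseq (rev us @ Z)) (20 * length us + 10)"
proof (induction us arbitrary: Z)
  case Nil
  show ?case
    by (simp only: list.map enc_list.simps; rule callsI[OF prog_nth(10), unfolded revapp_b_def];
        ((erule runs_absurd | rule runs_rules)+)?; simp add: length_prog)
next
  case (Cons u us)
  have IH: "calls revapp_f [eseq us, Cell (enc_nat u) (eseq Z)] (eseq (rev us @ u # Z)) (20 * length us + 10)"
    using Cons.IH[of "u # Z"] by simp
  show ?case
    by (simp only: list.map enc_list.simps; rule callsI[OF prog_nth(10), unfolded revapp_b_def];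
        ((erule runs_absurd | rule runs_rules IH)+)?; simp add: length_prog)
qed

lemma calls_append: "calls append_f [enc_list us, enc_list ws] (enc_list (us @ ws)) (20 * length us + 10)"
proof (induction us)
  case Nil
  show ?case
    by (simp only: list.map enc_list.simps; rule callsI[OF prog_nth(17), unfolded append_b_def];
        ((erule runs_absurd | rule runs_rules)+)?; simp add: length_prog)
next
  case (Cons u us)
  show ?case
    by (simp only: list.map enc_list.simps; rule callsI[OF prog_nth(17), unfolded append_b_def];
        ((erule runs_absurd | rule runs_rules Cons.IH)+)?; simp add: length_prog)
qed

fun eopt :: "nat option \<Rightarrow> val" where
  "eopt None = Atom"
| "eopt (Some q) = Cell (enc_nat q) Atom"

fun epair :: "nat \<times> nat \<Rightarrow> val" where
  "epair (l, q) = Cell (enc_nat l) (enc_nat q)"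

abbreviation emap :: "(nat \<times> nat) list \<Rightarrow> val" where "emap M \<equiv> enc_list (map epair M)"

lemma calls_lookup:
  "calls lookup_f [emap M, enc_nat l] (eopt (map_of M l)) (length M * (10 * l + 50) + 10)"
proof (induction M)
  case Nil
  show ?case
    by (simp only: list.map enc_list.simps; rule callsI[OF prog_nth(13), unfolded lookup_b_def];
        ((erule runs_absurd | rule runs_rules)+)?; simp add: length_prog)
next
  case (Cons e M)
  obtain l' q where e: "e = (l', q)" by fastforce
  show ?case unfolding e
    by (simp only: list.map enc_list.simps epair.simps; rule callsI[OF prog_nth(13), unfolded lookup_b_def];
        ((erule runs_absurd | rule runs_rules Cons.IH calls_eq)+)?; simp add: length_prog)
qed

lemma calls_upt: "calls upt_f [enc_list vs, enc_nat a] (eseq [a..<a + length vs]) (20 * length vs + 10)"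
proof (induction vs arbitrary: a)
  case Nil
  show ?case
    by (simp only: list.map enc_list.simps; rule callsI[OF prog_nth(30), unfolded upt_b_def];
        ((erule runs_absurd | rule runs_rules)+)?; simp add: length_prog)
next
  case (Cons u us)
  have IH: "calls upt_f [enc_list us, Cell Atom (enc_nat a)] (eseq [Suc a..<Suc a + length us]) (20 * length us + 10)"
    using Cons.IH[of "Suc a"] by simp
  show ?case
    by (simp only: list.map enc_list.simps; rule callsI[OF prog_nth(30), unfolded upt_b_def];
        ((erule runs_absurd | rule runs_rules IH)+)?; simp add: length_prog upt_conv_Cons del: upt_Suc)
qed

context ordering
begin

definition egraph :: val where
  "egraph = enc_list (map (\<lambda>u. enc_list (map (\<lambda>v. enc_bool ((u, v) \<in> E)) [0..<n])) [0..<n])"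

abbreviation verts :: val where "verts \<equiv> eseq [0..<n]"

abbreviation ctx :: val where "ctx \<equiv> Cell egraph (Cell verts (enc_nat k))"

text \<open>What the cost bounds need of a list; it also covers lists that are no partial solutions,
  such as the side \<open>A\<close> of a matching.\<close>

definition vseq :: "nat list \<Rightarrow> bool" where
  "vseq X \<longleftrightarrow> length X \<le> n \<and> set X \<subseteq> {..<n}"

lemma vseq_Cons: "vseq X \<Longrightarrow> v < n \<Longrightarrow> v \<notin> set X \<Longrightarrow> distinct X \<Longrightarrow> vseq (v # X)"
proof -
  assume a: "vseq X" "v < n" "v \<notin> set X" "distinct X"
  then have "card (insert v (set X)) \<le> card {..<n}" by (intro card_mono) (auto simp: vseq_def)
  with a show ?thesis by (simp add: vseq_def distinct_card)
qed

lemma seq_vseq: "seq X \<Longrightarrow> vseq X"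
  using card_mono[of "{..<n}" "set X"] distinct_card[of X] by (simp add: seq_def vseq_def)

lemma vseq_filter: "vseq X \<Longrightarrow> vseq (filter Q X)"
  using length_filter_le[of Q X] unfolding vseq_def by (meson filter_is_subset order_trans)

lemma vseq_upt [simp]: "vseq [0..<n]"
  by (auto simp: vseq_def)

lemma calls_eq': "a < n \<Longrightarrow> calls eq_f [enc_nat a, enc_nat b] (enc_bool (a = b)) (lin n)"
  by (rule calls_le[OF calls_eq]) (auto simp: lin_def)

lemma calls_row: "u < n \<Longrightarrow> calls nth_f [egraph, enc_nat u]
    (enc_list (map (\<lambda>v. enc_bool ((u, v) \<in> E)) [0..<n])) (lin n)"
  unfolding egraph_def by (rule calls_le[OF calls_nth]) (auto simp: lin_def)

lemma calls_col: "v < n \<Longrightarrow> calls nth_f [enc_list (map (\<lambda>v. enc_bool ((u, v) \<in> E)) [0..<n]), enc_nat v]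
    (enc_bool ((u, v) \<in> E)) (lin n)"
  by (rule calls_le[OF calls_nth]) (auto simp: lin_def)

end

section \<open>Cost of the program\<close>

definition T_mem :: "nat \<Rightarrow> nat" where "T_mem = loop (\<lambda>n. lin n + 50)"
definition T_arc :: "nat \<Rightarrow> nat" where "T_arc = loop (\<lambda>n. 2 * lin n + 50)"
definition T_boundary :: "nat \<Rightarrow> nat" where "T_boundary = loop (\<lambda>n. T_mem n + T_arc n + 50)"
definition T_cands :: "nat \<Rightarrow> nat" where
  "T_cands = loop (\<lambda>n. T_mem n + T_boundary n + lin n + 100)"
definition T_improve :: "nat \<Rightarrow> nat" where "T_improve = loop (\<lambda>n. 2 * T_boundary n + lin n + 100)"
definition T_diff :: "nat \<Rightarrow> nat" where "T_diff = loop (\<lambda>n. T_mem n + 50)"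
definition T_demand :: "nat \<Rightarrow> nat" where "T_demand = loop (\<lambda>n. 2 * T_mem n + 2 * T_arc n + 100)"
definition T_nbrs :: "nat \<Rightarrow> nat" where "T_nbrs = loop (\<lambda>n. T_mem n + 3 * lin n + 100)"

context ordering
begin

lemma calls_mem:
  assumes X: "length X \<le> n" "v < n"
  shows "calls mem_f [eseq X, enc_nat v] (enc_bool (v \<in> set X)) (T_mem n)"
proof -
  have R: "runs [enc_nat x, l, enc_nat v] (Call eq_f [x2, x0]) (enc_bool (v = x)) (lin n + 50)"
    if "x \<in> set X" for x l
    by (rule runs_le, (rule runs_rules calls_eq'[OF X(2)])+) auto
  show ?thesis
    by (rule calls_le[OF calls_Ex[OF _ prog_nth(4)[unfolded mem_b_def] R, where N = n]])
      (use assms in \<open>auto simp: length_prog T_mem_def loop_def\<close>)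
qed

lemma calls_arc:
  assumes X: "length X \<le> n" "set X \<subseteq> {..<n}" "u < n"
  shows "calls arc_f [eseq X, Cell (enc_nat u) egraph] (enc_bool (\<exists>x \<in> set X. (u, x) \<in> E)) (T_arc n)"
proof -
  have R: "runs [enc_nat x, l, Cell (enc_nat u) egraph]
      (Call nth_f [Call nth_f [Right x2, Left x2], x0]) (enc_bool ((u, x) \<in> E)) (2 * lin n + 50)"
    if "x \<in> set X" for x l
  proof -
    have "x < n" using that X by auto
    then show ?thesis
      by (intro runs_le[OF runs_Call[OF runs_Cons[OF runs_Call[OF _ calls_row[OF X(3)]] runs_Cons[OF _ runs_Nil]] calls_col]])
        (rule runs_rules | simp)+
  qed
  show ?thesis
    by (rule calls_le[OF calls_Ex[OF _ prog_nth(5)[unfolded arc_b_def] R, where N = n]])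
      (use assms in \<open>auto simp: length_prog T_arc_def loop_def\<close>)
qed

lemma calls_boundary:
  assumes X: "length X \<le> n" "set X \<subseteq> {..<n}"
  shows "calls boundary_f [verts, Cell (eseq X) egraph] (eseq (boundary X)) (T_boundary n)"
proof -
  have R: "runs [enc_nat u, l, Cell (eseq X) egraph]
     (And_e (Not_e (Call mem_f [Left x2, x0])) (Call arc_f [Left x2, Mk_Cell x0 (Right x2)]))
     (enc_bool (u \<notin> set X \<and> (\<exists>x \<in> set X. (u, x) \<in> E))) (T_mem n + T_arc n + 50)"
    if "u \<in> set [0..<n]" for u l
  proof -
    have u: "u < n" using that by simp
    show ?thesis
      by (rule runs_le, (rule runs_rules calls_mem[OF X(1) u] calls_arc[OF X u])+) auto
  qed
  show ?thesis unfolding boundary_def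
    by (rule calls_le[OF calls_Filter[OF _ prog_nth(6)[unfolded boundary_b_def] R, where N = n]])
      (use assms in \<open>auto simp: length_prog T_boundary_def loop_def\<close>)
qed

lemma boundary_le: "length (boundary X) \<le> n"
  unfolding boundary_def using length_filter_le[of _ "[0..<n]"] by simp

lemma calls_le_nat:
  "calls le_f [eseq (boundary X), enc_nat k] (enc_bool (card (inb (set X)) \<le> k)) (lin n)"
  by (rule calls_le[OF calls_le_f]) (use boundary_le[of X] in \<open>auto simp: length_boundary lin_def\<close>)

lemma calls_le_boundary:
  "calls le_f [eseq (boundary X), eseq (boundary Y)]
     (enc_bool (card (inb (set X)) \<le> card (inb (set Y)))) (lin n)"
  by (rule calls_le[OF calls_le_f]) (use boundary_le[of X] in \<open>auto simp: length_boundary lin_def\<close>)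

lemma calls_cands:
  assumes X: "distinct X" "vseq X"
  shows "calls cands_f [verts, Cell (eseq X) ctx] (eseq (cands X)) (T_cands n)"
proof -
  have l: "length X \<le> n" "set X \<subseteq> {..<n}" using X by (auto simp: vseq_def)
  have R: "runs [enc_nat u, l, Cell (eseq X) ctx]
     (And_e (Not_e (Call mem_f [Left x2, x0]))
     (Call le_f [Boundary_e (Mk_Cell x0 (Left x2)) (Right x2), Width_e (Right x2)]))
     (enc_bool (u \<notin> set X \<and> card (inb (set (u # X))) \<le> k)) (T_mem n + T_boundary n + lin n + 100)"
    if "u \<in> set [0..<n]" for u l
  proof -
    have u: "u < n" using that by simp
    have b: "calls boundary_f [verts, Cell (Cell (enc_nat u) (eseq X)) egraph] (eseq (boundary (u # X))) (T_boundary n)"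
      if "u \<notin> set X"
      using calls_boundary[of "u # X"] vseq_Cons[OF X(2) u that X(1)] by (simp add: vseq_def)
    show ?thesis
      by (rule runs_le, (rule runs_rules calls_mem[OF l(1) u] b calls_le_nat | assumption)+) auto
  qed
  show ?thesis unfolding cands_def
    by (rule calls_le[OF calls_Filter[OF _ prog_nth(7)[unfolded cands_b_def] R, where N = n]])
      (use assms in \<open>auto simp: length_prog T_cands_def loop_def\<close>)
qed

lemma calls_improve:
  assumes X: "distinct X" "vseq X"
  shows "calls improve_f [eseq (cands X), Cell (eseq X) ctx]
     (eseq (filter (\<lambda>u. card (inb (set (u # X))) \<le> card (inb (set X))) (cands X))) (T_improve n)"
proof -
  have l: "length X \<le> n" "set X \<subseteq> {..<n}" using X by (auto simp: vseq_def)
  have R: "runs [enc_nat u, l, Cell (eseq X) ctx]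
     (Call le_f [Boundary_e (Mk_Cell x0 (Left x2)) (Right x2), Boundary_e (Left x2) (Right x2)])
     (enc_bool (card (inb (set (u # X))) \<le> card (inb (set X)))) (2 * T_boundary n + lin n + 100)"
    if "u \<in> set (cands X)" for u l
  proof -
    have u: "u < n" "u \<notin> set X" using that by (auto simp: set_cands)
    have b: "calls boundary_f [verts, Cell (Cell (enc_nat u) (eseq X)) egraph] (eseq (boundary (u # X))) (T_boundary n)"
      using calls_boundary[of "u # X"] vseq_Cons[OF X(2) u X(1)] by (simp add: vseq_def)
    show ?thesis
      by (rule runs_le, (rule runs_rules b calls_boundary[OF \<open>length X \<le> n\<close> \<open>set X \<subseteq> {..<n}\<close>] calls_le_boundary)+) auto
  qed
  have "length (cands X) \<le> n"
    unfolding cands_def using length_filter_le[of _ "[0..<n]"] by simp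
  then show ?thesis
    by (intro calls_le[OF calls_Filter[OF _ prog_nth(8)[unfolded improve_b_def] R, where N = n]])
      (auto simp: length_prog T_improve_def loop_def)
qed

lemma calls_diff:
  assumes X: "length X \<le> n" "length ws \<le> n" "set ws \<subseteq> {..<n}"
  shows "calls diff_f [eseq ws, eseq X] (eseq (filter (\<lambda>x. x \<notin> set X) ws)) (T_diff n)"
proof -
  have R: "runs [enc_nat u, l, eseq X] (Not_e (Call mem_f [x2, x0])) (enc_bool (u \<notin> set X)) (T_mem n + 50)"
    if "u \<in> set ws" for u l
  proof -
    have u: "u < n" using that X by auto
    show ?thesis
      by (rule runs_le, (rule runs_rules calls_mem[OF X(1) u])+) auto
  qed
  show ?thesis
    by (rule calls_le[OF calls_Filter[OF _ prog_nth(11)[unfolded diff_b_def] R, where N = n]])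
      (use assms in \<open>auto simp: length_prog T_diff_def loop_def\<close>)
qed

lemma calls_demand:
  assumes X: "vseq X" and L: "vseq L"
  shows "calls demand_f [verts, Cell (Cell (eseq X) (eseq L)) egraph]
     (eseq (filter (\<lambda>q. hits q L \<and> \<not> hits q X) [0..<n])) (T_demand n)"
proof -
  have l: "length X \<le> n" "set X \<subseteq> {..<n}" "length L \<le> n" "set L \<subseteq> {..<n}"
    using X L by (auto simp: vseq_def)
  have R: "runs [enc_nat u, l, Cell (Cell (eseq X) (eseq L)) egraph]
     (And_e (Hits_e (Right (Left x2)) x0 (Right x2)) (Not_e (Hits_e (Left (Left x2)) x0 (Right x2))))
     (enc_bool (hits u L \<and> \<not> hits u X)) (2 * T_mem n + 2 * T_arc n + 100)"
    if "u \<in> set [0..<n]" for u l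
  proof -
    have u: "u < n" using that by simp
    show ?thesis unfolding hits_def
      by (rule runs_le, (rule runs_rules calls_mem[OF l(1) u] calls_mem[OF l(3) u]
        calls_arc[OF l(1,2) u] calls_arc[OF l(3,4) u])+) auto
  qed
  show ?thesis
    by (rule calls_le[OF calls_Filter[OF _ prog_nth(12)[unfolded demand_b_def] R, where N = n]])
      (use assms in \<open>auto simp: length_prog T_demand_def loop_def\<close>)
qed

lemma calls_nbrs:
  assumes A: "vseq A" and vis: "length vis \<le> n" and q: "q < n"
  shows "calls nbrs_f [eseq A, Cell (Cell (eseq vis) (enc_nat q)) egraph]
     (eseq (filter (\<lambda>l. l \<notin> set vis \<and> adj q l) A)) (T_nbrs n)"
proof -
  have R: "runs [enc_nat u, l, Cell (Cell (eseq vis) (enc_nat q)) egraph]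
     (And_e (Not_e (Call mem_f [Left (Left x2), x0]))
     (Or_e (Call eq_f [Right (Left x2), x0])
       (Call nth_f [Call nth_f [Right x2, Right (Left x2)], x0])))
     (enc_bool (u \<notin> set vis \<and> adj q u)) (T_mem n + 3 * lin n + 100)"
    if "u \<in> set A" for u l
  proof -
    have u: "u < n" using that A by (auto simp: vseq_def)
    show ?thesis unfolding adj_def
      by (rule runs_le, (rule runs_rules calls_mem[OF vis u] calls_eq'[OF q] calls_row[OF q] calls_col[OF u])+) auto
  qed
  show ?thesis
    by (rule calls_le[OF calls_Filter[OF _ prog_nth(14)[unfolded nbrs_b_def] R, where N = n]])
      (use assms in \<open>auto simp: length_prog T_nbrs_def vseq_def loop_def\<close>)
qed

end

section \<open>Cost of the matching\<close>

definition T_lookup :: "nat \<Rightarrow> nat" where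
  "T_lookup n = (n + 1) * (n + 1) * (10 * n + 50) + 10"
definition T_free :: "nat \<Rightarrow> nat" where "T_free = loop (\<lambda>n. T_lookup n + 50)"
definition T_push :: "nat \<Rightarrow> nat" where "T_push n = n * (T_lookup n + 50) + 10"
definition T_step :: "nat \<Rightarrow> nat" where
  "T_step n = T_nbrs n + T_free n + T_push n + 20 * n + 200"
definition T_search :: "nat \<Rightarrow> nat" where "T_search n = (n + 1) * T_step n + 50"
definition T_matching :: "nat \<Rightarrow> nat" where "T_matching n = n * (T_search n + 50) + 10"
definition T_minimizer :: "nat \<Rightarrow> nat" where
  "T_minimizer n = T_demand n + 2 * T_diff n + T_matching n + 20 * n + 200"

text \<open>Overridden pairs are never deleted, so an association list can have more than
  \<open>n\<close> entries. Each of at most \<open>n\<close> searches adds at most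
  \<open>n + 1\<close> pairs, which explains the length allowed in \<open>T_lookup\<close>.\<close>

definition bounded :: "nat \<Rightarrow> nat \<Rightarrow> (nat \<times> nat) list \<Rightarrow> bool" where
  "bounded n b M \<longleftrightarrow> length M \<le> b \<and> snd ` set M \<subseteq> {..<n}"

fun entry :: "nat \<times> (nat \<times> nat) list \<Rightarrow> val" where
  "entry (q, M) = Cell (enc_nat q) (emap M)"

abbreviation stack :: "(nat \<times> (nat \<times> nat) list) list \<Rightarrow> val" where
  "stack st \<equiv> enc_list (map entry st)"

lemma runs_None: "runs env e (eopt w) b \<Longrightarrow> runs env (Not_e e) (enc_bool (w = None)) (b + 5)"
  unfolding Not_e_def
  by (rule runs_le, rule runs_If, assumption, (rule runs_Cell runs_Atom)+)
    (cases w; simp add: enc_bool_def)+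

context ordering
begin

lemma calls_lookup':
  assumes "length M \<le> (n + 1) * (n + 1)" "l < n"
  shows "calls lookup_f [emap M, enc_nat l] (eopt (map_of M l)) (T_lookup n)"
proof -
  have "length M * (10 * l + 50) \<le> (n + 1) * (n + 1) * (10 * n + 50)"
    using assms by (intro mult_le_mono) auto
  then show ?thesis by (intro calls_le[OF calls_lookup]) (auto simp: T_lookup_def)
qed

lemma calls_free:
  assumes N: "vseq N" and M: "length M \<le> (n + 1) * (n + 1)"
  shows "calls free_f [eseq N, emap M] (eseq (filter (\<lambda>l. map_of M l = None) N)) (T_free n)"
proof -
  have R: "runs [enc_nat l, c, emap M] (Not_e (Call lookup_f [x2, x0])) (enc_bool (map_of M l = None))
     (T_lookup n + 50)" if "l \<in> set N" for l c
  proof -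
    have l: "l < n" using that N by (auto simp: vseq_def)
    show ?thesis
      by (rule runs_le, rule runs_None, (rule runs_rules calls_lookup'[OF M l])+) auto
  qed
  show ?thesis
    by (rule calls_le[OF calls_Filter[OF _ prog_nth(15)[unfolded free_b_def] R, where N = n]])
      (use assms in \<open>auto simp: length_prog T_free_def vseq_def loop_def\<close>)
qed

lemma calls_push:
  assumes M: "length M \<le> (n + 1) * (n + 1)"
  shows "(\<And>l. l \<in> set N \<Longrightarrow> l < n \<and> map_of M l \<noteq> None) \<Longrightarrow>
    calls push_f [eseq N, Cell (enc_nat q) (Cell (emap M) (stack st))]
      (stack (map (\<lambda>l. (the (map_of M l), (l, q) # M)) N @ st)) (length N * (T_lookup n + 50) + 10)"
proof (induction N)
  case Nil
  show ?case
    by (simp only: list.map enc_list.simps; rule callsI[OF prog_nth(16), unfolded push_b_def];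
        ((erule runs_absurd | rule runs_rules)+)?; simp add: length_prog)
next
  case (Cons l N)
  obtain r where r: "map_of M l = Some r" "l < n" using Cons.prems[of l] by auto
  have look: "calls lookup_f [emap M, enc_nat l] (Cell (enc_nat r) Atom) (T_lookup n)"
    using calls_lookup'[OF M r(2)] r(1) by simp
  have IH: "calls push_f [eseq N, Cell (enc_nat q) (Cell (emap M) (stack st))]
      (stack (map (\<lambda>l. (the (map_of M l), (l, q) # M)) N @ st)) (length N * (T_lookup n + 50) + 10)"
    using Cons by simp
  show ?case
    by (simp only: list.map enc_list.simps; rule callsI[OF prog_nth(16), unfolded push_b_def];
        ((erule runs_absurd | rule runs_rules look IH)+)?; simp add: length_prog r(1))
qed

lemma distinct_vseq: "distinct X \<Longrightarrow> set X \<subseteq> {..<n} \<Longrightarrow> vseq X"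
  using card_mono[of "{..<n}" "set X"] distinct_card[of X] by (simp add: vseq_def)

text \<open>A step uses one unit of fuel and adds at most one pair to a list, so the lists on the
  stack are bounded by \<open>b\<close> minus the remaining fuel. The condition
  \<open>length fs \<le> b\<close> guards the truncated subtraction.\<close>

lemma calls_search:
  assumes A: "distinct A" "vseq A" and b: "b \<le> (n + 1) * (n + 1)"
    and M0: "bounded n b M0" and D0: "distinct D0" "set D0 \<subseteq> {..<n}"
  shows "(\<And>q M. (q, M) \<in> set st \<Longrightarrow> q < n \<and> bounded n (b - length fs) M \<and> length fs \<le> b) \<Longrightarrow>
    distinct vis \<Longrightarrow> set vis \<subseteq> {..<n} \<Longrightarrow>
    search adj A M0 D0 (length fs) st vis = (M', D') \<Longrightarrow>
    calls search_f [enc_list fs, stack st, eseq vis, eseq A, Cell (emap M0) (eseq D0), egraph]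
      (Cell (emap M') (eseq D')) (length fs * T_step n + 50) \<and>
    bounded n b M' \<and> distinct D' \<and> set D' \<subseteq> {..<n}"
proof (induction fs arbitrary: st vis)
  case Nil
  have "calls search_f [Atom, stack st, eseq vis, eseq A, Cell (emap M0) (eseq D0), egraph]
      (Cell (emap M0) (eseq vis)) 50"
    by (rule callsI[OF prog_nth(18), unfolded search_b_def];
        ((erule runs_absurd | rule runs_rules)+)?; simp add: length_prog)
  with Nil M0 show ?case by simp
next
  case (Cons w fs)
  show ?case
  proof (cases st)
    case Nil
    have "calls search_f [Cell w (enc_list fs), Atom, eseq vis, eseq A, Cell (emap M0) (eseq D0), egraph]
        (Cell (emap M0) (eseq vis)) 50"
      by (rule callsI[OF prog_nth(18), unfolded search_b_def];
          ((erule runs_absurd | rule runs_rules)+)?; simp add: length_prog)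
    with Nil Cons.prems M0 show ?thesis by (auto elim: calls_le)
  next
    case (Cons e st')
    obtain q M where e: "e = (q, M)" by fastforce
    then have q: "q < n" "bounded n (b - Suc (length fs)) M" "Suc (length fs) \<le> b"
      using Cons.prems(1)[of q M] Cons by auto
    let ?N = "filter (\<lambda>l. l \<notin> set vis \<and> adj q l) A"
    let ?F = "filter (\<lambda>l. map_of M l = None) ?N"
    have vis: "length vis \<le> n" using distinct_vseq[OF Cons.prems(2,3)] by (simp add: vseq_def)
    have M: "length M \<le> (n + 1) * (n + 1)" using q b by (auto simp: bounded_def)
    have N: "vseq ?N" using A(2) by (rule vseq_filter)
    note nbrs = calls_nbrs[OF A(2) vis q(1)]
    note free = calls_free[OF N M]
    have small: "Suc (length fs) * T_step n = length fs * T_step n + T_step n" by simp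
    show ?thesis
    proof (cases ?F)
      case (Cons l rest)
      have free': "calls free_f [eseq ?N, emap M] (Cell (enc_nat l) (eseq rest)) (T_free n)"
        using free unfolding Cons by simp
      have res: "M' = (l, q) # M" "D' = D0"
        using Cons.prems(4) \<open>st = e # st'\<close> e Cons by (auto simp: Let_def)
      have "calls search_f [enc_list (w # fs), stack st, eseq vis, eseq A, Cell (emap M0) (eseq D0), egraph]
        (Cell (emap M') (eseq D')) (T_step n + 50)"
        unfolding \<open>st = e # st'\<close> e res
        by (simp only: list.map enc_list.simps entry.simps epair.simps;
            rule callsI[OF prog_nth(18), unfolded search_b_def];
            ((erule runs_absurd | rule runs_rules nbrs free')+)?; simp add: length_prog T_step_def)
      then have "calls search_f [enc_list (w # fs), stack st, eseq vis, eseq A, Cell (emap M0) (eseq D0), egraph]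
        (Cell (emap M') (eseq D')) (length (w # fs) * T_step n + 50)"
        by (rule calls_le) simp_all
      moreover have "bounded n b M'" using q by (auto simp: bounded_def res)
      ultimately show ?thesis using D0 res by simp
    next
      case Nil
      let ?new = "map (\<lambda>l. (the (map_of M l), (l, q) # M)) ?N"
      have free': "calls free_f [eseq ?N, emap M] Atom (T_free n)" using free unfolding Nil by simp
      have ne: "l < n \<and> map_of M l \<noteq> None" if "l \<in> set ?N" for l
        using that Nil N unfolding filter_empty_conv by (auto simp: vseq_def)
      have "length ?N \<le> n" using N by (simp add: vseq_def)
      then have "length ?N * (T_lookup n + 50) + 10 \<le> T_push n" by (simp add: T_push_def)
      then have push: "calls push_f [eseq ?N, Cell (enc_nat q) (Cell (emap M) (stack st'))]
          (stack (?new @ st')) (T_push n)"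
        using calls_push[OF M, of ?N q st'] ne calls_le by blast
      have app: "calls append_f [eseq ?N, eseq vis] (eseq (?N @ vis)) (20 * n + 10)"
        using calls_append[of "map enc_nat ?N" "map enc_nat vis"] \<open>length ?N \<le> n\<close>
        by (auto elim: calls_le)
      have S: "search adj A M0 D0 (length fs) (?new @ st') (?N @ vis) = (M', D')"
        using Cons.prems(4) \<open>st = e # st'\<close> e Nil by (simp add: Let_def)
      have B: "r < n \<and> bounded n (b - length fs) R \<and> length fs \<le> b" if "(r, R) \<in> set (?new @ st')" for r R
      proof (cases "(r, R) \<in> set ?new")
        case True
        then obtain l where l: "l \<in> set ?N" "r = the (map_of M l)" "R = (l, q) # M" by auto
        with ne have "(l, r) \<in> set M" by (auto intro: map_of_SomeD)
        with q l(3) show ?thesis by (force simp: bounded_def)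
      next
        case False
        with that have "(r, R) \<in> set st" using \<open>st = e # st'\<close> by auto
        from Cons.prems(1)[OF this] show ?thesis by (auto simp: bounded_def)
      qed
      have D: "distinct (?N @ vis)" "set (?N @ vis) \<subseteq> {..<n}"
        using Cons.prems(2,3) A by (auto simp: vseq_def)
      have IH: "calls search_f [enc_list fs, stack (?new @ st'), eseq (?N @ vis), eseq A,
          Cell (emap M0) (eseq D0), egraph] (Cell (emap M') (eseq D')) (length fs * T_step n + 50)"
        and post: "bounded n b M' \<and> distinct D' \<and> set D' \<subseteq> {..<n}"
        using Cons.IH[OF B D S] by blast+
      have "calls search_f [enc_list (w # fs), stack st, eseq vis, eseq A, Cell (emap M0) (eseq D0), egraph]
        (Cell (emap M') (eseq D')) (length (w # fs) * T_step n + 50)"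
        unfolding \<open>st = e # st'\<close> e
        by (simp only: list.map(2) enc_list.simps entry.simps;
            rule callsI[OF prog_nth(18), unfolded search_b_def];
            ((erule runs_absurd | rule runs_rules nbrs free' push app IH)+)?;
            simp add: length_prog T_step_def)
      with post show ?thesis by blast
    qed
  qed
qed

lemma calls_matching:
  assumes A: "distinct A" "vseq A"
  shows "set Q \<subseteq> {..<n} \<Longrightarrow> bounded n b (fst s) \<Longrightarrow> b + length Q * (n + 1) \<le> (n + 1) * (n + 1) \<Longrightarrow>
    distinct (snd s) \<Longrightarrow> set (snd s) \<subseteq> {..<n} \<Longrightarrow> matching adj A (Suc n) Q s = (M', D') \<Longrightarrow>
    calls matching_f [eseq Q, Cell (emap (fst s)) (eseq (snd s)), eseq A, Cell Atom verts, egraph]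
      (Cell (emap M') (eseq D')) (length Q * (T_search n + 50) + 10) \<and>
    distinct D' \<and> set D' \<subseteq> {..<n}"
proof (induction Q arbitrary: s b)
  case Nil
  have "calls matching_f [Atom, Cell (emap (fst s)) (eseq (snd s)), eseq A, Cell Atom verts, egraph]
      (Cell (emap (fst s)) (eseq (snd s))) 10"
    by (rule callsI[OF prog_nth(19), unfolded matching_b_def];
        ((erule runs_absurd | rule runs_rules)+)?; simp add: length_prog)
  with Nil show ?case by simp
next
  case (Cons q Q)
  obtain M D where s: "s = (M, D)" by fastforce
  obtain M1 D1 where S: "search adj A M D (Suc n) [(q, M)] D = (M1, D1)" by fastforce
  \<comment> \<open>\<open>?fs\<close> is the fuel \<open>Suc n\<close> written as a list, and
    \<open>?b\<close> grants this one search as many new pairs.\<close>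
  let ?fs = "Atom # map enc_nat [0..<n]" and ?b = "b + (n + 1)"
  have b: "?b \<le> (n + 1) * (n + 1)" "?b + length Q * (n + 1) \<le> (n + 1) * (n + 1)"
    using Cons.prems(3) by auto
  have "bounded n ?b M" using Cons.prems(2) s by (auto simp: bounded_def)
  moreover have "r < n \<and> bounded n (?b - length ?fs) R \<and> length ?fs \<le> ?b"
    if "(r, R) \<in> set [(q, M)]" for r R
    using that Cons.prems(1,2) s by (auto simp: bounded_def)
  moreover have "search adj A M D (length ?fs) [(q, M)] D = (M1, D1)" using S by simp
  ultimately have "calls search_f [enc_list ?fs, stack [(q, M)], eseq D, eseq A,
      Cell (emap M) (eseq D), egraph] (Cell (emap M1) (eseq D1)) (length ?fs * T_step n + 50) \<and>
    bounded n ?b M1 \<and> distinct D1 \<and> set D1 \<subseteq> {..<n}"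
    using Cons.prems(4,5) s by (intro calls_search[OF A b(1)]) auto
  then have search: "calls search_f [Cell Atom verts, Cell (Cell (enc_nat q) (emap M)) Atom, eseq D, eseq A,
      Cell (emap M) (eseq D), egraph] (Cell (emap M1) (eseq D1)) (T_search n)"
    and post: "bounded n ?b M1" "distinct D1" "set D1 \<subseteq> {..<n}"
    by (auto simp: T_search_def)
  have "matching adj A (Suc n) Q (M1, D1) = (M', D')" using Cons.prems(6) S s by simp
  then have IH: "calls matching_f [eseq Q, Cell (emap M1) (eseq D1), eseq A, Cell Atom verts, egraph]
      (Cell (emap M') (eseq D')) (length Q * (T_search n + 50) + 10)" "distinct D'" "set D' \<subseteq> {..<n}"
    using Cons.IH[of ?b "(M1, D1)"] Cons.prems(1) b(2) post by auto
  have "calls matching_f [eseq (q # Q), Cell (emap M) (eseq D), eseq A, Cell Atom verts, egraph]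
      (Cell (emap M') (eseq D')) (length (q # Q) * (T_search n + 50) + 10)"
    by (simp only: list.map(2) enc_list.simps;
        rule callsI[OF prog_nth(19), unfolded matching_b_def];
        ((erule runs_absurd | rule runs_rules search IH(1))+)?; simp add: length_prog)
  with IH s show ?case by simp
qed

lemma calls_minimizer:
  assumes X: "vseq X" and L: "distinct L" "vseq L"
  shows "calls minimizer_f [eseq X, eseq L, ctx] (eseq (rev (minimizer X L))) (T_minimizer n)"
proof -
  let ?Q = "filter (\<lambda>q. hits q L \<and> \<not> hits q X) [0..<n]" and ?A = "filter (\<lambda>l. l \<notin> set X) L"
  obtain M D where MD: "matching adj ?A (Suc n) ?Q ([], []) = (M, D)" by fastforce
  have l: "length X \<le> n" "length L \<le> n" "set L \<subseteq> {..<n}" using X L by (auto simp: vseq_def)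
  have lQ: "length ?Q \<le> n" using length_filter_le[of _ "[0..<n]"] by simp
  then have "0 + length ?Q * (n + 1) \<le> (n + 1) * (n + 1)"
    unfolding add_0 by (intro mult_le_mono1) simp
  moreover have "distinct ?A" "vseq ?A" using L vseq_filter by auto
  ultimately have m: "calls matching_f [eseq ?Q, Cell Atom Atom, eseq ?A, Cell Atom verts, egraph]
      (Cell (emap M) (eseq D)) (length ?Q * (T_search n + 50) + 10)" and D: "distinct D" "set D \<subseteq> {..<n}"
    using calls_matching[of ?A ?Q 0 "([], [])" M D] MD by (auto simp: bounded_def)
  have "length ?Q * (T_search n + 50) + 10 \<le> T_matching n" using lQ by (simp add: T_matching_def)
  with m have m': "calls matching_f [eseq ?Q, Cell Atom Atom, eseq ?A, Cell Atom verts, egraph]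
      (Cell (emap M) (eseq D)) (T_matching n)"
    by (rule calls_le[OF _ refl])
  have "length D \<le> n" using distinct_vseq[OF D] by (simp add: vseq_def)
  note d = calls_diff[OF this l(2,3)]
  let ?W = "filter (\<lambda>l. l \<notin> set D) L"
  have W: "minimizer X L = ?W" by (simp add: minimizer_def MD)
  have "length ?W \<le> n" using l(2) length_filter_le le_trans by blast
  then have r: "calls revapp_f [eseq ?W, Atom] (eseq (rev ?W)) (20 * n + 10)"
    using calls_revapp[of ?W "[]"] by (auto elim: calls_le)
  show ?thesis unfolding W
    by (rule callsI[OF prog_nth(20), unfolded minimizer_b_def];
        ((erule runs_absurd | rule runs_rules calls_demand[OF X L(2)] calls_diff[OF l] m' d r)+)?;
        simp add: length_prog T_minimizer_def)
qed

end

section \<open>Cost of the operations on trees\<close>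

primrec etree :: "tree \<Rightarrow> val" where
  "etree (Node v X ts) = Cell (enc_nat v) (Cell (eseq X) (enc_list (map etree ts)))"

abbreviation etrees :: "tree list \<Rightarrow> val" where "etrees ts \<equiv> enc_list (map etree ts)"

lemma etree_eq: "etree t = Cell (enc_nat (seed t)) (Cell (eseq (taken t)) (etrees (kids t)))"
  by (cases t) simp

definition T_child :: "nat \<Rightarrow> nat" where "T_child = loop (\<lambda>n. lin n + 50)"
definition T_follow1 :: "nat \<Rightarrow> nat" where "T_follow1 n = T_diff n + T_child n + 20 * n + 200"
definition T_follow :: "nat \<Rightarrow> nat" where "T_follow n = (n + 1) * T_follow1 n"
definition T_leaves :: "nat \<Rightarrow> nat" where "T_leaves = loop (\<lambda>n. 50)"
definition T_grow :: "nat \<Rightarrow> nat" where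
  "T_grow n = T_diff n + T_cands n + T_improve n + T_leaves n + 200"
definition T_settle :: "nat \<Rightarrow> nat" where
  "T_settle n = T_improve n + T_minimizer n + T_follow n + 200"
definition T_adv :: "nat \<Rightarrow> nat" where "T_adv n = T_grow n + T_settle n + 100 * n + 200"

context ordering
begin

text \<open>Only the size conditions that bound a walk; unlike \<open>tinv\<close> they also hold
  while the kids of the root are advanced and the root is not yet repaired.\<close>

primrec tree_ok :: "tree \<Rightarrow> bool" where
  "tree_ok (Node v X ts) \<longleftrightarrow> seq X \<and> length ts \<le> n \<and> list_all id (map tree_ok ts) \<and>
     (\<forall>t \<in> set ts. seed t < n \<and> length X < length (taken t))"

text \<open>Distinct seeds bound the number of kids, and a kid contains its seed, which the parent
  lacks, so its list is longer.\<close>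

lemma kinv_tree_ok:
  assumes "seq X" "kinv i X ts" "\<And>t. t \<in> set ts \<Longrightarrow> tree_ok t"
  shows "tree_ok (Node v X ts)"
proof -
  have "length ts = card (seed ` set ts)"
    using assms(2) distinct_card[of "map seed ts"] by (simp add: kinv_def)
  also have "\<dots> \<le> card {..<n}" using assms(2) by (intro card_mono) (auto simp: kinv_def)
  finally have l: "length ts \<le> n" by simp
  have "seed t < n \<and> length X < length (taken t)" if t: "t \<in> set ts" for t
  proof -
    from t assms(2) obtain ys where ys: "taken t = ys @ X" "seed t \<in> {..<n} - set X"
      "good (insert (seed t) (set X)) (set (taken t))"
      unfolding kinv_def by blast
    from good_subset[OF ys(3)] ys(1,2) have "ys \<noteq> []" by auto
    with ys show ?thesis by simp
  qed
  with l assms(1,3) show ?thesis by (simp add: list_all_iff)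
qed

lemma tinv_tree_ok: "tinv i t \<Longrightarrow> tree_ok t"
proof (induction t rule: tree.induct)
  case (Node v X ts)
  show ?case
  proof (cases "ts = []")
    case True with Node.prems show ?thesis by (simp add: tinv_iff)
  next
    case False
    then have K: "kinv i X ts" "seq X" using Node.prems by (auto simp: tinv_iff)
    then have "tinv i t" if "t \<in> set ts" for t using that by (auto simp: kinv_def)
    with Node.IH show ?thesis by (intro kinv_tree_ok[OF K(2,1)]) auto
  qed
qed

lemma calls_child:
  assumes u: "u < n" and ts: "length ts \<le> n"
  shows "calls child_f [etrees ts, enc_nat u] (etrees (filter (\<lambda>t. seed t = u) ts)) (T_child n)"
proof -
  have R: "runs [etree t, l, enc_nat u] (Call eq_f [x2, Seed_e x0]) (enc_bool (seed t = u)) (lin n + 50)"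
    if "t \<in> set ts" for t l
    unfolding etree_eq[of t] eq_commute[of "seed t"]
    by (rule runs_le, (rule runs_rules calls_eq'[OF u])+) auto
  show ?thesis
    by (rule calls_le[OF calls_Filter[OF _ prog_nth(21)[unfolded child_b_def] R, where N = n]])
      (use ts in \<open>auto simp: length_prog T_child_def loop_def\<close>)
qed

lemma seq_length: "seq X \<Longrightarrow> length X \<le> n"
  using seq_vseq by (simp add: vseq_def)

text \<open>Lists get strictly longer on the way down and never exceed \<open>n\<close>, so the
  difference in the bound counts the nodes that can still be visited.\<close>

lemma calls_follow:
  "tree_ok t \<Longrightarrow> vseq ws \<Longrightarrow>
    calls follow_f [etree t, eseq ws] (etrees (follow t ws)) ((Suc n - length (taken t)) * T_follow1 n)"
proof (induction t arbitrary: ws rule: tree.induct)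
  case (Node v Z ts)
  have Z: "length Z \<le> n" "length ts \<le> n" using Node.prems seq_length by auto
  have ws: "length ws \<le> n" "set ws \<subseteq> {..<n}" using Node.prems by (auto simp: vseq_def)
  let ?us = "filter (\<lambda>x. x \<notin> set Z) ws"
  note diff = calls_diff[OF Z(1) ws]
  have one: "T_follow1 n \<le> (Suc n - length Z) * T_follow1 n"
  proof -
    have "1 \<le> Suc n - length Z" using Z(1) by linarith
    from mult_le_mono1[OF this, of "T_follow1 n"] show ?thesis by simp
  qed
  show ?case
  proof (cases ?us)
    case Nil
    then have diff: "calls diff_f [eseq ws, eseq Z] Atom (T_diff n)" using diff by simp
    have res: "follow (Node v Z ts) ws = [Node v Z ts]" using Nil by (simp add: follow.simps)
    have "calls follow_f [etree (Node v Z ts), eseq ws] (etrees (follow (Node v Z ts) ws)) (T_follow1 n)"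
      unfolding res
      by (simp only: etree.simps; rule callsI[OF prog_nth(22), unfolded follow_b_def];
        ((erule runs_absurd | rule runs_rules diff)+)?; simp add: length_prog T_follow1_def)
    with one show ?thesis by (auto elim: calls_le)
  next
    case (Cons u us)
    then have "u \<in> set ?us" "set us \<subseteq> set ?us" "length us \<le> length ?us" by auto
    moreover have "vseq ?us" using Node.prems(2) by (rule vseq_filter)
    ultimately have u: "u < n" "vseq us" "length (u # us) \<le> n"
      using Cons by (auto simp: vseq_def)
    have diff: "calls diff_f [eseq ws, eseq Z] (Cell (enc_nat u) (eseq us)) (T_diff n)"
      using diff unfolding Cons by simp
    have rev: "calls revapp_f [Cell (enc_nat u) (eseq us), eseq Z] (eseq (rev (u # us) @ Z)) (20 * n + 10)"
      using calls_revapp[of "u # us" Z] u(3) by (auto elim: calls_le)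
    show ?thesis
    proof (cases ts)
      case Nil
      have res: "follow (Node v Z ts) ws = [Node v (rev (u # us) @ Z) []]"
        using Nil Cons by (simp add: follow.simps)
      have "calls follow_f [etree (Node v Z ts), eseq ws] (etrees (follow (Node v Z ts) ws)) (T_follow1 n)"
        unfolding res unfolding Nil
        by (simp only: etree.simps list.map(1) enc_list.simps;
          rule callsI[OF prog_nth(22), unfolded follow_b_def];
          ((erule runs_absurd | rule runs_rules diff rev)+)?; simp add: length_prog T_follow1_def)
      with one show ?thesis by (auto elim: calls_le)
    next
      case ts: (Cons t0 ts0)
      note child = calls_child[OF u(1) Z(2)]
      have ets: "etrees ts = Cell (etree t0) (etrees ts0)" using ts by simp
      show ?thesis
      proof (cases "filter (\<lambda>t. seed t = u) ts")
        case Nil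
        then have child: "calls child_f [Cell (etree t0) (etrees ts0), enc_nat u] Atom (T_child n)"
          using child ets by simp
        have res: "follow (Node v Z ts) ws = []"
          using Nil Cons ts by (simp add: follow.simps)
        have "calls follow_f [etree (Node v Z ts), eseq ws] (etrees (follow (Node v Z ts) ws)) (T_follow1 n)"
          unfolding res
          by (simp only: etree.simps ets; rule callsI[OF prog_nth(22), unfolded follow_b_def];
            ((erule runs_absurd | rule runs_rules diff child)+)?; simp add: length_prog T_follow1_def)
        with one show ?thesis by (auto elim: calls_le)
      next
        case F: (Cons t rest)
        then have "t \<in> set (filter (\<lambda>t. seed t = u) ts)" by simp
        then have t: "t \<in> set ts" by simp
        then have T: "tree_ok t" "length Z < length (taken t)"
          using Node.prems(1) by (auto simp: list_all_iff)
        have IH: "calls follow_f [etree t, eseq us] (etrees (follow t us))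
            ((Suc n - length (taken t)) * T_follow1 n)"
          by (rule Node.IH[OF t T(1) u(2)])
        have child: "calls child_f [Cell (etree t0) (etrees ts0), enc_nat u] (Cell (etree t) (etrees rest)) (T_child n)"
          using child ets unfolding F by simp
        have res: "follow (Node v Z ts) ws = follow t us"
          using F Cons ts by (simp add: follow.simps)
        have "length (taken t) \<le> n" using T(1) seq_length by (cases t) simp
        then have "Suc n - length Z \<ge> Suc (Suc n - length (taken t))" using T(2) by linarith
        then have le: "T_follow1 n + (Suc n - length (taken t)) * T_follow1 n
            \<le> (Suc n - length Z) * T_follow1 n"
          using mult_le_mono1[of "Suc (Suc n - length (taken t))" _ "T_follow1 n"] by simp
        have "calls follow_f [etree (Node v Z ts), eseq ws] (etrees (follow (Node v Z ts) ws))
            (T_follow1 n + (Suc n - length (taken t)) * T_follow1 n)"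
          unfolding res
          by (simp only: etree.simps ets; rule callsI[OF prog_nth(22), unfolded follow_b_def];
            ((erule runs_absurd | rule runs_rules diff child IH)+)?; simp add: length_prog T_follow1_def)
        with le show ?thesis by (auto elim: calls_le)
      qed
    qed
  qed
qed

lemma calls_follow':
  assumes "tree_ok t" "vseq ws"
  shows "calls follow_f [etree t, eseq ws] (etrees (follow t ws)) (T_follow n)"
  by (rule calls_le[OF calls_follow[OF assms] refl]) (unfold T_follow_def, intro mult_le_mono1, simp)

lemma calls_leaves:
  assumes "length C \<le> n"
  shows "calls leaves_f [eseq C, eseq X] (etrees (map (\<lambda>u. Node u (u # X) []) C)) (T_leaves n)"
proof -
  have R: "runs [enc_nat u, l, eseq X] (Node_e x0 (Mk_Cell x0 x2) Mk_Atom) (etree (Node u (u # X) [])) 50"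
    if "u \<in> set C" for u l
    by (rule runs_le, (rule runs_rules)+) auto
  have "calls leaves_f [eseq C, eseq X] (enc_list (map (\<lambda>u. etree (Node u (u # X) [])) C)) (T_leaves n)"
    by (rule calls_le[OF calls_Map[OF _ prog_nth(9)[unfolded leaves_b_def] R, where N = n]])
      (use assms in \<open>auto simp: length_prog T_leaves_def loop_def\<close>)
  then show ?thesis by (simp add: comp_def)
qed

lemma calls_grow:
  assumes X: "seq X"
  shows "calls grow_f [enc_nat v, eseq X, ctx] (etrees (grow v X)) (T_grow n)"
proof -
  have l: "length X \<le> n" "distinct X" "vseq X" using X seq_vseq by (auto simp: seq_def seq_length)
  let ?R = "filter (\<lambda>u. u \<notin> set X) [0..<n]"
  have diff: "calls diff_f [verts, eseq X] (eseq ?R) (T_diff n)"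
    by (rule calls_diff[OF l(1)]) auto
  note cands = calls_cands[OF l(2,3)]
  note improve = calls_improve[OF l(2,3)]
  have lc: "length (cands X) \<le> n" unfolding cands_def using length_filter_le[of _ "[0..<n]"] by simp
  note leaves = calls_leaves[OF lc, of X]
  show ?thesis
  proof (cases ?R)
    case Nil
    have diff: "calls diff_f [verts, eseq X] Atom (T_diff n)" using diff unfolding Nil by simp
    have res: "grow v X = [Node v X []]" unfolding grow_def Nil by simp
    show ?thesis unfolding res
      by (rule callsI[OF prog_nth(26), unfolded grow_b_def];
        ((erule runs_absurd | rule runs_rules diff)+)?; simp add: length_prog T_grow_def)
  next
    case R: (Cons r rs)
    have diff: "calls diff_f [verts, eseq X] (Cell (enc_nat r) (eseq rs)) (T_diff n)"
      using diff unfolding R by simp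
    let ?N = "filter (\<lambda>u. card (inb (set (u # X))) \<le> card (inb (set X))) (cands X)"
    show ?thesis
    proof (cases ?N)
      case N: (Cons u us)
      have improve: "calls improve_f [eseq (cands X), Cell (eseq X) ctx] (Cell (enc_nat u) (eseq us)) (T_improve n)"
        using improve unfolding N by simp
      have res: "grow v X = [Node v (u # X) []]" unfolding grow_def R N by simp
      show ?thesis unfolding res
        by (rule callsI[OF prog_nth(26), unfolded grow_b_def];
          ((erule runs_absurd | rule runs_rules diff cands improve)+)?; simp add: length_prog T_grow_def)
    next
      case Nil
      have improve: "calls improve_f [eseq (cands X), Cell (eseq X) ctx] Atom (T_improve n)"
        using improve unfolding Nil by simp
      show ?thesis
      proof (cases "cands X")
        case C: Nil
        have c: "calls cands_f [verts, Cell (eseq X) ctx] Atom (T_cands n)"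
          "calls improve_f [Atom, Cell (eseq X) ctx] Atom (T_improve n)"
          using cands improve unfolding C by simp_all
        have res: "grow v X = []" unfolding grow_def R Nil C by simp
        show ?thesis unfolding res
          by (rule callsI[OF prog_nth(26), unfolded grow_b_def];
            ((erule runs_absurd | rule runs_rules diff c)+)?; simp add: length_prog T_grow_def)
      next
        case C: (Cons a as)
        let ?L = "map (\<lambda>u. Node u (u # X) []) (cands X)"
        have c: "calls cands_f [verts, Cell (eseq X) ctx] (Cell (enc_nat a) (eseq as)) (T_cands n)"
          "calls improve_f [Cell (enc_nat a) (eseq as), Cell (eseq X) ctx] Atom (T_improve n)"
          "calls leaves_f [Cell (enc_nat a) (eseq as), eseq X] (etrees ?L) (T_leaves n)"
          using cands improve leaves unfolding C by simp_all
        have res: "grow v X = [Node v X ?L]" unfolding grow_def R Nil using C by simp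
        show ?thesis unfolding res
          by (rule callsI[OF prog_nth(26), unfolded grow_b_def];
            ((erule runs_absurd | rule runs_rules diff c)+)?; simp add: length_prog T_grow_def)
      qed
    qed
  qed
qed

lemma calls_collapse:
  assumes X: "vseq X" and ts: "length ts \<le> n" "\<And>t. t \<in> set ts \<Longrightarrow> tree_ok t"
  shows "calls collapse_f [etrees ts, Cell (eseq X) ctx]
     (etrees (filter (\<lambda>t. card (inb (set (taken t))) \<le> card (inb (set X))) ts)) (T_improve n)"
proof -
  have R: "runs [etree t, l, Cell (eseq X) ctx]
     (Call le_f [Boundary_e (Taken_e x0) (Right x2), Boundary_e (Left x2) (Right x2)])
     (enc_bool (card (inb (set (taken t))) \<le> card (inb (set X)))) (2 * T_boundary n + lin n + 100)"
    if "t \<in> set ts" for t l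
  proof -
    have "vseq (taken t)" using ts(2)[OF that] seq_vseq by (cases t) simp
    then have b: "calls boundary_f [verts, Cell (eseq (taken t)) egraph] (eseq (boundary (taken t))) (T_boundary n)"
      "calls boundary_f [verts, Cell (eseq X) egraph] (eseq (boundary X)) (T_boundary n)"
      using X by (auto simp: vseq_def intro: calls_boundary)
    show ?thesis unfolding etree_eq[of t]
      by (rule runs_le, (rule runs_rules b calls_le_boundary)+) auto
  qed
  show ?thesis
    by (rule calls_le[OF calls_Filter[OF _ prog_nth(23)[unfolded collapse_b_def] R, where N = n]])
      (use ts in \<open>auto simp: length_prog T_improve_def loop_def\<close>)
qed

lemma calls_settle:
  assumes X: "seq X" and ts: "kinv i X ts"
  shows "calls settle_f [enc_nat v, eseq X, etrees ts, ctx] (etrees (settle v X ts)) (T_settle n)"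
proof (cases ts)
  case Nil
  then have res: "settle v X ts = []" by (simp add: settle_def)
  show ?thesis unfolding res unfolding Nil
    by (simp only: list.map(1) enc_list.simps; rule callsI[OF prog_nth(27), unfolded settle_b_def];
      ((erule runs_absurd | rule runs_rules)+)?; simp add: length_prog T_settle_def)
next
  case C: (Cons t0 ts0)
  have ok: "tree_ok t" if "t \<in> set ts" for t using that ts tinv_tree_ok by (auto simp: kinv_def)
  have okX: "tree_ok (Node v X ts)" by (rule kinv_tree_ok[OF X ts ok])
  then have l: "length ts \<le> n" by simp
  note collapse = calls_collapse[OF seq_vseq[OF X] l ok]
  let ?F = "filter (\<lambda>t. card (inb (set (taken t))) \<le> card (inb (set X))) ts"
  show ?thesis
  proof (cases ?F)
    case Nil
    have c: "calls collapse_f [Cell (etree t0) (etrees ts0), Cell (eseq X) ctx] Atom (T_improve n)"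
      using collapse unfolding Nil unfolding C by simp
    have res: "settle v X ts = [Node v X ts]" unfolding settle_def Nil using C by simp
    show ?thesis unfolding res unfolding C
      by (simp only: list.map(2) enc_list.simps; rule callsI[OF prog_nth(27), unfolded settle_b_def];
        ((erule runs_absurd | rule runs_rules c)+)?; simp add: length_prog T_settle_def)
  next
    case F: (Cons t rest)
    then have "t \<in> set ?F" by simp
    then have "t \<in> set ts" by simp
    from ok[OF this] have "seq (taken t)" by (cases t) simp
    then have L: "distinct (taken t)" "vseq (taken t)" using seq_vseq by (auto simp: seq_def)
    have c: "calls collapse_f [Cell (etree t0) (etrees ts0), Cell (eseq X) ctx]
        (Cell (Cell (enc_nat (seed t)) (Cell (eseq (taken t)) (etrees (kids t)))) (etrees rest)) (T_improve n)"
      using collapse unfolding F etree_eq[of t, symmetric] unfolding C by simp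
    note min = calls_minimizer[OF seq_vseq[OF X] L]
    have "vseq (rev (minimizer X (taken t)))"
      using vseq_filter[OF L(2)] by (auto simp: minimizer_def Let_def vseq_def)
    from calls_follow'[OF okX this]
    have fol: "calls follow_f [Cell (enc_nat v) (Cell (eseq X) (Cell (etree t0) (etrees ts0))),
        eseq (rev (minimizer X (taken t)))]
        (etrees (follow (Node v X ts) (rev (minimizer X (taken t))))) (T_follow n)"
      unfolding C by simp
    show ?thesis
    proof (cases "follow (Node v X ts) (rev (minimizer X (taken t)))")
      case Nil
      have res: "settle v X ts = []" unfolding settle_def F using C Nil by simp
      have fol: "calls follow_f [Cell (enc_nat v) (Cell (eseq X) (Cell (etree t0) (etrees ts0))),
        eseq (rev (minimizer X (taken t)))] Atom (T_follow n)" using fol unfolding Nil by simp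
      show ?thesis unfolding res unfolding C
        by (simp only: list.map(2) enc_list.simps; rule callsI[OF prog_nth(27), unfolded settle_b_def];
          ((erule runs_absurd | rule runs_rules c min fol)+)?; simp add: length_prog T_settle_def)
    next
      case R: (Cons r rs)
      \<comment> \<open>The program keeps only the head of the result, which is faithful because
        there is never a second tree.\<close>
      have "rs = []"
      proof -
        have "length (follow t ws) \<le> 1" for t ws
          by (induction t ws rule: follow.induct) (auto simp: follow.simps split: list.splits)
        from this[of "Node v X ts" "rev (minimizer X (taken t))"] R show ?thesis by simp
      qed
      have res: "settle v X ts = [Node v (taken r) (kids r)]"
        unfolding settle_def F using C R \<open>rs = []\<close> by simp
      have fol: "calls follow_f [Cell (enc_nat v) (Cell (eseq X) (Cell (etree t0) (etrees ts0))),
        eseq (rev (minimizer X (taken t)))]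
        (Cell (Cell (enc_nat (seed r)) (Cell (eseq (taken r)) (etrees (kids r)))) Atom) (T_follow n)"
        using fol unfolding R \<open>rs = []\<close> etree_eq[of r, symmetric] by simp
      show ?thesis unfolding res unfolding C
        by (simp only: list.map(2) enc_list.simps; rule callsI[OF prog_nth(27), unfolded settle_b_def];
          ((erule runs_absurd | rule runs_rules c min fol)+)?; simp add: length_prog T_settle_def)
    qed
  qed
qed

lemma adv_single:
  assumes "tinv i t" "i < n"
  shows "length (adv t) \<le> 1"
  using adv_ok[OF assms] by (auto elim: result_ok_cases)

text \<open>Each node is charged \<open>T_adv n\<close> once. The summand \<open>100 * n\<close> in
  it pays for collecting the results of the at most \<open>n\<close> kids, each of which returns at
  most one tree.\<close>

lemma calls_adv:
  assumes "i < n"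
  shows "tinv i t \<Longrightarrow> calls adv_f [etree t, ctx] (etrees (adv t)) (tsize t * T_adv n)"
proof (induction t rule: tree.induct)
  case (Node v X ts)
  show ?case
  proof (cases ts)
    case Nil
    have X: "seq X" using Node.prems by (simp add: tinv_iff)
    have res: "adv (Node v X ts) = grow v X" using Nil by simp
    show ?thesis unfolding res unfolding Nil
      by (simp only: etree.simps list.map(1) enc_list.simps; rule callsI[OF prog_nth(25), unfolded adv_b_def];
        ((erule runs_absurd | rule runs_rules calls_grow[OF X])+)?; simp add: length_prog T_adv_def)
  next
    case (Cons t0 ts0)
    then have K: "seq X" "kinv i X ts" using Node.prems by (auto simp: tinv_iff)
    have kids: "tinv i t" if "t \<in> set ts" for t using that K by (simp add: kinv_def)
    have K': "kinv (Suc i) X (concat (map adv ts))"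
      using kinv_adv[OF K(2)] adv_ok[OF kids assms] by blast
    have "length ts \<le> n" using tinv_tree_ok[OF Node.prems] by simp
    have "calls advs_f [etrees us, ctx] (etrees (concat (map adv us)))
        (sum_list (map tsize us) * T_adv n + length us * 100 + 10)" if "set us \<subseteq> set ts" for us
      using that
    proof (induction us)
      case Nil
      show ?case
        by (simp only: list.map(1) enc_list.simps concat.simps; rule callsI[OF prog_nth(24), unfolded advs_b_def];
          ((erule runs_absurd | rule runs_rules)+)?; simp add: length_prog)
    next
      case (Cons u us)
      then have u: "u \<in> set ts" by simp
      have IHu: "calls adv_f [etree u, ctx] (etrees (adv u)) (tsize u * T_adv n)"
        using Node.IH[OF u kids[OF u]] .
      have IHus: "calls advs_f [etrees us, ctx] (etrees (concat (map adv us)))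
        (sum_list (map tsize us) * T_adv n + length us * 100 + 10)" using Cons by simp
      have app: "calls append_f [etrees (adv u), etrees (concat (map adv us))]
          (etrees (concat (map adv (u # us)))) 30"
        using calls_append[of "map etree (adv u)" "map etree (concat (map adv us))"]
          adv_single[OF kids[OF u] assms] by (auto elim!: calls_le)
      show ?case
        by (simp only: list.map(2) enc_list.simps; rule callsI[OF prog_nth(24), unfolded advs_b_def];
          ((erule runs_absurd | rule runs_rules IHu IHus app)+)?; simp add: length_prog algebra_simps)
    qed
    from this[of ts]
    have advs: "calls advs_f [Cell (etree t0) (etrees ts0), ctx] (etrees (concat (map adv ts)))
        (sum_list (map tsize ts) * T_adv n + 100 * n + 10)"
      using Cons \<open>length ts \<le> n\<close> by (auto elim!: calls_le)
    have res: "adv (Node v X ts) = settle v X (concat (map adv ts))" using Cons by simp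
    have size: "tsize (Node v X ts) * T_adv n = sum_list (map tsize ts) * T_adv n + T_adv n" by simp
    have et: "etree (Node v X ts) = Cell (enc_nat v) (Cell (eseq X) (Cell (etree t0) (etrees ts0)))"
      unfolding Cons by simp
    show ?thesis unfolding res size et
      by (rule callsI[OF prog_nth(25), unfolded adv_b_def];
        ((erule runs_absurd | rule runs_rules advs calls_settle[OF K(1) K'])+)?; simp add: length_prog T_adv_def)
  qed
qed

text \<open>The invariant holds before every round, so each tree that is advanced has at most
  \<open>2 * B ^ k\<close> nodes and all rounds have the same price.\<close>

lemma calls_rounds:
  assumes B: "2 \<le> B" "\<And>X. card {v \<in> {..<n} - X. card (inb (insert v X)) \<le> k} \<le> B"
  shows "result_ok i [] {} r \<Longrightarrow> i + length ws \<le> n \<Longrightarrow>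
    calls rounds_f [enc_list ws, etrees r, ctx] (etrees (rounds (length ws) r))
      (length ws * (2 * B ^ k * T_adv n + 50) + 10)"
proof (induction ws arbitrary: i r)
  case Nil
  show ?case
    by (simp only: enc_list.simps; rule callsI[OF prog_nth(28), unfolded rounds_b_def];
      ((erule runs_absurd | rule runs_rules)+)?; simp add: length_prog)
next
  case (Cons w ws)
  from Cons.prems(1) show ?case
  proof (cases rule: result_ok_cases)
    case 1
    have "rounds m [] = []" for m by (induction m) auto
    with 1 have res: "rounds (length (w # ws)) r = []" by simp
    show ?thesis unfolding res unfolding 1
      by (simp only: list.map(1) enc_list.simps; rule callsI[OF prog_nth(28), unfolded rounds_b_def];
        ((erule runs_absurd | rule runs_rules)+)?; simp add: length_prog)
  next
    case (2 t)
    have i: "i < n" using Cons.prems(2) by simp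
    have "tsize t \<le> 2 * B ^ (k - card (inb (set (taken t))))" using tsize_bound[OF B 2(2)] by simp
    also have "\<dots> \<le> 2 * B ^ k" using B(1) by (simp add: power_increasing)
    finally have "tsize t * T_adv n \<le> 2 * B ^ k * T_adv n" by (rule mult_le_mono1)
    then have adv: "calls adv_f [etree t, ctx] (etrees (adv t)) (2 * B ^ k * T_adv n)"
      using calls_adv[OF i 2(2)] calls_le by blast
    have "result_ok (Suc i) [] {} (adv t)"
      using result_ok_round[OF Cons.prems(1) i] 2(1) by simp
    then have IH: "calls rounds_f [enc_list ws, etrees (adv t), ctx] (etrees (rounds (length ws) (adv t)))
        (length ws * (2 * B ^ k * T_adv n + 50) + 10)"
      using Cons.prems(2) by (intro Cons.IH[of "Suc i"]) auto
    have res: "rounds (length (w # ws)) r = rounds (length ws) (adv t)" using 2 by simp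
    show ?thesis unfolding res unfolding 2(1)
      by (simp only: list.map enc_list.simps; rule callsI[OF prog_nth(28), unfolded rounds_b_def];
        ((erule runs_absurd | rule runs_rules adv IH)+)?; simp add: length_prog)
  qed
qed

lemma calls_bags:
  "length X \<le> n \<Longrightarrow> set X \<subseteq> {..<n} \<Longrightarrow>
    calls bags_f [eseq X, ctx] (enc_list (map eseq (bags X))) (length X * (T_boundary n + 50) + 10)"
proof (induction X)
  case Nil
  show ?case
    by (simp only: list.map enc_list.simps bags.simps; rule callsI[OF prog_nth(29), unfolded bags_b_def];
      ((erule runs_absurd | rule runs_rules)+)?; simp add: length_prog)
next
  case (Cons v X)
  have IH: "calls bags_f [eseq X, ctx] (enc_list (map eseq (bags X))) (length X * (T_boundary n + 50) + 10)"
    using Cons by simp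
  have b: "calls boundary_f [verts, Cell (Cell (enc_nat v) (eseq X)) egraph] (eseq (boundary (v # X))) (T_boundary n)"
    using calls_boundary[OF Cons.prems] by simp
  show ?case
    by (simp only: list.map enc_list.simps; rule callsI[OF prog_nth(29), unfolded bags_b_def];
      ((erule runs_absurd | rule runs_rules IH b)+)?; simp add: length_prog)
qed

end

section \<open>Polynomial bounds and the complete algorithm\<close>

definition poly_bounded :: "(nat \<Rightarrow> nat) \<Rightarrow> bool" where
  "poly_bounded T \<longleftrightarrow> (\<exists>c. \<forall>n. T n \<le> c * (n + 1) ^ c)"

text \<open>In \<open>poly_bounded\<close> one constant is factor and exponent, as in the theorem;
  two separate ones merge into their sum.\<close>

lemma poly_boundedI:
  assumes "\<And>n. T n \<le> a * (n + 1) ^ b"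
  shows "poly_bounded T"
proof -
  have "T n \<le> (a + b) * (n + 1) ^ (a + b)" for n
  proof -
    have "a * (n + 1) ^ b \<le> (a + b) * (n + 1) ^ (a + b)"
      by (intro mult_le_mono power_increasing) auto
    with assms[of n] show ?thesis by linarith
  qed
  then show ?thesis unfolding poly_bounded_def by blast
qed

lemma poly_bounded_const: "poly_bounded (\<lambda>n. c)"
  by (rule poly_boundedI[of _ c 0]) simp

lemma poly_bounded_id: "poly_bounded (\<lambda>n. n)"
  by (rule poly_boundedI[of _ 1 1]) simp

lemma poly_bounded_add:
  assumes "poly_bounded S" "poly_bounded T"
  shows "poly_bounded (\<lambda>n. S n + T n)"
proof -
  obtain c d where cd: "\<And>n. S n \<le> c * (n + 1) ^ c" "\<And>n. T n \<le> d * (n + 1) ^ d"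
    using assms unfolding poly_bounded_def by blast
  show ?thesis
  proof (rule poly_boundedI)
    fix n
    have "c * (n + 1) ^ c \<le> c * (n + 1) ^ (c + d)" "d * (n + 1) ^ d \<le> d * (n + 1) ^ (c + d)"
      by (intro mult_le_mono power_increasing; simp)+
    then show "S n + T n \<le> (c + d) * (n + 1) ^ (c + d)"
      using cd(1)[of n] cd(2)[of n] unfolding add_mult_distrib by linarith
  qed
qed

lemma poly_bounded_mult:
  assumes "poly_bounded S" "poly_bounded T"
  shows "poly_bounded (\<lambda>n. S n * T n)"
proof -
  obtain c d where cd: "\<And>n. S n \<le> c * (n + 1) ^ c" "\<And>n. T n \<le> d * (n + 1) ^ d"
    using assms unfolding poly_bounded_def by blast
  show ?thesis
  proof (rule poly_boundedI)
    fix n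
    show "S n * T n \<le> (c * d) * (n + 1) ^ (c + d)"
      using mult_le_mono[OF cd(1)[of n] cd(2)[of n]] by (simp add: power_add mult_ac)
  qed
qed

lemmas poly_bounded_intros = poly_bounded_const poly_bounded_id poly_bounded_add poly_bounded_mult

lemma poly_bounded_loop: "poly_bounded T \<Longrightarrow> poly_bounded (loop T)"
  unfolding loop_def by (intro poly_bounded_intros)

definition T_main :: "nat \<Rightarrow> nat" where
  "T_main n = n * (2 * T_adv n + 50) + n * (T_boundary n + 50) + 50 * n + 500"

lemma poly_bounded_main: "poly_bounded T_main"
proof -
  have lin: "poly_bounded lin" unfolding lin_def by (intro poly_bounded_intros)
  note intros = poly_bounded_intros poly_bounded_loop lin
  have mem: "poly_bounded T_mem" unfolding T_mem_def by (intro intros)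
  have arc: "poly_bounded T_arc" unfolding T_arc_def by (intro intros)
  have boundary: "poly_bounded T_boundary" unfolding T_boundary_def by (intro intros mem arc)
  have cands: "poly_bounded T_cands" unfolding T_cands_def by (intro intros mem boundary)
  have improve: "poly_bounded T_improve" unfolding T_improve_def by (intro intros boundary)
  have diff: "poly_bounded T_diff" unfolding T_diff_def by (intro intros mem)
  have demand: "poly_bounded T_demand" unfolding T_demand_def by (intro intros mem arc)
  have nbrs: "poly_bounded T_nbrs" unfolding T_nbrs_def by (intro intros mem)
  have lookup: "poly_bounded T_lookup" unfolding T_lookup_def by (intro intros)
  have free: "poly_bounded T_free" unfolding T_free_def by (intro intros lookup)
  have push: "poly_bounded T_push" unfolding T_push_def by (intro intros lookup)
  have step: "poly_bounded T_step" unfolding T_step_def by (intro intros nbrs free push)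
  have search: "poly_bounded T_search" unfolding T_search_def by (intro intros step)
  have matching: "poly_bounded T_matching" unfolding T_matching_def by (intro intros search)
  have minimizer: "poly_bounded T_minimizer"
    unfolding T_minimizer_def by (intro intros demand diff matching)
  have child: "poly_bounded T_child" unfolding T_child_def by (intro intros)
  have follow1: "poly_bounded T_follow1" unfolding T_follow1_def by (intro intros diff child)
  have follow: "poly_bounded T_follow" unfolding T_follow_def by (intro intros follow1)
  have leaves: "poly_bounded T_leaves" unfolding T_leaves_def by (intro intros)
  have grow: "poly_bounded T_grow" unfolding T_grow_def by (intro intros diff cands improve leaves)
  have settle: "poly_bounded T_settle"
    unfolding T_settle_def by (intro intros improve minimizer follow)
  have adv: "poly_bounded T_adv" unfolding T_adv_def by (intro intros grow settle)
  show ?thesis unfolding T_main_def by (intro intros adv boundary)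
qed

lemma trivial_decomposition:
  assumes "pair_digraph G" "pverts G = {..<n}"
  shows "path_decomposition G [{..<n}]"
  unfolding path_decomposition_def
proof (intro conjI)
  interpret pair_digraph G by fact
  show "\<forall>(u, v)\<in>parcs G. \<exists>i j. j \<le> i \<and> i < length [{..<n}] \<and> u \<in> [{..<n}] ! i \<and> v \<in> [{..<n}] ! j"
    using in_arcsD1 in_arcsD2 assms(2) by fastforce
  show "\<forall>v\<in>pverts G. \<exists>a b. {i. i < length [{..<n}] \<and> v \<in> [{..<n}] ! i} = {a..b}"
  proof
    fix v assume "v \<in> pverts G"
    then have "i < length [{..<n}] \<and> v \<in> [{..<n}] ! i \<longleftrightarrow> i = 0" for i
      using assms(2) by (cases i) simp_all
    then have "{i. i < length [{..<n}] \<and> v \<in> [{..<n}] ! i} = {0..0}" by simp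
    then show "\<exists>a b. {i. i < length [{..<n}] \<and> v \<in> [{..<n}] ! i} = {a..b}" by blast
  qed
qed (use assms(2) in auto)

context ordered_digraph
begin

lemma run_main:
  assumes G: "pair_digraph G" and B: "2 \<le> B" "\<And>X. card {v \<in> {..<n} - X. card (inb (insert v X)) \<le> k} \<le> B"
  shows "\<exists>answer. runs [enc_nat h, egraph, enc_nat k] main_e (enc_answer answer) (B ^ k * T_main n) \<and>
    correct_answer G k answer"
proof -
  have sp: "spine egraph = n" by (simp add: egraph_def)
  have upt: "calls upt_f [egraph, Atom] verts (20 * n + 10)"
    using calls_upt[of "map (\<lambda>u. enc_list (map (\<lambda>v. enc_bool ((u, v) \<in> E)) [0..<n])) [0..<n]" 0]
    by (simp add: egraph_def)
  have le: "calls le_f [egraph, enc_nat k] (enc_bool (n \<le> k)) (10 * n + 10)"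
    using calls_le_f[of egraph "enc_nat k"] sp by simp
  have P: "1 \<le> B ^ k" using B(1) by simp
  have T: "T_main n \<le> B ^ k * T_main n" using mult_le_mono1[OF P, of "T_main n"] by simp
  show ?thesis
  \<comment> \<open>If \<open>n \<le> k\<close>, a single bag with all vertices is narrow enough.
    This also settles the empty digraph, for which \<open>bags\<close> would give no bag.\<close>
  proof (cases "n \<le> k")
    case True
    then have le: "calls le_f [egraph, enc_nat k] (Cell Atom Atom) (10 * n + 10)"
      using le by (simp add: enc_bool_def)
    have "runs [enc_nat h, egraph, enc_nat k] main_e (enc_answer (Some [[0..<n]])) (T_main n)"
      unfolding main_e_def
      by (rule runs_le, (erule runs_absurd | rule runs_rules upt le)+) (auto simp: T_main_def)
    moreover have "correct_answer G k (Some [[0..<n]])"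
      using trivial_decomposition[OF G pverts] True by (simp add: width_def lessThan_atLeast0)
    ultimately show ?thesis using T runs_le by blast
  next
    case False
    then have le: "calls le_f [egraph, enc_nat k] Atom (10 * n + 10)"
      using le by (simp add: enc_bool_def)
    \<comment> \<open>The initial leaf is the empty order; its seed is arbitrary because it has no
      parent.\<close>
    let ?t = "Node 0 [] []"
    have "tinv 0 ?t" by (simp add: tinv_iff seq_def)
    then have init: "result_ok 0 [] {} [?t]" by (simp add: result_ok_def)
    have "calls rounds_f [verts, etrees [?t], ctx] (etrees (rounds n [?t]))
      (n * (2 * B ^ k * T_adv n + 50) + 10)"
      using calls_rounds[OF B init, of "map enc_nat [0..<n]"] by simp
    then have rounds: "calls rounds_f [verts, Cell (Cell Atom (Cell Atom Atom)) Atom, ctx] (etrees (rounds n [?t]))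
      (n * (2 * B ^ k * T_adv n + 50) + 10)" by simp
    have "n * (2 * B ^ k * T_adv n + 50) \<le> B ^ k * (n * (2 * T_adv n + 50))"
      using mult_le_mono1[OF P, of "n * 50"] by (simp add: algebra_simps)
    moreover have "n * (T_boundary n + 50) + 50 * n + 500 \<le> B ^ k * (n * (T_boundary n + 50) + 50 * n + 500)"
      using mult_le_mono1[OF P, of "n * (T_boundary n + 50) + 50 * n + 500"] by simp
    moreover have "B ^ k * T_main n = B ^ k * (n * (2 * T_adv n + 50))
        + B ^ k * (n * (T_boundary n + 50) + 50 * n + 500)"
      unfolding T_main_def by (simp add: algebra_simps)
    ultimately have cost: "n * (2 * B ^ k * T_adv n + 50) + (n * (T_boundary n + 50) + 50 * n + 500)
        \<le> B ^ k * T_main n" by linarith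
    have "result_ok n [] {} (rounds n [?t])" using rounds_ok[OF init, of n] by simp
    then show ?thesis
    proof (cases rule: result_ok_cases)
      case 1
      have rounds: "calls rounds_f [verts, Cell (Cell Atom (Cell Atom Atom)) Atom, ctx] Atom
        (n * (2 * B ^ k * T_adv n + 50) + 10)" using rounds 1(1) by simp
      have "runs [enc_nat h, egraph, enc_nat k] main_e (enc_answer None) (B ^ k * T_main n)"
        unfolding main_e_def
        by (rule runs_le, (erule runs_absurd | rule runs_rules upt le rounds)+) (use cost in auto)
      moreover have "correct_answer G k None"
      proof (rule ccontr)
        assume "\<not> correct_answer G k None"
        then have "pathwidth G \<le> int k" by simp
        moreover obtain Xs where "path_decomposition G Xs" "width Xs = pathwidth G"
          using pathwidth_is_minimum(1)[OF G] by blast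
        ultimately have "alive {}" using decomposition_alive[of Xs] by simp
        with 1(2) show False ..
      qed
      ultimately show ?thesis by blast
    next
      case (2 t)
      have X: "seq (taken t)" "set (taken t) = {..<n}" using tinv_seq[OF 2(2)] tinv_final[OF 2(2)] by auto
      have rounds: "calls rounds_f [verts, Cell (Cell Atom (Cell Atom Atom)) Atom, ctx]
        (Cell (Cell (enc_nat (seed t)) (Cell (eseq (taken t)) (etrees (kids t)))) Atom)
        (n * (2 * B ^ k * T_adv n + 50) + 10)" using rounds 2(1) etree_eq[of t] by simp
      have l: "length (taken t) \<le> n" using seq_length[OF X(1)] .
      have "length (taken t) * (T_boundary n + 50) \<le> n * (T_boundary n + 50)"
        using l by (rule mult_le_mono1)
      then have bags: "calls bags_f [eseq (taken t), ctx] (enc_list (map eseq (bags (taken t))))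
          (n * (T_boundary n + 50) + 10)"
        using X(2) by (intro calls_le[OF calls_bags[OF l] refl]) auto
      have "runs [enc_nat h, egraph, enc_nat k] main_e (enc_answer (Some (bags (taken t)))) (B ^ k * T_main n)"
        unfolding main_e_def
        by (rule runs_le, (erule runs_absurd | rule runs_rules upt le rounds bags)+) (use cost in auto)
      moreover have "correct_answer G k (Some (bags (taken t)))"
        using bags_decomposition[OF X] False by simp
      ultimately show ?thesis by blast
    qed
  qed
qed

end

theorem theorem1:
  shows "\<exists>(P :: expr list) (main :: expr) (c :: nat).
    \<forall>(h :: nat) (k :: nat) (n :: nat) (G :: nat pair_pre_digraph).
      h \<ge> 1 \<longrightarrow> k \<ge> 1 \<longrightarrow>
      pair_digraph G \<longrightarrow> pverts G = {..<n} \<longrightarrow> semicomplete h G \<longrightarrow>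
      (\<exists>t answer.
        evaluates P [enc_nat h, enc_digraph n G, enc_nat k] main (enc_answer answer) t \<and>
        t \<le> c * (h + 2 * k + 1) ^ (2 * k) * (max 1 n) ^ c \<and>
        correct_answer G k answer)"
proof -
  obtain c where c: "\<And>n. T_main n \<le> c * (n + 1) ^ c"
    using poly_bounded_main unfolding poly_bounded_def by blast
  \<comment> \<open>The first summand absorbs the factor from
    \<open>n + 1 \<le> 2 * max 1 n\<close>, the second makes the exponent at least
    \<open>c\<close>.\<close>
  let ?c = "c * 2 ^ c + c"
  have poly: "T_main n \<le> ?c * max 1 n ^ ?c" for n
  proof -
    have "(n + 1) ^ c \<le> (2 * max 1 n) ^ c" by (intro power_mono) auto
    then have "c * (n + 1) ^ c \<le> c * 2 ^ c * max 1 n ^ c"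
      using mult_le_mono2[of "(n + 1) ^ c" "(2 * max 1 n) ^ c" c] by (simp add: power_mult_distrib)
    also have "\<dots> \<le> ?c * max 1 n ^ ?c" by (intro mult_le_mono power_increasing) auto
    finally show ?thesis using c[of n] by linarith
  qed
  have main: "\<exists>t answer. evaluates prog [enc_nat h, enc_digraph n G, enc_nat k] main_e (enc_answer answer) t \<and>
      t \<le> ?c * (h + 2 * k + 1) ^ (2 * k) * max 1 n ^ ?c \<and> correct_answer G k answer"
    if k: "k \<ge> 1" and G: "pair_digraph G" "pverts G = {..<n}" "semicomplete h G" for h k n G
  proof -
    interpret pair_digraph G by fact
    interpret ordered_digraph n k "parcs G" G
    proof unfold_locales
      show "parcs G \<subseteq> {..<n} \<times> {..<n}" using in_arcsD1 in_arcsD2 G(2) by auto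
      show "(v, v) \<notin> parcs G" for v using no_loops' by blast
    qed (use G(2) in auto)
    let ?B = "h + 2 * k + 1"
    have B: "card {v \<in> {..<n} - X. card (inb (insert v X)) \<le> k} \<le> ?B" for X
      using G(2,3) by (intro card_cands) (simp add: semicomplete_def non_neighbors_def)
    have "2 \<le> ?B" using k by simp
    from run_main[OF G(1) this B, of h] obtain answer t where
      a: "correct_answer G k answer" "t \<le> ?B ^ k * T_main n"
        "evaluates prog [enc_nat h, egraph, enc_nat k] main_e (enc_answer answer) t"
      unfolding runs_def by blast
    note a(2)
    \<comment> \<open>The search tree accounts for \<open>?B ^ k\<close>; the exponent
      \<open>2 * k\<close> follows by monotonicity.\<close>
    also have "?B ^ k * T_main n \<le> ?B ^ (2 * k) * (?c * max 1 n ^ ?c)"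
      by (intro mult_le_mono power_increasing poly) auto
    also have "\<dots> = ?c * ?B ^ (2 * k) * max 1 n ^ ?c" by (simp only: mult_ac)
    finally show ?thesis using a(1,3) by (auto simp: egraph_def enc_digraph_def)
  qed
  then show ?thesis by blast
qed

end
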